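(* (i) Let $N$ be a nonnegative integer, $\Lambda>0$, and $\delta$ a positive rational number with $2/\delta\notin\{1,\dots,N\}$. Then there exist integers $N',I,J$, rational numbers $\varepsilon',\delta'$, and polynomials $F_1,\dots,F_I,G_1,\dots,G_J\in\mathbb{Z}[A_1,\dots,A_N]$ of degrees at most $N'$ such that for every monic polynomial $Q(z)=\sum_{i=0}^Na_iz^{N-i}$ ($a_0=1$) all of whose zeros lie in $B_{\Lambda/2}$: $\int_{B_\Lambda}|Q(z)|^{-\delta}dV=\infty$ if and only if $G_j(a_1,\dots,a_N)=0$ for all $j$; and otherwise both sides of $$\int_{B_\Lambda}|Q(z)|^{-\delta}dV\ \sim\ \frac{\big(\sum_{i=1}^I|F_i(a_1,\dots,a_N)|^2\big)^{\varepsilon'/2}}{\big(\sum_{j=1}^J|G_j(a_1,\dots,a_N)|^2\big)^{\delta'/2}}$$ are finite and each is bounded by a constant multiple of the other, with constants depending only on $N,\delta,\Lambda$. (ii) When in addition $\delta<4/N$, one can take $I=1$ and $F_1=1$ in (i).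
   Context: $dV$ is Lebesgue measure on $\mathbb{C}$ and $B_r$ the open disk of radius $r$ centered at $0$. *)

theory Defs
  imports "HOL-Analysis.Analysis"
begin

text \<open>Multivariate integer polynomials in the variables A_1,...,A_N of total degree at most D,
  represented by their coefficient function on exponent vectors. An exponent vector
  alpha :: nat => nat assigns to variable A_i (1 <= i <= N) the exponent alpha i;
  only exponent vectors supported in {1..N} with total degree <= D are used.\<close>

definition mono_set :: "nat \<Rightarrow> nat \<Rightarrow> (nat \<Rightarrow> nat) set" where
  "mono_set N D = {\<alpha>. (\<forall>i. (i < 1 \<or> i > N) \<longrightarrow> \<alpha> i = 0) \<and> (\<Sum>i\<in>{1..N}. \<alpha> i) \<le> D}"

definition mpoly_eval :: "nat \<Rightarrow> nat \<Rightarrow> ((nat \<Rightarrow> nat) \<Rightarrow> int) \<Rightarrow> (nat \<Rightarrow> complex) \<Rightarrow> complex" where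
  "mpoly_eval N D c a = (\<Sum>\<alpha>\<in>mono_set N D. of_int (c \<alpha>) * (\<Prod>i\<in>{1..N}. a i ^ \<alpha> i))"

definition mpoly_one :: "(nat \<Rightarrow> nat) \<Rightarrow> int" where
  "mpoly_one \<alpha> = (if \<alpha> = (\<lambda>_. 0) then 1 else 0)"

text \<open>The monic polynomial Q(z) = sum_{i=0}^N a_i z^(N-i) (with a_0 = 1 imposed separately).\<close>
definition Qpoly :: "nat \<Rightarrow> (nat \<Rightarrow> complex) \<Rightarrow> complex \<Rightarrow> complex" where
  "Qpoly N a z = (\<Sum>i\<le>N. a i * z ^ (N - i))"

definition negpow_integral :: "nat \<Rightarrow> real \<Rightarrow> real \<Rightarrow> (nat \<Rightarrow> complex) \<Rightarrow> ennreal" where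
  "negpow_integral N \<delta> \<Lambda> a =
     (\<integral>\<^sup>+ z \<in> ball 0 \<Lambda>. ennreal (cmod (Qpoly N a z) powr (- \<delta>)) \<partial>lborel)"

definition asymp_formula ::
  "nat \<Rightarrow> real \<Rightarrow> real \<Rightarrow> nat \<Rightarrow> nat \<Rightarrow> nat \<Rightarrow> real \<Rightarrow> real
     \<Rightarrow> (nat \<Rightarrow> (nat \<Rightarrow> nat) \<Rightarrow> int) \<Rightarrow> (nat \<Rightarrow> (nat \<Rightarrow> nat) \<Rightarrow> int) \<Rightarrow> bool" where
  "asymp_formula N \<delta> \<Lambda> N' I J \<epsilon>' \<delta>' F G \<longleftrightarrow>
     (\<exists>C>0. \<forall>a :: nat \<Rightarrow> complex.
        a 0 = 1 \<longrightarrow> (\<forall>z. Qpoly N a z = 0 \<longrightarrow> z \<in> ball 0 (\<Lambda>/2)) \<longrightarrow>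
        ((negpow_integral N \<delta> \<Lambda> a = \<infinity> \<longleftrightarrow> (\<forall>j<J. mpoly_eval N N' (G j) a = 0)) \<and>
         (negpow_integral N \<delta> \<Lambda> a \<noteq> \<infinity> \<longrightarrow>
           (let R = (\<Sum>i<I. (cmod (mpoly_eval N N' (F i) a))\<^sup>2) powr (\<epsilon>' / 2)
                    / (\<Sum>j<J. (cmod (mpoly_eval N N' (G j) a))\<^sup>2) powr (\<delta>' / 2)
            in negpow_integral N \<delta> \<Lambda> a \<le> ennreal (C * R) \<and>
               ennreal R \<le> C * negpow_integral N \<delta> \<Lambda> a))))"

end

theory Submission
  imports Defs "HOL-Computational_Algebra.Fundamental_Theorem_Algebra"
begin

text \<open>
  Write \<open>2 / \<delta> = p / q\<close> and let \<open>\<alpha>\<^sub>i\<close> be the zeros of \<open>Q\<close>. Comparing \<open>\<bar>Q(z)\<bar>\<close> with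
  \<open>\<Prod>\<^sub>j max r \<bar>\<alpha>\<^sub>i - \<alpha>\<^sub>j\<bar>\<close>, where \<open>\<alpha>\<^sub>i\<close> is the zero nearest to \<open>z\<close> and \<open>r\<close> its distance, shows that
  the integral is comparable to the largest of the numbers \<open>M\<^sub>i\<close> to the power \<open>- \<delta> / q\<close>, where
  \<open>M\<^sub>i\<close> is the minimum over \<open>\<rho>\<close> of \<open>\<rho> ^ (-p) \<Prod>\<^sub>j max \<rho> \<bar>\<alpha>\<^sub>i - \<alpha>\<^sub>j\<bar> ^ q\<close>. If every zero is repeated
  \<open>q\<close> times, \<open>M\<^sub>i\<close> is the product of the \<open>q N - p\<close> largest distances from \<open>\<alpha>\<^sub>i\<close>, i.e. a maximum of
  moduli of monomials in the differences of the zeros; and \<open>1 / min M\<^sub>i\<close> is the quotient of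
  \<open>max\<^sub>i \<Prod>\<^sub>j\<^sub>\<noteq>\<^sub>i M\<^sub>j\<close> by \<open>\<Prod>\<^sub>j M\<^sub>j\<close>. If \<open>N \<delta> < 4\<close>, then \<open>min M\<^sub>i\<close> itself is comparable to the maximum over all
  choices of \<open>q N - p\<close> disjoint pairs of the product of their distances.

  A maximum of moduli over a family that is symmetric in the zeros is comparable to an expression
  in the power sums of the family, and these are integer polynomials in the coefficients of \<open>Q\<close> by
  Newton's identities.
\<close>

section \<open>Symmetrisation over lists without repetition\<close>

text \<open>The hypothesis that 2/\<delta> is not an integer enters as a dichotomy. If 2/\<delta> <
  N, each zero \<alpha>_i has a threshold distance D_i, possibly 0, with fewer than 2/\<delta> zeros
  strictly closer and more than 2/\<delta> zeros at distance at most D_i. Around \<alpha>_i the size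
  of |Q|^(-\<delta>) therefore grows more slowly than r^(-2) below the scale D_i and decays faster
  than r^(-2) above it. The mass sits at the scale D_i without a logarithm, and divergence means
  that some D_i is 0.

  The obstacle is that D_i is not algebraic in the coefficients. It disappears because D_i minimises
  the expression defining M_i. A monomial realising that minimum has to discard the p/q nearest
  zeros, and repeating zeros q times turns this into discarding p copies.

  The bound N \<delta> < 4 makes room for the pairs: q N - p disjoint pairs exist among q N copies
  only if q N \<le> 2 p.\<close>

definition dlists :: "nat \<Rightarrow> 'a set \<Rightarrow> 'a list set" where
  "dlists m V = {xs. length xs = m \<and> distinct xs \<and> set xs \<subseteq> V}"

lemma finite_dlists: "finite V \<Longrightarrow> finite (dlists m V)"
  by (rule finite_subset[OF _ finite_lists_length_eq[of V m]]) (auto simp: dlists_def)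

lemma dlistsD:
  assumes "xs \<in> dlists m V"
  shows "length xs = m" "distinct xs" "set xs \<subseteq> V" "l < m \<Longrightarrow> xs ! l \<in> V"
  using assms by (auto simp: dlists_def subset_iff)

lemma dlists_0: "dlists 0 V = {[]}"
  by (auto simp: dlists_def)

lemma sum_dlists_Suc:
  assumes "finite V"
  shows "(\<Sum>ys\<in>dlists (Suc m) V. f ys) = (\<Sum>xs\<in>dlists m V. \<Sum>v\<in>V - set xs. f (v # xs))"
proof -
  have "dlists (Suc m) V = (\<lambda>(xs, v). v # xs) ` Sigma (dlists m V) (\<lambda>xs. V - set xs)"
  proof (intro set_eqI iffI)
    fix ys assume "ys \<in> dlists (Suc m) V"
    then obtain v xs where "ys = v # xs" "xs \<in> dlists m V" "v \<in> V - set xs"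
      by (cases ys) (auto simp: dlists_def)
    then show "ys \<in> (\<lambda>(xs, v). v # xs) ` Sigma (dlists m V) (\<lambda>xs. V - set xs)"
      by force
  qed (auto simp: dlists_def)
  moreover have "inj_on (\<lambda>(xs, v). v # xs) (Sigma (dlists m V) (\<lambda>xs. V - set xs))"
    by (auto simp: inj_on_def)
  ultimately have "(\<Sum>ys\<in>dlists (Suc m) V. f ys)
      = (\<Sum>(xs, v)\<in>Sigma (dlists m V) (\<lambda>xs. V - set xs). f (v # xs))"
    by (simp add: sum.reindex case_prod_unfold)
  also have "\<dots> = (\<Sum>xs\<in>dlists m V. \<Sum>v\<in>V - set xs. f (v # xs))"
    using assms by (subst sum.Sigma) (auto simp: finite_dlists)
  finally show ?thesis .
qed

lemma prod_nth_distinct: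
  assumes "distinct xs" "length xs = m"
  shows "(\<Prod>l<m. f (xs ! l)) = (\<Prod>v\<in>set xs. f v)"
  using prod.reindex_bij_betw[OF bij_betw_nth[OF assms(1) refl refl], of f] assms(2) by simp

text \<open>A subring of the complex functions on an arbitrary type. The type stays abstract because
  the symmetrisation is applied to functions of the zeros alone and also to functions of the zeros
  together with one distinguished centre.\<close>

definition fun_ring :: "('c \<Rightarrow> complex) set \<Rightarrow> bool" where
  "fun_ring R \<longleftrightarrow> (\<forall>k. (\<lambda>_. of_int k) \<in> R) \<and>
     (\<forall>f\<in>R. \<forall>g\<in>R. (\<lambda>c. f c + g c) \<in> R \<and> (\<lambda>c. f c * g c) \<in> R)"

lemma fun_ring_of_int: "fun_ring R \<Longrightarrow> (\<lambda>_. of_int k) \<in> R"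
  and fun_ring_add: "fun_ring R \<Longrightarrow> f \<in> R \<Longrightarrow> g \<in> R \<Longrightarrow> (\<lambda>c. f c + g c) \<in> R"
  and fun_ring_mult: "fun_ring R \<Longrightarrow> f \<in> R \<Longrightarrow> g \<in> R \<Longrightarrow> (\<lambda>c. f c * g c) \<in> R"
  by (auto simp: fun_ring_def)

lemma fun_ring_uminus: "fun_ring R \<Longrightarrow> f \<in> R \<Longrightarrow> (\<lambda>c. - f c) \<in> R"
  using fun_ring_mult[OF _ fun_ring_of_int[of R "-1"], of f] by simp

lemma fun_ring_diff: "fun_ring R \<Longrightarrow> f \<in> R \<Longrightarrow> g \<in> R \<Longrightarrow> (\<lambda>c. f c - g c) \<in> R"
  using fun_ring_add[OF _ _ fun_ring_uminus, of R f g] by simp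

lemma fun_ring_sum:
  assumes "fun_ring R" "\<And>t. t \<in> A \<Longrightarrow> f t \<in> R"
  shows "(\<lambda>c. \<Sum>t\<in>A. f t c) \<in> R"
  using assms(2)
proof (induction A rule: infinite_finite_induct)
  case (insert x F)
  then show ?case by (simp add: fun_ring_add[OF assms(1)])
qed (use fun_ring_of_int[OF assms(1), of 0] in simp_all)

lemma fun_ring_prod:
  assumes "fun_ring R" "\<And>t. t \<in> A \<Longrightarrow> f t \<in> R"
  shows "(\<lambda>c. \<Prod>t\<in>A. f t c) \<in> R"
  using assms(2)
proof (induction A rule: infinite_finite_induct)
  case (insert x F)
  then show ?case by (simp add: fun_ring_mult[OF assms(1)])
qed (use fun_ring_of_int[OF assms(1), of 1] in simp_all)

lemma fun_ring_power: "fun_ring R \<Longrightarrow> f \<in> R \<Longrightarrow> (\<lambda>c. f c ^ k) \<in> R"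
  using fun_ring_prod[of R "{..<k}" "\<lambda>_. f"] by simp

text \<open>Polynomials are kept as functions of a parameter and a vector of variables, the
  coefficients being functions of the parameter. Generating them from monomials by addition gives
  the induction that reduces symmetrisation to a single monomial.\<close>

inductive_set poly_over ::
    "('c \<Rightarrow> complex) set \<Rightarrow> nat \<Rightarrow> ('c \<times> (nat \<Rightarrow> complex) \<Rightarrow> complex) set"
  for R m where
  mono: "c \<in> R \<Longrightarrow> (\<lambda>y. c (fst y) * (\<Prod>i<m. snd y i ^ e i)) \<in> poly_over R m"
| add: "f \<in> poly_over R m \<Longrightarrow> g \<in> poly_over R m \<Longrightarrow> (\<lambda>y. f y + g y) \<in> poly_over R m"

lemma poly_over_coeff: "c \<in> R \<Longrightarrow> (\<lambda>y. c (fst y)) \<in> poly_over R m"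
  using poly_over.mono[where c = c and e = "\<lambda>_. 0"] by simp

lemma poly_over_var:
  assumes "fun_ring R" "i < m"
  shows "(\<lambda>y. snd y i) \<in> poly_over R m"
proof -
  have "(\<Prod>j<m. x j ^ (if j = i then 1 else 0)) = x i" for x :: "nat \<Rightarrow> complex"
    using assms(2) by (simp add: if_distrib[of "\<lambda>e. _ ^ e"] prod.delta cong: if_cong)
  note eq = this
  show ?thesis
    using poly_over.mono[OF fun_ring_of_int[OF assms(1), of 1], where m = m and e = "\<lambda>j. if j = i then 1 else 0"]
    unfolding eq by simp
qed

lemma fun_ring_poly_over:
  assumes R: "fun_ring R"
  shows "fun_ring (poly_over R m)"
  unfolding fun_ring_def
proof (intro conjI allI ballI)
  show "(\<lambda>_. of_int k) \<in> poly_over R m" for k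
    using poly_over_coeff[OF fun_ring_of_int[OF R]] .
  fix f g assume f: "f \<in> poly_over R m" and g: "g \<in> poly_over R m"
  then show "(\<lambda>y. f y + g y) \<in> poly_over R m"
    by (rule poly_over.add)
  show "(\<lambda>y. f y * g y) \<in> poly_over R m"
    using f
  proof induction
    case (mono c e)
    note c = mono
    show ?case
      using g
    proof induction
      case (mono c' e')
      have "(\<lambda>y. (c (fst y) * c' (fst y)) * (\<Prod>i<m. snd y i ^ (e i + e' i))) \<in> poly_over R m"
        by (rule poly_over.mono, rule fun_ring_mult[OF R c mono])
      then show ?case
        by (simp add: power_add prod.distrib mult_ac)
    next
      case (add g1 g2)
      then show ?case
        using poly_over.add[OF add.IH] by (simp add: algebra_simps)
    qed
  next
    case (add f1 f2)
    then show ?case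
      using poly_over.add[OF add.IH] by (simp add: algebra_simps)
  qed
qed

text \<open>Induction on the number of slots. Letting the head run over all of \<open>V\<close>
  splits off a power sum; the terms in which it coincides with an entry of the tail are subtracted.
  Coinciding with slot \<open>j\<close> merely adds the exponent of the head to that of slot
  \<open>j\<close>, so only shorter monomials remain.\<close>

lemma sum_dlists_monomial:
  assumes R: "fun_ring R" and V: "finite V"
    and ps: "\<And>k. (\<lambda>c. \<Sum>v\<in>V. b c v ^ k) \<in> R"
  shows "(\<lambda>c. \<Sum>xs\<in>dlists m V. \<Prod>i<m. b c (xs ! i) ^ e i) \<in> R"
proof (induction m arbitrary: e)
  case 0
  then show ?case using fun_ring_of_int[OF R, of 1] by (simp add: dlists_0)
next
  case (Suc m)
  let ?e' = "\<lambda>i. e (Suc i)"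
  have eq: "(\<Sum>xs\<in>dlists (Suc m) V. \<Prod>i<Suc m. b c (xs ! i) ^ e i) =
      (\<Sum>v\<in>V. b c v ^ e 0) * (\<Sum>xs\<in>dlists m V. \<Prod>i<m. b c (xs ! i) ^ ?e' i) -
      (\<Sum>j<m. \<Sum>xs\<in>dlists m V. \<Prod>i<m. b c (xs ! i) ^ (?e' i + (if i = j then e 0 else 0)))" for c
  proof -
    have "(\<Sum>v\<in>V - set xs. \<Prod>i<Suc m. b c ((v # xs) ! i) ^ e i) =
        (\<Sum>v\<in>V. b c v ^ e 0) * (\<Prod>i<m. b c (xs ! i) ^ ?e' i) -
        (\<Sum>j<m. \<Prod>i<m. b c (xs ! i) ^ (?e' i + (if i = j then e 0 else 0)))"
      if xs: "xs \<in> dlists m V" for xs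
    proof -
      have "(\<Sum>v\<in>V - set xs. \<Prod>i<Suc m. b c ((v # xs) ! i) ^ e i) =
          (\<Sum>v\<in>V - set xs. b c v ^ e 0) * (\<Prod>i<m. b c (xs ! i) ^ ?e' i)"
        by (simp add: prod.lessThan_Suc_shift sum_distrib_right del: prod.lessThan_Suc)
      also have "(\<Sum>v\<in>V - set xs. b c v ^ e 0) = (\<Sum>v\<in>V. b c v ^ e 0) - (\<Sum>v\<in>set xs. b c v ^ e 0)"
        using V dlistsD(3)[OF xs] by (simp add: sum_diff)
      also have "(\<Sum>v\<in>set xs. b c v ^ e 0) = (\<Sum>j<m. b c (xs ! j) ^ e 0)"
        using sum.reindex_bij_betw[OF bij_betw_nth[OF dlistsD(2)[OF xs] refl refl],
            of "\<lambda>v. b c v ^ e 0"] dlistsD(1)[OF xs] by simp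
      finally have 1: "(\<Sum>v\<in>V - set xs. \<Prod>i<Suc m. b c ((v # xs) ! i) ^ e i) =
          (\<Sum>v\<in>V. b c v ^ e 0) * (\<Prod>i<m. b c (xs ! i) ^ ?e' i) -
          (\<Sum>j<m. b c (xs ! j) ^ e 0 * (\<Prod>i<m. b c (xs ! i) ^ ?e' i))"
        by (simp add: algebra_simps sum_distrib_left sum_distrib_right)
      have "(\<Prod>i<m. b c (xs ! i) ^ (?e' i + (if i = j then e 0 else 0))) =
          b c (xs ! j) ^ e 0 * (\<Prod>i<m. b c (xs ! i) ^ ?e' i)" if "j < m" for j
      proof -
        have "(\<Prod>i<m. b c (xs ! i) ^ (if i = j then e 0 else 0)) = b c (xs ! j) ^ e 0"
          using that by (simp add: if_distrib[of "\<lambda>e. _ ^ e"] prod.delta cong: if_cong)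
        then show ?thesis by (simp add: power_add prod.distrib)
      qed
      then show ?thesis using 1 by simp
    qed
    then show ?thesis
      by (subst sum_dlists_Suc[OF V])
         (simp add: sum_subtractf sum_distrib_left sum.swap[of _ "{..<m}"])
  qed
  show ?case
    unfolding eq
    by (intro fun_ring_diff[OF R] fun_ring_mult[OF R] ps Suc.IH fun_ring_sum[OF R])
qed

text \<open>Summing over lists without repetition makes every polynomial symmetric, so that only power
  sums survive; this replaces the fundamental theorem on symmetric polynomials.\<close>

lemma sum_dlists_poly_over:
  assumes R: "fun_ring R" and V: "finite V"
    and ps: "\<And>k. (\<lambda>c. \<Sum>v\<in>V. b c v ^ k) \<in> R"
    and f: "f \<in> poly_over R m"
  shows "(\<lambda>c. \<Sum>xs\<in>dlists m V. f (c, \<lambda>i. b c (xs ! i))) \<in> R"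
  using f
proof induction
  case (mono c e)
  show ?case
    using fun_ring_mult[OF R mono sum_dlists_monomial[OF R V ps, where m = m and e = e]]
    by (simp add: sum_distrib_left)
next
  case (add f g)
  then show ?case using fun_ring_add[OF R add.IH] by (simp add: sum.distrib)
qed

section \<open>Integer polynomials and Newton identities\<close>

lemma finite_mono_set: "finite (mono_set N D)"
proof -
  have "mono_set N D \<subseteq> {\<alpha>. \<forall>i. (i \<in> {1..N} \<longrightarrow> \<alpha> i \<in> {..D}) \<and> (i \<notin> {1..N} \<longrightarrow> \<alpha> i = 0)}"
  proof
    fix \<alpha> assume a: "\<alpha> \<in> mono_set N D"
    have "\<alpha> i \<le> D" if "i \<in> {1..N}" for i
      using a member_le_sum[OF that, of \<alpha>] by (auto simp: mono_set_def)
    then show "\<alpha> \<in> {\<alpha>. \<forall>i. (i \<in> {1..N} \<longrightarrow> \<alpha> i \<in> {..D}) \<and> (i \<notin> {1..N} \<longrightarrow> \<alpha> i = 0)}"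
      using a by (auto simp: mono_set_def not_less_eq_eq)
  qed
  then show ?thesis
    by (rule finite_subset) (rule finite_set_of_finite_funs; simp)
qed

text \<open>Padding with zero coefficients. It is needed because all polynomials of the final
  formula share one degree bound.\<close>

lemma mpoly_eval_degree_mono:
  assumes "D \<le> D'"
  shows "\<exists>c'. \<forall>a. mpoly_eval N D c a = mpoly_eval N D' c' a"
proof -
  have sub: "mono_set N D \<subseteq> mono_set N D'"
    using assms by (auto simp: mono_set_def)
  have "mpoly_eval N D c a = mpoly_eval N D' (\<lambda>\<alpha>. if \<alpha> \<in> mono_set N D then c \<alpha> else 0) a" for a
    unfolding mpoly_eval_def
    by (rule sum.mono_neutral_cong_left[OF finite_mono_set sub]) auto
  then show ?thesis by blast
qed

lemma mpoly_eval_cong: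
  assumes "\<And>i. i \<in> {1..N} \<Longrightarrow> a i = b i"
  shows "mpoly_eval N D c a = mpoly_eval N D c b"
  unfolding mpoly_eval_def using assms by (intro sum.cong refl arg_cong2[of _ _ _ _ "(*)"] prod.cong) auto

lemma mpoly_eval_one: "mpoly_eval N D mpoly_one a = 1"
proof -
  have "mpoly_eval N D mpoly_one a = (\<Sum>\<alpha>\<in>mono_set N D. if \<alpha> = (\<lambda>_. 0) then 1 else 0)"
    unfolding mpoly_eval_def by (intro sum.cong) (auto simp: mpoly_one_def)
  also have "\<dots> = 1"
    by (simp add: sum.delta finite_mono_set) (simp add: mono_set_def)
  finally show ?thesis .
qed

definition int_mpolys :: "nat \<Rightarrow> ((nat \<Rightarrow> complex) \<Rightarrow> complex) set" where
  "int_mpolys N = {f. \<exists>D c. \<forall>a. f a = mpoly_eval N D c a}"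

lemma int_mpolys_add:
  assumes "f \<in> int_mpolys N" "g \<in> int_mpolys N"
  shows "(\<lambda>a. f a + g a) \<in> int_mpolys N"
proof -
  obtain D1 c1 D2 c2 where f: "\<And>a. f a = mpoly_eval N D1 c1 a" and g: "\<And>a. g a = mpoly_eval N D2 c2 a"
    using assms unfolding int_mpolys_def by blast
  obtain c1' c2' where "\<And>a. f a = mpoly_eval N (max D1 D2) c1' a"
    and "\<And>a. g a = mpoly_eval N (max D1 D2) c2' a"
    using mpoly_eval_degree_mono[of D1 "max D1 D2" N c1] mpoly_eval_degree_mono[of D2 "max D1 D2" N c2]
    unfolding f g by auto
  then have "f a + g a = mpoly_eval N (max D1 D2) (\<lambda>\<alpha>. c1' \<alpha> + c2' \<alpha>) a" for a
    by (simp add: mpoly_eval_def sum.distrib algebra_simps)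
  then show ?thesis unfolding int_mpolys_def by blast
qed

lemma int_mpolys_monomial: "(\<lambda>a. of_int k * (\<Prod>i\<in>{1..N}. a i ^ e i)) \<in> int_mpolys N"
proof -
  define e' where "e' = (\<lambda>i. if i \<in> {1..N} then e i else 0)"
  define D where "D = (\<Sum>i\<in>{1..N}. e i)"
  have e': "e' \<in> mono_set N D"
    by (auto simp: mono_set_def e'_def D_def)
  have "mpoly_eval N D (\<lambda>\<alpha>. if \<alpha> = e' then k else 0) a = of_int k * (\<Prod>i\<in>{1..N}. a i ^ e i)" for a
  proof -
    have "mpoly_eval N D (\<lambda>\<alpha>. if \<alpha> = e' then k else 0) a =
        (\<Sum>\<alpha>\<in>mono_set N D. if \<alpha> = e' then of_int k * (\<Prod>i\<in>{1..N}. a i ^ \<alpha> i) else 0)"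
      unfolding mpoly_eval_def by (intro sum.cong) auto
    also have "\<dots> = of_int k * (\<Prod>i\<in>{1..N}. a i ^ e' i)"
      using e' by (simp add: sum.delta finite_mono_set)
    finally show ?thesis by (simp add: e'_def)
  qed
  then show ?thesis unfolding int_mpolys_def by (auto intro!: exI[of _ D] dest: sym)
qed

lemma int_mpolys_sum:
  assumes "\<And>t. t \<in> A \<Longrightarrow> f t \<in> int_mpolys N"
  shows "(\<lambda>a. \<Sum>t\<in>A. f t a) \<in> int_mpolys N"
  using assms
proof (induction A rule: infinite_finite_induct)
  case (insert x F)
  then show ?case by (simp add: int_mpolys_add)
qed (use int_mpolys_monomial[where k = 0 and e = "\<lambda>_. 0"] in simp_all)

lemma fun_ring_int_mpolys: "fun_ring (int_mpolys N)"
  unfolding fun_ring_def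
proof (intro conjI allI ballI)
  show "(\<lambda>_. of_int k) \<in> int_mpolys N" for k
    using int_mpolys_monomial[where k = k and e = "\<lambda>_. 0"] by simp
  fix f g assume fg: "f \<in> int_mpolys N" "g \<in> int_mpolys N"
  then show "(\<lambda>c. f c + g c) \<in> int_mpolys N" by (rule int_mpolys_add)
  obtain D1 c1 D2 c2 where f: "\<And>a. f a = mpoly_eval N D1 c1 a" and g: "\<And>a. g a = mpoly_eval N D2 c2 a"
    using fg unfolding int_mpolys_def by blast
  have "f a * g a = (\<Sum>\<alpha>\<in>mono_set N D1. \<Sum>\<beta>\<in>mono_set N D2.
      of_int (c1 \<alpha> * c2 \<beta>) * (\<Prod>i\<in>{1..N}. a i ^ (\<alpha> i + \<beta> i)))" for a
    unfolding f g mpoly_eval_def sum_product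
    by (intro sum.cong refl) (simp add: power_add prod.distrib mult_ac)
  then show "(\<lambda>c. f c * g c) \<in> int_mpolys N"
    by (simp only:) (intro int_mpolys_sum int_mpolys_monomial)
qed

lemma int_mpolys_var:
  assumes "i \<in> {1..N}"
  shows "(\<lambda>a. a i) \<in> int_mpolys N"
proof -
  have "(\<Prod>j\<in>{1..N}. x j ^ (if j = i then 1 else 0)) = x i" for x :: "nat \<Rightarrow> complex"
    using assms by (simp add: if_distrib[of "\<lambda>e. _ ^ e"] prod.delta cong: if_cong)
  note eq = this
  show ?thesis
    using int_mpolys_monomial[where k = 1 and N = N and e = "\<lambda>j. if j = i then 1 else 0"]
    unfolding eq by simp
qed

text \<open>The coefficients of \<open>\<Prod>(1 - x\<^sub>i X)\<close> are those of \<open>\<Prod>(X - x\<^sub>i)\<close> in reverse order.\<close>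

definition vieta_fps :: "'a set \<Rightarrow> ('a \<Rightarrow> complex) \<Rightarrow> complex fps" where
  "vieta_fps S x = (\<Prod>i\<in>S. 1 - fps_const (x i) * fps_X)"

text \<open>Up to the sign (-1)^n the elementary symmetric function of degree \<open>n\<close>; for
  the zeros of \<open>Q\<close> it is the coefficient a_n.\<close>

definition vieta :: "'a set \<Rightarrow> ('a \<Rightarrow> complex) \<Rightarrow> nat \<Rightarrow> complex" where
  "vieta S x n = fps_nth (vieta_fps S x) n"

lemma vieta_0:
  assumes "finite S" shows "vieta S x 0 = 1"
  using assms by (induction S rule: finite_induct) (simp_all add: vieta_def vieta_fps_def)

lemma vieta_insert:
  assumes "finite S" "s \<notin> S"
  shows "vieta (insert s S) x (Suc n) = vieta S x (Suc n) - x s * vieta S x n"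
proof -
  have "vieta_fps (insert s S) x = vieta_fps S x - fps_const (x s) * (fps_X * vieta_fps S x)"
    using assms by (simp add: vieta_fps_def left_diff_distrib mult.assoc)
  then show ?thesis by (simp add: vieta_def)
qed

lemma vieta_eq_0:
  assumes "finite S" "n > card S" shows "vieta S x n = 0"
  using assms
proof (induction S arbitrary: n rule: finite_induct)
  case empty
  then show ?case by (simp add: vieta_def vieta_fps_def)
next
  case (insert s S)
  then obtain m where "n = Suc m" by (cases n) auto
  then show ?case using insert by (simp add: vieta_insert)
qed

lemma prod_eq_vieta:
  assumes "finite S"
  shows "(\<Prod>i\<in>S. z - x i) = (\<Sum>n\<le>card S. vieta S x n * z ^ (card S - n))"
  using assms
proof (induction S rule: finite_induct)
  case empty
  then show ?case by (simp add: vieta_def vieta_fps_def)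
next
  case (insert s S)
  let ?K = "card S"
  have "(\<Sum>n\<le>card (insert s S). vieta (insert s S) x n * z ^ (card (insert s S) - n)) =
     z ^ Suc ?K + (\<Sum>n\<le>?K. (vieta S x (Suc n) - x s * vieta S x n) * z ^ (?K - n))"
    using insert by (simp add: sum.atMost_Suc_shift vieta_0 vieta_insert del: sum.atMost_Suc)
  also have "\<dots> = z ^ Suc ?K + (\<Sum>n\<le>?K. vieta S x (Suc n) * z ^ (?K - n))
       - x s * (\<Sum>n\<le>?K. vieta S x n * z ^ (?K - n))"
    by (simp add: algebra_simps sum_subtractf sum_distrib_left)
  also have "z ^ Suc ?K + (\<Sum>n\<le>?K. vieta S x (Suc n) * z ^ (?K - n)) =
      (\<Sum>n\<le>Suc ?K. vieta S x n * z ^ (Suc ?K - n))"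
    using insert by (simp add: sum.atMost_Suc_shift vieta_0 del: sum.atMost_Suc)
  also have "\<dots> = (\<Sum>n\<le>?K. vieta S x n * z ^ (Suc ?K - n))"
    using insert by (simp add: vieta_eq_0)
  also have "\<dots> = z * (\<Sum>n\<le>?K. vieta S x n * z ^ (?K - n))"
    unfolding sum_distrib_left by (intro sum.cong refl) (simp add: Suc_diff_le)
  finally show ?case
    using insert by (simp add: algebra_simps)
qed

text \<open>The logarithmic derivative of the product, cleared of denominators. In the induction a
  new linear factor times its own geometric series collapses to the constant \<open>x s\<close>,
  which is minus the derivative of that factor.\<close>

lemma newton_fps:
  assumes "finite S"
  shows "vieta_fps S x * Abs_fps (\<lambda>n. \<Sum>i\<in>S. x i ^ Suc n) = - fps_deriv (vieta_fps S x)"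
  using assms
proof (induction S rule: finite_induct)
  case empty
  have "Abs_fps (\<lambda>n. 0) = (0 :: complex fps)" by (simp add: fps_eq_iff)
  then show ?case by (simp add: vieta_fps_def)
next
  case (insert s S)
  let ?l = "1 - fps_const (x s) * fps_X :: complex fps"
  let ?P = "vieta_fps S x" and ?A = "Abs_fps (\<lambda>n. \<Sum>i\<in>S. x i ^ Suc n)"
  have P: "vieta_fps (insert s S) x = ?l * ?P"
    using insert by (simp add: vieta_fps_def)
  have A: "Abs_fps (\<lambda>n. \<Sum>i\<in>insert s S. x i ^ Suc n) = ?A + Abs_fps (\<lambda>n. x s ^ Suc n)"
    using insert by (simp add: fps_eq_iff)
  have "fps_nth (?l * Abs_fps (\<lambda>n. x s ^ Suc n)) n = fps_nth (fps_const (x s)) n" for n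
    by (cases n) (simp_all add: algebra_simps mult.assoc)
  then have geo: "?l * Abs_fps (\<lambda>n. x s ^ Suc n) = fps_const (x s)"
    by (simp add: fps_eq_iff)
  have "vieta_fps (insert s S) x * Abs_fps (\<lambda>n. \<Sum>i\<in>insert s S. x i ^ Suc n) =
      ?l * (?P * ?A) + (?l * Abs_fps (\<lambda>n. x s ^ Suc n)) * ?P"
    unfolding P A by (simp add: algebra_simps)
  also have "\<dots> = - fps_deriv (?l * ?P)"
    unfolding insert.IH geo by (simp add: algebra_simps)
  finally show ?case by (simp add: P)
qed

lemma newton:
  assumes "finite S"
  shows "of_nat (Suc n) * vieta S x (Suc n) = - (\<Sum>j\<le>n. vieta S x j * (\<Sum>i\<in>S. x i ^ Suc (n - j)))"
proof -
  have "(\<Sum>j\<le>n. vieta S x j * (\<Sum>i\<in>S. x i ^ Suc (n - j)))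
      = fps_nth (vieta_fps S x * Abs_fps (\<lambda>n. \<Sum>i\<in>S. x i ^ Suc n)) n"
    by (simp add: fps_mult_nth vieta_def atLeast0AtMost)
  also have "\<dots> = - (of_nat (Suc n) * vieta S x (Suc n))"
    unfolding newton_fps[OF assms] by (simp add: vieta_def)
  finally show ?thesis by simp
qed

text \<open>Newton's identity solved for the power sum, whose coefficient there is 1. No division
  occurs, so integrality is preserved; solving for \<open>vieta\<close> would divide by
  \<open>Suc n\<close>.\<close>

lemma newton_power_sum:
  assumes "finite S"
  shows "(\<Sum>i\<in>S. x i ^ Suc n) = - of_nat (Suc n) * vieta S x (Suc n)
      - (\<Sum>j<n. vieta S x (Suc j) * (\<Sum>i\<in>S. x i ^ (n - j)))"
proof -
  have "(\<Sum>j\<le>n. vieta S x j * (\<Sum>i\<in>S. x i ^ Suc (n - j))) = (\<Sum>i\<in>S. x i ^ Suc n)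
     + (\<Sum>j<n. vieta S x (Suc j) * (\<Sum>i\<in>S. x i ^ Suc (n - Suc j)))"
    using assms by (simp add: lessThan_Suc_atMost[symmetric] sum.lessThan_Suc_shift vieta_0 del: sum.lessThan_Suc)
  also have "(\<Sum>j<n. vieta S x (Suc j) * (\<Sum>i\<in>S. x i ^ Suc (n - Suc j))) =
      (\<Sum>j<n. vieta S x (Suc j) * (\<Sum>i\<in>S. x i ^ (n - j)))"
    by (intro sum.cong refl) (simp add: Suc_diff_Suc del: power_Suc)
  finally have "of_nat (Suc n) * vieta S x (Suc n) = - ((\<Sum>i\<in>S. x i ^ Suc n)
     + (\<Sum>j<n. vieta S x (Suc j) * (\<Sum>i\<in>S. x i ^ (n - j))))"
    using newton[OF assms, of n x] by simp
  moreover have "A = - (P + B) \<Longrightarrow> P = - A - B" for A P B :: complex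
    by simp
  ultimately have "(\<Sum>i\<in>S. x i ^ Suc n) = - (of_nat (Suc n) * vieta S x (Suc n))
      - (\<Sum>j<n. vieta S x (Suc j) * (\<Sum>i\<in>S. x i ^ (n - j)))" by blast
  then show ?thesis by (simp only: mult_minus_left)
qed

section \<open>Functions of the zeros that are integer polynomials in the coefficients\<close>

definition sym_polys :: "nat \<Rightarrow> ((nat \<Rightarrow> complex) \<Rightarrow> complex) set" where
  "sym_polys N = {f. \<exists>g\<in>int_mpolys N. \<forall>\<alpha>. f \<alpha> = g (vieta {..<N} \<alpha>)}"

lemma sym_polysI: "g \<in> int_mpolys N \<Longrightarrow> (\<lambda>\<alpha>. g (vieta {..<N} \<alpha>)) \<in> sym_polys N"
  unfolding sym_polys_def by blast

lemma fun_ring_sym_polys: "fun_ring (sym_polys N)"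
  unfolding fun_ring_def
proof (intro conjI allI ballI)
  show "(\<lambda>_. of_int k) \<in> sym_polys N" for k
    using sym_polysI[OF fun_ring_of_int[OF fun_ring_int_mpolys]] .
  fix f g assume "f \<in> sym_polys N" "g \<in> sym_polys N"
  then obtain f' g' where fg': "f' \<in> int_mpolys N" "g' \<in> int_mpolys N"
    and "\<forall>\<alpha>. f \<alpha> = f' (vieta {..<N} \<alpha>)" "\<forall>\<alpha>. g \<alpha> = g' (vieta {..<N} \<alpha>)"
    unfolding sym_polys_def by blast
  then have eq: "f = (\<lambda>\<alpha>. f' (vieta {..<N} \<alpha>))" "g = (\<lambda>\<alpha>. g' (vieta {..<N} \<alpha>))"
    by blast+
  show "(\<lambda>c. f c + g c) \<in> sym_polys N" "(\<lambda>c. f c * g c) \<in> sym_polys N"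
    unfolding eq
    using sym_polysI[OF fun_ring_add[OF fun_ring_int_mpolys fg']]
      sym_polysI[OF fun_ring_mult[OF fun_ring_int_mpolys fg']] by auto
qed

lemma sym_polys_vieta: "(\<lambda>\<alpha>. vieta {..<N} \<alpha> n) \<in> sym_polys N"
proof (cases "n \<in> {1..N}")
  case True
  show ?thesis using sym_polysI[OF int_mpolys_var[OF True]] .
next
  case False
  then have "vieta {..<N} \<alpha> n = of_int (if n = 0 then 1 else 0)" for \<alpha>
    by (auto simp: vieta_0 vieta_eq_0)
  then show ?thesis using fun_ring_of_int[OF fun_ring_sym_polys] by simp
qed

lemma sym_polys_power_sum: "(\<lambda>\<alpha>. \<Sum>i<N. \<alpha> i ^ k) \<in> sym_polys N"
proof (induction k rule: less_induct)
  case (less k)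
  note R = fun_ring_sym_polys[of N]
  show ?case
  proof (cases k)
    case 0
    then show ?thesis using fun_ring_of_int[OF R, of "int N"] by simp
  next
    case (Suc n)
    have "(\<lambda>\<alpha>. of_int (- int (Suc n)) * vieta {..<N} \<alpha> (Suc n)
      - (\<Sum>j<n. vieta {..<N} \<alpha> (Suc j) * (\<Sum>i<N. \<alpha> i ^ (n - j)))) \<in> sym_polys N"
      by (intro fun_ring_diff[OF R] fun_ring_mult[OF R] fun_ring_sum[OF R] fun_ring_of_int[OF R]
          sym_polys_vieta less.IH) (use Suc in auto)
    moreover have "(\<lambda>\<alpha>. of_int (- int (Suc n)) * vieta {..<N} \<alpha> (Suc n)
      - (\<Sum>j<n. vieta {..<N} \<alpha> (Suc j) * (\<Sum>i<N. \<alpha> i ^ (n - j)))) = (\<lambda>\<alpha>. \<Sum>i<N. \<alpha> i ^ k)"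
      unfolding Suc by (subst newton_power_sum) simp_all
    ultimately show ?thesis by simp
  qed
qed

section \<open>Families controlled by their power sums\<close>

text \<open>Newton's identity of index \<open>Suc m\<close> has \<open>Suc m\<close> terms, each at
  most t^(m+1) by induction. Their number cancels against the factor \<open>Suc m\<close> on the
  left, so no constant accumulates.\<close>

lemma norm_vieta_le:
  assumes S: "finite S" and t: "t \<ge> 0"
    and ps: "\<And>k. k \<in> {1..card S} \<Longrightarrow> cmod (\<Sum>i\<in>S. x i ^ k) \<le> t ^ k"
  shows "n \<le> card S \<Longrightarrow> cmod (vieta S x n) \<le> t ^ n"
proof (induction n rule: less_induct)
  case (less n)
  show ?case
  proof (cases n)
    case 0
    then show ?thesis using S by (simp add: vieta_0)
  next
    case (Suc m)
    have "real (Suc m) * cmod (vieta S x (Suc m)) = cmod (of_nat (Suc m) * vieta S x (Suc m))"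
      by (simp add: norm_mult del: of_nat_Suc)
    also have "\<dots> = cmod (\<Sum>j\<le>m. vieta S x j * (\<Sum>i\<in>S. x i ^ Suc (m - j)))"
      unfolding newton[OF S] by simp
    also have "\<dots> \<le> (\<Sum>j\<le>m. cmod (vieta S x j * (\<Sum>i\<in>S. x i ^ Suc (m - j))))"
      by (rule norm_sum)
    also have "\<dots> \<le> (\<Sum>j\<le>m. t ^ Suc m)"
    proof (rule sum_mono)
      fix j assume j: "j \<in> {..m}"
      have "cmod (vieta S x j * (\<Sum>i\<in>S. x i ^ Suc (m - j))) \<le> t ^ j * t ^ Suc (m - j)"
        unfolding norm_mult
        by (intro mult_mono less.IH ps) (use j less.prems Suc t in auto)
      also have "\<dots> = t ^ Suc m"
        using j by (simp add: power_add[symmetric] del: power_Suc)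
      finally show "cmod (vieta S x j * (\<Sum>i\<in>S. x i ^ Suc (m - j))) \<le> t ^ Suc m" .
    qed
    also have "\<dots> = real (Suc m) * t ^ Suc m" by simp
    finally show ?thesis unfolding Suc by (simp only: mult_le_cancel_left_pos of_nat_0_less_iff zero_less_Suc)
  qed
qed

text \<open>A root bound of Cauchy type. If |x_s| exceeded 2t, the coefficient of index n would be
  at most (|x_s|/2)^n; since the sum of 2^(-n) over 1 \<le> n \<le> K stays below 1, the remaining
  terms could not cancel the leading one.\<close>

lemma norm_le_of_power_sums:
  assumes S: "finite S" and t: "t \<ge> 0" and s: "s \<in> S"
    and ps: "\<And>k. k \<in> {1..card S} \<Longrightarrow> cmod (\<Sum>i\<in>S. x i ^ k) \<le> t ^ k"
  shows "cmod (x s) \<le> 2 * t"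
proof (rule ccontr)
  assume "\<not> ?thesis"
  then have r: "2 * t < cmod (x s)" by simp
  have half_powers: "(\<Sum>n\<in>{1..m}. (1/2::real) ^ n) = 1 - (1/2) ^ m" for m
    by (induction m) (simp_all add: field_simps)
  let ?r = "cmod (x s)" and ?K = "card S"
  have r0: "?r > 0" using r t by linarith
  have "(\<Prod>i\<in>S. x s - x i) = 0"
    using S s by (auto intro!: prod_zero)
  then have "(\<Sum>n\<le>?K. vieta S x n * x s ^ (?K - n)) = 0"
    using prod_eq_vieta[OF S, of "x s" x] by simp
  moreover have "{..?K} = insert 0 {1..?K}" by auto
  ultimately have "x s ^ ?K = - (\<Sum>n\<in>{1..?K}. vieta S x n * x s ^ (?K - n))"
    using S by (simp add: vieta_0 add_eq_0_iff2)
  then have "?r ^ ?K = cmod (\<Sum>n\<in>{1..?K}. vieta S x n * x s ^ (?K - n))"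
    by (metis norm_minus_cancel norm_power)
  also have "\<dots> \<le> (\<Sum>n\<in>{1..?K}. cmod (vieta S x n * x s ^ (?K - n)))"
    by (rule norm_sum)
  also have "\<dots> \<le> (\<Sum>n\<in>{1..?K}. ?r ^ ?K * (1/2) ^ n)"
  proof (rule sum_mono)
    fix n assume n: "n \<in> {1..?K}"
    have "cmod (vieta S x n) \<le> (?r / 2) ^ n"
      using norm_vieta_le[OF S t ps, of n] power_mono[of t "?r / 2" n] n r t by (simp, linarith)
    then have "cmod (vieta S x n * x s ^ (?K - n)) \<le> (?r / 2) ^ n * ?r ^ (?K - n)"
      unfolding norm_mult norm_power by (intro mult_right_mono) auto
    also have "\<dots> = ?r ^ ?K * (1/2) ^ n"
      using n by (simp add: power_divide power_add[symmetric])
    finally show "cmod (vieta S x n * x s ^ (?K - n)) \<le> ?r ^ ?K * (1/2) ^ n" .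
  qed
  also have "\<dots> = ?r ^ ?K * (\<Sum>n\<in>{1..?K}. (1/2) ^ n)"
    by (simp add: sum_distrib_left)
  also have "(\<Sum>n\<in>{1..?K}. (1/2::real) ^ n) = 1 - (1/2) ^ ?K"
    by (rule half_powers)
  also have "?r ^ ?K * (1 - (1/2) ^ ?K) < ?r ^ ?K"
    using r0 by (simp add: algebra_simps)
  finally show False by simp
qed

section \<open>Sums of moduli represented by integer polynomials\<close>

definition sq_sum :: "nat \<Rightarrow> nat \<Rightarrow> nat \<Rightarrow> (nat \<Rightarrow> (nat \<Rightarrow> nat) \<Rightarrow> int) \<Rightarrow> (nat \<Rightarrow> complex) \<Rightarrow> real" where
  "sq_sum N D J G \<alpha> = (\<Sum>j<J. (cmod (mpoly_eval N D (G j) (vieta {..<N} \<alpha>)))\<^sup>2)"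

definition comparable :: "nat \<Rightarrow> nat \<Rightarrow> nat \<Rightarrow> (nat \<Rightarrow> (nat \<Rightarrow> nat) \<Rightarrow> int) \<Rightarrow> nat \<Rightarrow>
    ((nat \<Rightarrow> complex) \<Rightarrow> real) \<Rightarrow> bool" where
  "comparable N D J G L X \<longleftrightarrow> (\<exists>C>0. \<forall>\<alpha>. X \<alpha> ^ (2 * L) \<le> C * sq_sum N D J G \<alpha> \<and>
     sq_sum N D J G \<alpha> \<le> C * X \<alpha> ^ (2 * L))"

definition repres :: "nat \<Rightarrow> ((nat \<Rightarrow> complex) \<Rightarrow> real) \<Rightarrow> bool" where
  "repres N X \<longleftrightarrow> (\<exists>L>0. \<exists>J D0. \<forall>D\<ge>D0. \<exists>G. comparable N D J G L X)"

lemma sym_polys_common_degree: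
  fixes J :: nat
  assumes "\<And>j. j < J \<Longrightarrow> g j \<in> sym_polys N"
  shows "\<exists>D0. \<forall>D\<ge>D0. \<exists>G. \<forall>\<alpha>. \<forall>j<J. g j \<alpha> = mpoly_eval N D (G j) (vieta {..<N} \<alpha>)"
proof -
  have "\<forall>j. \<exists>D c. j < J \<longrightarrow> (\<forall>\<alpha>. g j \<alpha> = mpoly_eval N D c (vieta {..<N} \<alpha>))"
  proof (intro allI)
    fix j
    show "\<exists>D c. j < J \<longrightarrow> (\<forall>\<alpha>. g j \<alpha> = mpoly_eval N D c (vieta {..<N} \<alpha>))"
    proof (cases "j < J")
      case True
      from assms[OF True] show ?thesis unfolding sym_polys_def int_mpolys_def
        by (auto intro!: exI)
    qed simp
  qed
  then obtain Dj cj where D: "\<And>j \<alpha>. j < J \<Longrightarrow> g j \<alpha> = mpoly_eval N (Dj j) (cj j) (vieta {..<N} \<alpha>)"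
    by metis
  show ?thesis
  proof (rule exI[of _ "\<Sum>j<J. Dj j"], intro allI impI)
    fix D assume "D \<ge> (\<Sum>j<J. Dj j)"
    then have "Dj j \<le> D" if "j < J" for j
      using member_le_sum[of j "{..<J}" Dj] that by simp
    then have "\<forall>j. \<exists>c'. j < J \<longrightarrow> (\<forall>a. mpoly_eval N (Dj j) (cj j) a = mpoly_eval N D c' a)"
      using mpoly_eval_degree_mono by blast
    then obtain G where "\<forall>j. j < J \<longrightarrow> (\<forall>a. mpoly_eval N (Dj j) (cj j) a = mpoly_eval N D (G j) a)"
      by metis
    then show "\<exists>G. \<forall>\<alpha>. \<forall>j<J. g j \<alpha> = mpoly_eval N D (G j) (vieta {..<N} \<alpha>)"
      using D by auto
  qed
qed

text \<open>The sizes of the power sums \<open>p\<^sub>k\<close> of a finite family control the family itself; the powers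
  \<open>p\<^sub>k ^ (K! / k)\<close> all have the same weight \<open>K!\<close>.\<close>

lemma repres_sum_norm:
  assumes S: "finite S"
    and ps: "\<And>k. (\<lambda>\<alpha>. \<Sum>s\<in>S. x \<alpha> s ^ k) \<in> sym_polys N"
  shows "repres N (\<lambda>\<alpha>. \<Sum>s\<in>S. cmod (x \<alpha> s))"
proof -
  define K where "K = card S"
  define L where "L = (fact K :: nat)"
  define g where "g = (\<lambda>j \<alpha>. (\<Sum>s\<in>S. x \<alpha> s ^ Suc j) ^ (L div Suc j))"
  have L: "L > 0" by (simp add: L_def)
  have Lj: "Suc j * (L div Suc j) = L" if "j < K" for j
    unfolding L_def using that by (intro dvd_mult_div_cancel dvd_fact) auto
  have "g j \<in> sym_polys N" for j
    unfolding g_def by (intro fun_ring_power[OF fun_ring_sym_polys] ps)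
  then obtain D0 where D0: "\<forall>D\<ge>D0. \<exists>G. \<forall>\<alpha>. \<forall>j<K. g j \<alpha> = mpoly_eval N D (G j) (vieta {..<N} \<alpha>)"
    using sym_polys_common_degree[of K g N] by blast
  define C where "C = (2 * real K) ^ (2 * L) + real K + 1"
  have C: "C > 0" by (simp add: C_def add_nonneg_pos)
  have main: "X ^ (2 * L) \<le> C * Q \<and> Q \<le> C * X ^ (2 * L)"
    if X: "X = (\<Sum>s\<in>S. cmod (x \<alpha> s))" and Q: "Q = (\<Sum>j<K. (cmod (g j \<alpha>))\<^sup>2)" for \<alpha> X Q
  proof
    have X0: "X \<ge> 0" unfolding X by (simp add: sum_nonneg)
    have Q0: "Q \<ge> 0" unfolding Q by (simp add: sum_nonneg)
    have "cmod (g j \<alpha>) \<le> X ^ L" if j: "j < K" for j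
    proof -
      have "cmod (\<Sum>s\<in>S. x \<alpha> s ^ Suc j) \<le> (\<Sum>s\<in>S. cmod (x \<alpha> s) * X ^ j)"
      proof (rule sum_norm_le)
        fix s assume "s \<in> S"
        then have "cmod (x \<alpha> s) \<le> X"
          unfolding X using S by (intro member_le_sum) auto
        then show "cmod (x \<alpha> s ^ Suc j) \<le> cmod (x \<alpha> s) * X ^ j"
          by (simp add: norm_mult norm_power mult_left_mono power_mono)
      qed
      also have "\<dots> = X ^ Suc j" by (simp add: X sum_distrib_right)
      finally have "cmod (g j \<alpha>) \<le> (X ^ Suc j) ^ (L div Suc j)"
        unfolding g_def norm_power by (intro power_mono) auto
      then show ?thesis using Lj[OF j] by (simp add: power_mult[symmetric] del: power_Suc)
    qed
    then have "Q \<le> (\<Sum>j<K. (X ^ L)\<^sup>2)"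
      unfolding Q by (intro sum_mono power_mono) auto
    also have "\<dots> = real K * X ^ (2 * L)" by (simp add: power_mult[symmetric] mult.commute)
    also have "\<dots> \<le> C * X ^ (2 * L)"
      using X0 by (intro mult_right_mono) (auto simp: C_def)
    finally show "Q \<le> C * X ^ (2 * L)" .
    \<comment> \<open>\<open>Q\<close> has weight 2L in the family, so its 2L-th root is the right
      scale: each |g_j| is at most t^L, and extracting a root of order \<open>L div k\<close> leaves
      |p_k| \<le> t^k.\<close>
    define t where "t = root L (sqrt Q)"
    have t0: "t \<ge> 0" using Q0 L by (simp add: t_def)
    have tL: "t ^ L = sqrt Q" using Q0 L by (simp add: t_def)
    have "cmod (x \<alpha> s) \<le> 2 * t" if s: "s \<in> S" for s
    proof (rule norm_le_of_power_sums[OF S t0 s])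
      fix k assume k: "k \<in> {1..card S}"
      then obtain j where j: "k = Suc j" "j < K" by (cases k) (auto simp: K_def)
      have "(cmod (g j \<alpha>))\<^sup>2 \<le> Q"
        unfolding Q using j by (intro member_le_sum) auto
      then have "cmod (g j \<alpha>) \<le> t ^ L" unfolding tL by (rule real_le_rsqrt)
      also have "t ^ L = (t ^ k) ^ (L div k)"
        using Lj[OF j(2)] by (simp add: power_mult[symmetric] j(1) del: power_Suc)
      finally have le: "cmod (\<Sum>s\<in>S. x \<alpha> s ^ k) ^ (L div k) \<le> (t ^ k) ^ (L div k)"
        by (simp add: g_def norm_power j(1))
      have "L div k \<noteq> 0" using Lj[OF j(2)] L j(1) by (metis mult_0_right less_not_refl)
      then show "cmod (\<Sum>s\<in>S. x \<alpha> s ^ k) \<le> t ^ k"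
        using power_mono_iff[of "cmod (\<Sum>s\<in>S. x \<alpha> s ^ k)" "t ^ k" "L div k"] le t0 by simp
    qed
    then have "X \<le> (\<Sum>s\<in>S. 2 * t)" unfolding X by (intro sum_mono)
    then have "X \<le> 2 * real K * t" by (simp add: K_def)
    then have "X ^ (2 * L) \<le> (2 * real K * t) ^ (2 * L)" using X0 by (intro power_mono)
    also have "\<dots> = (2 * real K) ^ (2 * L) * (t ^ L)\<^sup>2"
      by (simp add: power_mult_distrib power_mult[symmetric] mult.commute)
    also have "\<dots> = (2 * real K) ^ (2 * L) * Q" using Q0 by (simp add: tL)
    also have "\<dots> \<le> C * Q" using Q0 by (intro mult_right_mono) (auto simp: C_def)
    finally show "X ^ (2 * L) \<le> C * Q" .
  qed
  have "\<exists>G. comparable N D K G L (\<lambda>\<alpha>. \<Sum>s\<in>S. cmod (x \<alpha> s))" if D: "D \<ge> D0" for D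
  proof -
    obtain G where "\<forall>\<alpha>. \<forall>j<K. g j \<alpha> = mpoly_eval N D (G j) (vieta {..<N} \<alpha>)"
      using spec[OF D0, of D] D by (elim impE exE)
    then have "sq_sum N D K G \<alpha> = (\<Sum>j<K. (cmod (g j \<alpha>))\<^sup>2)" for \<alpha>
      by (simp add: sq_sum_def)
    then show ?thesis unfolding comparable_def using main C by metis
  qed
  then show ?thesis unfolding repres_def using L by blast
qed

section \<open>Pair and star families on zeros repeated q times\<close>

lemma sym_polys_power_sum_copies:
  fixes q :: nat
  shows "(\<lambda>\<alpha>. \<Sum>v\<in>{..<N} \<times> {..<q}. \<alpha> (fst v) ^ k) \<in> sym_polys N"
proof -
  have "(\<Sum>v\<in>{..<N} \<times> {..<q}. \<alpha> (fst v) ^ k) = of_int (int q) * (\<Sum>i<N. \<alpha> i ^ k)" for \<alpha> :: "nat \<Rightarrow> complex"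
    using sum.cartesian_product[of "\<lambda>i _. \<alpha> i ^ k" "{..<q}" "{..<N}"]
    by (simp add: case_prod_unfold sum_distrib_left)
  then show ?thesis
    using fun_ring_mult[OF fun_ring_sym_polys fun_ring_of_int[OF fun_ring_sym_polys, of "int q"]
        sym_polys_power_sum] by (simp only:)
qed

text \<open>The list consists of two halves, entry \<open>l\<close> being paired with entry
  \<open>T + l\<close>. The sum replaces the maximum over all choices at the cost of a factor, the
  number of terms.\<close>

definition pair_sum :: "nat \<Rightarrow> nat \<Rightarrow> nat \<Rightarrow> (nat \<Rightarrow> complex) \<Rightarrow> real" where
  "pair_sum N q T \<alpha> = (\<Sum>xs\<in>dlists (T + T) ({..<N} \<times> {..<q}).
     \<Prod>l<T. cmod (\<alpha> (fst (xs ! l)) - \<alpha> (fst (xs ! (T + l)))))"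

lemma repres_pair_sum: "repres N (pair_sum N q T)"
proof -
  let ?V = "{..<N} \<times> {..<q}"
  let ?x = "\<lambda>\<alpha> xs. \<Prod>l<T. \<alpha> (fst (xs ! l)) - \<alpha> (fst (xs ! (T + l)))"
  note R = fun_ring_sym_polys[of N] and P = fun_ring_poly_over[OF fun_ring_sym_polys[of N]]
  have "(\<lambda>\<alpha>. \<Sum>xs\<in>dlists (T + T) ?V. ?x \<alpha> xs ^ k) \<in> sym_polys N" for k
  proof -
    have "(\<lambda>y. (\<Prod>l<T. snd y l - snd y (T + l)) ^ k) \<in> poly_over (sym_polys N) (T + T)"
      by (intro fun_ring_power[OF P] fun_ring_prod[OF P] fun_ring_diff[OF P] poly_over_var[OF R]) auto
    from sum_dlists_poly_over[OF R _ sym_polys_power_sum_copies[where q = q] this]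
    show ?thesis by simp
  qed
  then have "repres N (\<lambda>\<alpha>. \<Sum>xs\<in>dlists (T + T) ?V. cmod (?x \<alpha> xs))"
    by (intro repres_sum_norm finite_dlists) auto
  then show ?thesis unfolding pair_sum_def by (simp add: prod_norm)
qed

text \<open>The centre \<open>i\<close> is an index of a zero, not a copy. Copies of it may occur
  among the entries of \<open>ys\<close>; such products vanish.\<close>

definition star_sum :: "nat \<Rightarrow> nat \<Rightarrow> nat \<Rightarrow> (nat \<Rightarrow> complex) \<Rightarrow> nat \<Rightarrow> real" where
  "star_sum N q T \<alpha> i = (\<Sum>ys\<in>dlists T ({..<N} \<times> {..<q}). \<Prod>l<T. cmod (\<alpha> i - \<alpha> (fst (ys ! l))))"

text \<open>Distributivity: a product of star sums becomes one sum indexed by the centres and a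
  choice function, that is, a single family to which the power sum criterion applies.\<close>

lemma sum_times_PiE:
  fixes F :: "'a \<Rightarrow> 'b \<Rightarrow> 'c :: comm_semiring_1"
  assumes "finite B"
  shows "(\<Sum>s\<in>A \<times> ({..<m::nat} \<rightarrow>\<^sub>E B). \<Prod>i<m. F (fst s ! i) (snd s i)) =
    (\<Sum>xs\<in>A. \<Prod>i<m. \<Sum>y\<in>B. F (xs ! i) y)"
proof -
  have "(\<Prod>i<m. \<Sum>y\<in>B. F (xs ! i) y) = (\<Sum>g\<in>{..<m} \<rightarrow>\<^sub>E B. \<Prod>i<m. F (xs ! i) (g i))" for xs
    by (rule prod_sum_PiE) (auto intro: assms)
  then show ?thesis
    by (simp add: sum.cartesian_product case_prod_unfold)
qed

text \<open>Symmetrisation in two rounds. The outer ends of a star are summed with its centre held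
  as a parameter; the result is polynomial in the centre with symmetric coefficients. Then the list
  of centres is symmetrised.\<close>

lemma repres_star_sum_prod: "repres N (\<lambda>\<alpha>. \<Sum>xs\<in>dlists m {..<N}. \<Prod>i<m. star_sum N q T \<alpha> (xs ! i))"
proof -
  let ?V = "{..<N} \<times> {..<q}"
  let ?f = "\<lambda>\<alpha> i ys. \<Prod>l<T. \<alpha> i - \<alpha> (fst (ys ! l))"
  let ?S = "dlists m {..<N} \<times> ({..<m} \<rightarrow>\<^sub>E dlists T ?V)"
  let ?x = "\<lambda>\<alpha> s. \<Prod>i<m. ?f \<alpha> (fst s ! i) (snd s i)"
  note R = fun_ring_sym_polys[of N]
  have fin: "finite ?S"
    by (intro finite_cartesian_product finite_PiE finite_dlists) auto
  \<comment> \<open>A function of the zeros and a centre lies in \<open>R'\<close> if reading the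
    centre as any slot variable gives a polynomial over \<open>sym_polys N\<close>. This makes
    \<open>R'\<close> usable as the coefficient ring of the inner round.\<close>
  define R' where "R' = {h :: (nat \<Rightarrow> complex) \<times> complex \<Rightarrow> complex.
     \<forall>m i. i < m \<longrightarrow> (\<lambda>y. h (fst y, snd y i)) \<in> poly_over (sym_polys N) m}"
  have R': "fun_ring R'"
    unfolding fun_ring_def R'_def
    using fun_ring_of_int[OF fun_ring_poly_over[OF R]] fun_ring_add[OF fun_ring_poly_over[OF R]]
      fun_ring_mult[OF fun_ring_poly_over[OF R]] by simp
  have snd_R': "snd \<in> R'"
    unfolding R'_def using poly_over_var[OF R] by simp
  have fst_R': "(\<lambda>c. g (fst c)) \<in> R'" if "g \<in> sym_polys N" for g
    unfolding R'_def using poly_over_coeff[OF that] by simp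
  have h: "(\<lambda>c. \<Sum>ys\<in>dlists T ?V. (\<Prod>l<T. snd c - fst c (fst (ys ! l))) ^ k) \<in> R'" for k
  proof -
    note P' = fun_ring_poly_over[OF R']
    have "(\<lambda>y. (\<Prod>l<T. snd (fst y) - snd y l) ^ k) \<in> poly_over R' T"
      by (intro fun_ring_power[OF P'] fun_ring_prod[OF P'] fun_ring_diff[OF P'] poly_over_var[OF R']
          poly_over_coeff[OF snd_R']) auto
    from sum_dlists_poly_over[OF R' _ fst_R'[OF sym_polys_power_sum_copies[where q = q]] this]
    show ?thesis by simp
  qed
  have "(\<lambda>\<alpha>. \<Sum>s\<in>?S. ?x \<alpha> s ^ k) \<in> sym_polys N" for k
  proof -
    note P = fun_ring_poly_over[OF R]
    have "(\<lambda>y. \<Prod>i<m. \<Sum>ys\<in>dlists T ?V. (\<Prod>l<T. snd y i - fst y (fst (ys ! l))) ^ k)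
        \<in> poly_over (sym_polys N) m"
      using h[of k] unfolding R'_def by (intro fun_ring_prod[OF P]) auto
    from sum_dlists_poly_over[OF R _ sym_polys_power_sum this]
    have "(\<lambda>\<alpha>. \<Sum>xs\<in>dlists m {..<N}. \<Prod>i<m. \<Sum>ys\<in>dlists T ?V. ?f \<alpha> (xs ! i) ys ^ k) \<in> sym_polys N"
      by simp
    moreover have "(\<Sum>s\<in>?S. ?x \<alpha> s ^ k) =
        (\<Sum>xs\<in>dlists m {..<N}. \<Prod>i<m. \<Sum>ys\<in>dlists T ?V. ?f \<alpha> (xs ! i) ys ^ k)"
      for \<alpha> :: "nat \<Rightarrow> complex"
      using sum_times_PiE[OF finite_dlists, of ?V "\<lambda>i ys. ?f \<alpha> i ys ^ k"]
      by (simp add: prod_power_distrib)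
    ultimately show ?thesis by (simp only:)
  qed
  from repres_sum_norm[OF fin this]
  have "repres N (\<lambda>\<alpha>. \<Sum>s\<in>?S. \<Prod>i<m. cmod (?f \<alpha> (fst s ! i) (snd s i)))"
    by (simp add: prod_norm)
  moreover have "(\<Sum>s\<in>?S. \<Prod>i<m. cmod (?f \<alpha> (fst s ! i) (snd s i))) =
      (\<Sum>xs\<in>dlists m {..<N}. \<Prod>i<m. star_sum N q T \<alpha> (xs ! i))" for \<alpha>
    using sum_times_PiE[OF finite_dlists, of ?V "\<lambda>i ys. cmod (?f \<alpha> i ys)"]
    by (simp add: star_sum_def prod_norm)
  ultimately show ?thesis by (simp only:)
qed

section \<open>Pairings in graphs of large minimal degree\<close>

definition pairing :: "('a \<times> 'a) list \<Rightarrow> bool" where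
  "pairing ps \<longleftrightarrow> distinct (map fst ps @ map snd ps)"

definition covered :: "('a \<times> 'a) list \<Rightarrow> 'a set" where
  "covered ps = set (map fst ps @ map snd ps)"

lemma card_covered: "pairing ps \<Longrightarrow> card (covered ps) = 2 * length ps"
  unfolding pairing_def covered_def by (subst distinct_card) auto

lemma finite_covered: "finite (covered ps)"
  by (simp add: covered_def)

lemma pairing_Cons:
  "pairing ((x, y) # ps) \<longleftrightarrow> pairing ps \<and> x \<noteq> y \<and> x \<notin> covered ps \<and> y \<notin> covered ps"
  by (auto simp: pairing_def covered_def)

lemma covered_Cons: "covered ((x, y) # ps) = insert x (insert y (covered ps))"
  by (auto simp: covered_def)

lemma pairing_append:
  "pairing (ps @ qs) \<longleftrightarrow> pairing ps \<and> pairing qs \<and> covered ps \<inter> covered qs = {}"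
  by (auto simp: pairing_def covered_def)

lemma covered_append: "covered (ps @ qs) = covered ps \<union> covered qs"
  by (auto simp: covered_def)

text \<open>The two exclusions allow each pair to contribute at most 2 to both counts together. Used
  contrapositively: too many edges from two vertices force a pair along which a matching can be
  augmented.\<close>

lemma pairing_count:
  assumes "\<And>x y. (x, y) \<in> set ps \<Longrightarrow> \<not> (P x \<and> Q y) \<and> \<not> (P y \<and> Q x)"
  shows "card {w \<in> covered ps. P w} + card {w \<in> covered ps. Q w} \<le> 2 * length ps"
  using assms
proof (induction ps)
  case Nil
  then show ?case by (simp add: covered_def)
next
  case (Cons p ps)
  obtain x y where p: "p = (x, y)" by force
  have IH: "card {w \<in> covered ps. P w} + card {w \<in> covered ps. Q w} \<le> 2 * length ps"
    using Cons by auto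
  have ins: "card {w \<in> covered (p # ps). R w} \<le>
      card {w \<in> covered ps. R w} + (if R x then 1 else 0) + (if R y then 1 else 0)" for R
  proof -
    have "{w \<in> covered (p # ps). R w} = {w \<in> covered ps. R w} \<union> (if R x then {x} else {}) \<union> (if R y then {y} else {})"
      by (auto simp: p covered_Cons)
    also have "card \<dots> \<le> card {w \<in> covered ps. R w} + card (if R x then {x} else {}) + card (if R y then {y} else {})"
      by (meson card_Un_le add_le_mono1 order_trans)
    finally show ?thesis by (simp split: if_splits)
  qed
  have "\<not> (P x \<and> Q y) \<and> \<not> (P y \<and> Q x)" using Cons.prems[of x y] p by simp
  then show ?case
    using IH ins[of P] ins[of Q] by (auto split: if_splits)
qed

text \<open>Augmentation of a matching with t pairs. If no edge joins two uncovered vertices, two of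
  them, u and v, send at least 2t + 2 edges into the covered set. Hence some pair (x, y) has u
  adjacent to one end and v to the other, and the path through u, x, y, v trades that pair for
  two.\<close>

lemma min_degree_pairing:
  assumes V: "finite V" and sym: "\<And>x y. E x y \<Longrightarrow> E y x" and irr: "\<And>x. \<not> E x x"
    and deg: "\<And>v. v \<in> V \<Longrightarrow> card {w \<in> V. E v w} \<ge> t" and card: "2 * t \<le> card V"
  shows "\<exists>ps. length ps = t \<and> pairing ps \<and> covered ps \<subseteq> V \<and> (\<forall>(x, y)\<in>set ps. E x y)"
  using deg card
proof (induction t)
  case 0
  then show ?case by (intro exI[of _ "[]"]) (auto simp: pairing_def covered_def)
next
  case (Suc t)
  have "\<exists>ps. length ps = t \<and> pairing ps \<and> covered ps \<subseteq> V \<and> (\<forall>(x, y)\<in>set ps. E x y)"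
    using Suc.prems by (intro Suc.IH) (auto dest: Suc_leD)
  then obtain ps where ps: "length ps = t" "pairing ps" "covered ps \<subseteq> V" "\<And>x y. (x, y) \<in> set ps \<Longrightarrow> E x y"
    by blast
  have "card (V - covered ps) \<ge> 2"
    using Suc.prems(2) card_covered[OF ps(2)] ps(1) V by (simp add: card_Diff_subset finite_covered ps(3))
  then obtain u v where uv: "u \<in> V - covered ps" "v \<in> V - covered ps" "u \<noteq> v"
    using card_le_Suc0_iff_eq[of "V - covered ps"] V by fastforce
  show ?case
  proof (cases "\<exists>x\<in>V - covered ps. \<exists>y\<in>V - covered ps. E x y")
    case True
    then obtain x y where "x \<in> V - covered ps" "y \<in> V - covered ps" "E x y" by blast
    then show ?thesis
      using ps irr by (intro exI[of _ "(x, y) # ps"]) (auto simp: pairing_Cons covered_Cons)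
  next
    case False
    then have nb: "{w \<in> V. E z w} = {w \<in> covered ps. E z w}" if "z \<in> V - covered ps" for z
      using that ps(3) by auto
    have "\<exists>x y. (x, y) \<in> set ps \<and> ((E u x \<and> E v y) \<or> (E u y \<and> E v x))"
    proof (rule ccontr)
      assume "\<not> ?thesis"
      then have "card {w \<in> covered ps. E u w} + card {w \<in> covered ps. E v w} \<le> 2 * length ps"
        by (intro pairing_count) auto
      moreover have "card {w \<in> covered ps. E u w} \<ge> Suc t" "card {w \<in> covered ps. E v w} \<ge> Suc t"
        using Suc.prems(1)[of u] Suc.prems(1)[of v] nb uv by auto
      ultimately show False using ps(1) by linarith
    qed
    then obtain x y where xy: "(x, y) \<in> set ps" "(E u x \<and> E v y) \<or> (E u y \<and> E v x)" by blast
    then obtain as bs where dec: "ps = as @ (x, y) # bs" by (meson split_list)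
    obtain x' y' where x'y': "(x' = x \<and> y' = y) \<or> (x' = y \<and> y' = x)" "E u x'" "E v y'"
      using xy(2) by blast
    have "pairing ((u, x') # (v, y') # as @ bs)" "covered ((u, x') # (v, y') # as @ bs) \<subseteq> V"
      using ps(2,3) uv x'y'(1) unfolding dec
      by (auto simp: pairing_Cons covered_Cons pairing_append covered_append)
    moreover have "\<forall>(a, b)\<in>set ((u, x') # (v, y') # as @ bs). E a b"
      using ps(4) x'y' unfolding dec by auto
    moreover have "length ((u, x') # (v, y') # as @ bs) = Suc t"
      using ps(1) unfolding dec by simp
    ultimately show ?thesis by blast
  qed
qed

lemma pairing_dlists:
  fixes f :: "'a \<Rightarrow> 'a \<Rightarrow> real"
  assumes "pairing ps" "covered ps \<subseteq> V" "length ps = T"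
  shows "map fst ps @ map snd ps \<in> dlists (T + T) V"
    "(\<Prod>l<T. f ((map fst ps @ map snd ps) ! l) ((map fst ps @ map snd ps) ! (T + l))) =
      (\<Prod>p\<leftarrow>ps. f (fst p) (snd p))"
proof -
  show "map fst ps @ map snd ps \<in> dlists (T + T) V"
    using assms by (auto simp: dlists_def pairing_def covered_def)
  have "(\<Prod>p\<leftarrow>ps. f (fst p) (snd p)) = (\<Prod>l<T. f (fst (ps ! l)) (snd (ps ! l)))"
    using assms(3) by (simp add: prod.list_conv_set_nth atLeast0LessThan)
  then show "(\<Prod>l<T. f ((map fst ps @ map snd ps) ! l) ((map fst ps @ map snd ps) ! (T + l))) =
      (\<Prod>p\<leftarrow>ps. f (fst p) (snd p))"
    using assms(3) by (simp add: nth_append)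
qed

text \<open>D is the least distance whose closed ball holds more than p/q indices. The next smaller
  distance already reaches every index strictly below D, so minimality leaves at most p/q of them,
  and equality is excluded by the hypothesis on p.\<close>

lemma exists_threshold:
  fixes d :: "nat \<Rightarrow> real" and p q :: nat
  assumes "p < q * N" and "\<And>k. k \<in> {..N} \<Longrightarrow> p \<noteq> q * k"
  shows "\<exists>D\<in>d ` {..<N}. q * card {j\<in>{..<N}. d j < D} < p \<and> p < q * card {j\<in>{..<N}. d j \<le> D}"
proof -
  let ?A = "{D \<in> d ` {..<N}. p < q * card {j\<in>{..<N}. d j \<le> D}}"
  have N: "N > 0" using assms(1) by (cases N) auto
  have fin: "finite ?A" by simp
  have "{j\<in>{..<N}. d j \<le> Max (d ` {..<N})} = {..<N}" by auto
  then have "Max (d ` {..<N}) \<in> ?A"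
    using assms(1) N by (auto intro!: Max_in)
  then have ne: "?A \<noteq> {}" by blast
  define D where "D = Min ?A"
  have D: "D \<in> ?A" unfolding D_def using fin ne by (rule Min_in)
  have "q * card {j\<in>{..<N}. d j < D} \<le> p"
  proof (rule ccontr)
    assume c: "\<not> ?thesis"
    let ?B = "{j\<in>{..<N}. d j < D}"
    have "?B \<noteq> {}" using c by (metis card.empty mult_0_right not_less_zero not_le_imp_less)
    define D' where "D' = Max (d ` ?B)"
    have D': "D' \<in> d ` ?B" unfolding D'_def using \<open>?B \<noteq> {}\<close> by (intro Max_in) auto
    have "?B \<subseteq> {j\<in>{..<N}. d j \<le> D'}" unfolding D'_def by auto
    then have "card ?B \<le> card {j\<in>{..<N}. d j \<le> D'}" by (intro card_mono) auto
    then have "p < q * card {j\<in>{..<N}. d j \<le> D'}"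
      using c by (meson le_less_trans linorder_not_le mult_le_mono2 order_less_le_trans)
    then have "D' \<in> ?A" using D' by auto
    then have "D \<le> D'" unfolding D_def using fin by (rule Min_le[rotated])
    then show False using D' by auto
  qed
  moreover have "card {j\<in>{..<N}. d j < D} \<in> {..N}"
    using card_mono[of "{..<N}" "{j\<in>{..<N}. d j < D}"] by auto
  ultimately show ?thesis using assms(2)[of "card {j\<in>{..<N}. d j < D}"] D by force
qed

section \<open>Weights of point configurations\<close>

lemma prod_copies: "(\<Prod>v\<in>{..<N} \<times> {..<q::nat}. f (fst v)) = (\<Prod>j<N. f j :: real) ^ q"
  using prod.cartesian_product[of "\<lambda>j _. f j" "{..<q}" "{..<N}"]
  by (simp add: case_prod_unfold prod_power_distrib)

lemma card_copies: "card {v \<in> {..<N} \<times> {..<q::nat}. P (fst v)} = q * card {j \<in> {..<N}. P j}"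
proof -
  have "{v \<in> {..<N} \<times> {..<q}. P (fst v)} = {j \<in> {..<N}. P j} \<times> {..<q}" by auto
  then show ?thesis by (simp add: card_cartesian_product)
qed

text \<open>For p/q = 2/\<delta> the power -\<delta>/q of this is \<rho>^2 times the product of all
  \<open>max \<rho> (d j)\<close> to the power -\<delta>: area times integrand at distance \<rho>
  from the centre.\<close>

definition weight :: "nat \<Rightarrow> nat \<Rightarrow> nat \<Rightarrow> (nat \<Rightarrow> real) \<Rightarrow> real \<Rightarrow> real" where
  "weight N p q d \<rho> = (\<Prod>j<N. max \<rho> (d j)) ^ q / \<rho> ^ p"

lemma weight_pos: "\<rho> > 0 \<Longrightarrow> weight N p q d \<rho> > 0"
  unfolding weight_def by (intro divide_pos_pos zero_less_power prod_pos) auto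

lemma prod_max_le:
  fixes \<rho> :: real
  assumes A: "A \<subseteq> {..<N} \<times> {..<q}" and \<rho>: "\<rho> > 0"
  shows "(\<Prod>v\<in>A. max \<rho> (d (fst v))) \<le> (\<Prod>j<N. max \<rho> (d j)) ^ q / \<rho> ^ (q * N - card A)"
proof -
  let ?V = "{..<N} \<times> {..<q}" and ?m = "\<lambda>v. max \<rho> (d (fst v))"
  have fA: "finite A" using A finite_subset by blast
  have "(\<Prod>v\<in>?V. ?m v) = (\<Prod>v\<in>?V - A. ?m v) * (\<Prod>v\<in>A. ?m v)"
    using A by (intro prod.subset_diff) auto
  moreover have "(\<Prod>v\<in>?V - A. ?m v) \<ge> (\<Prod>v\<in>?V - A. \<rho>)"
    using \<rho> by (intro prod_mono) auto
  moreover have "(\<Prod>v\<in>?V - A. \<rho>) = \<rho> ^ (q * N - card A)"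
    using A fA by (simp add: card_Diff_subset card_cartesian_product mult.commute)
  ultimately have "\<rho> ^ (q * N - card A) * (\<Prod>v\<in>A. ?m v) \<le> (\<Prod>j<N. max \<rho> (d j)) ^ q"
    using \<rho> prod_nonneg[of A ?m] mult_right_mono
    unfolding prod_copies[of "\<lambda>j. max \<rho> (d j)"] by (metis less_imp_le max.coboundedI1)
  then show ?thesis using \<rho> by (simp add: field_simps)
qed

text \<open>Since T + p = q N, exactly p copies are left out; each has a factor at least \<rho> in
  the full product, which pays for the division by \<rho>^p.\<close>

lemma star_le_weight:
  assumes T: "T + p = q * N" and \<rho>: "\<rho> > 0" and d: "\<And>j. d j \<ge> 0"
    and ys: "ys \<in> dlists T ({..<N} \<times> {..<q})"
  shows "(\<Prod>l<T. d (fst (ys ! l))) \<le> weight N p q d \<rho>"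
proof -
  have "(\<Prod>l<T. d (fst (ys ! l))) = (\<Prod>v\<in>set ys. d (fst v))"
    using dlistsD[OF ys] prod_nth_distinct[of ys T "\<lambda>v. d (fst v)"] by simp
  also have "\<dots> \<le> (\<Prod>v\<in>set ys. max \<rho> (d (fst v)))"
    using d by (intro prod_mono) auto
  also have "\<dots> \<le> (\<Prod>j<N. max \<rho> (d j)) ^ q / \<rho> ^ (q * N - card (set ys))"
    using dlistsD(3)[OF ys] \<rho> by (rule prod_max_le)
  also have "q * N - card (set ys) = p"
    using dlistsD[OF ys] T distinct_card[of ys] by simp
  finally show ?thesis by (simp add: weight_def)
qed

text \<open>The two counts leave room to keep T copies at distance at least D, among them all beyond
  D. The p discarded ones then contribute exactly D each and cancel D^p. Together with the preceding
  bound, the threshold minimises the weight.\<close>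

lemma weight_eq_star:
  assumes T: "T + p = q * N" and D: "D > 0"
    and lo: "q * card {j\<in>{..<N}. d j < D} < p" and hi: "p < q * card {j\<in>{..<N}. d j \<le> D}"
  shows "\<exists>ys\<in>dlists T ({..<N} \<times> {..<q}). (\<Prod>l<T. d (fst (ys ! l))) = weight N p q d D"
proof -
  let ?V = "{..<N} \<times> {..<q}"
  let ?H = "{v \<in> ?V. d (fst v) > D}" and ?G = "{v \<in> ?V. d (fst v) \<ge> D}"
  have V: "N * q = q * N" by (rule mult.commute)
  have "?H = ?V - {v \<in> ?V. d (fst v) \<le> D}" by auto
  then have "card ?H = q * N - q * card {j\<in>{..<N}. d j \<le> D}"
    by (simp add: card_Diff_subset card_copies[where P = "\<lambda>j. d j \<le> D"] mult.commute)
  then have H: "card ?H \<le> T" using hi T by linarith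
  have "?G = ?V - {v \<in> ?V. d (fst v) < D}" by auto
  then have "card ?G = q * N - q * card {j\<in>{..<N}. d j < D}"
    by (simp add: card_Diff_subset card_copies[where P = "\<lambda>j. d j < D"] mult.commute)
  then have G: "T \<le> card ?G" using lo T by linarith
  have "?H \<subseteq> ?G" by auto
  then obtain A where A: "?H \<subseteq> A" "A \<subseteq> ?G" "card A = T"
    using exists_subset_between[OF H G] by auto
  have fA: "finite A" using A(2) by (rule finite_subset) auto
  obtain ys where ys: "set ys = A" "distinct ys"
    using finite_distinct_list[OF fA] by blast
  have len: "length ys = T" using ys A(3) distinct_card by metis
  have "ys \<in> dlists T ?V" using ys len A(2) by (auto simp: dlists_def)
  moreover have "(\<Prod>l<T. d (fst (ys ! l))) = weight N p q d D"
  proof -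
    have "(\<Prod>l<T. d (fst (ys ! l))) = (\<Prod>v\<in>A. d (fst v))"
      using prod_nth_distinct[OF ys(2) len, of "\<lambda>v. d (fst v)"] ys(1) by simp
    also have "\<dots> = (\<Prod>v\<in>A. max D (d (fst v)))"
      using A(2) by (intro prod.cong) auto
    finally have 1: "(\<Prod>l<T. d (fst (ys ! l))) = (\<Prod>v\<in>A. max D (d (fst v)))" .
    have "(\<Prod>v\<in>?V. max D (d (fst v))) = (\<Prod>v\<in>?V - A. max D (d (fst v))) * (\<Prod>v\<in>A. max D (d (fst v)))"
      using A by (intro prod.subset_diff) auto
    also have "(\<Prod>v\<in>?V - A. max D (d (fst v))) = (\<Prod>v\<in>?V - A. D)"
      using A(1) by (intro prod.cong) (auto simp: max_def not_less)
    also have "\<dots> = D ^ p"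
    proof -
      have "card (?V - A) = q * N - T"
        using A(2,3) fA by (subst card_Diff_subset) (auto simp: V)
      moreover have "q * N - T = p" using T by linarith
      ultimately show ?thesis by simp
    qed
    finally show ?thesis
      using D 1 unfolding weight_def prod_copies[of "\<lambda>j. max D (d j)"] by simp
  qed
  ultimately show ?thesis by blast
qed

text \<open>More than p copies coincide with the centre, so the numerator has at least one more
  factor \<rho> than the denominator. This is the degenerate threshold D = 0.\<close>

lemma weight_le_linear:
  assumes d: "\<And>j. d j \<ge> 0" and hi: "p < q * card {j\<in>{..<N}. d j \<le> 0}"
  shows "\<exists>K>0. \<forall>\<rho>. 0 < \<rho> \<and> \<rho> \<le> 1 \<longrightarrow> weight N p q d \<rho> \<le> K * \<rho>"
proof -
  let ?Z = "{j\<in>{..<N}. d j \<le> 0}"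
  define K where "K = (\<Prod>j\<in>{..<N} - ?Z. max 1 (d j)) ^ q"
  have "K > 0" unfolding K_def by (intro zero_less_power prod_pos) auto
  moreover have "weight N p q d \<rho> \<le> K * \<rho>" if \<rho>: "0 < \<rho>" "\<rho> \<le> 1" for \<rho>
  proof -
    have "(\<Prod>j<N. max \<rho> (d j)) = (\<Prod>j\<in>{..<N} - ?Z. max \<rho> (d j)) * (\<Prod>j\<in>?Z. max \<rho> (d j))"
      by (intro prod.subset_diff) auto
    also have "(\<Prod>j\<in>?Z. max \<rho> (d j)) = (\<Prod>j\<in>?Z. \<rho>)"
      using \<rho> by (intro prod.cong) auto
    finally have "(\<Prod>j<N. max \<rho> (d j)) ^ q = (\<Prod>j\<in>{..<N} - ?Z. max \<rho> (d j)) ^ q * \<rho> ^ (q * card ?Z)"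
      by (simp add: power_mult_distrib power_mult[symmetric] mult.commute)
    also have "\<dots> \<le> K * \<rho> ^ (q * card ?Z)"
      unfolding K_def using \<rho> by (intro mult_right_mono power_mono prod_mono prod_nonneg) auto
    also have "\<rho> ^ (q * card ?Z) \<le> \<rho> ^ Suc p"
      using hi \<rho> by (intro power_decreasing) auto
    finally have "(\<Prod>j<N. max \<rho> (d j)) ^ q \<le> K * \<rho> ^ Suc p"
      using \<open>K > 0\<close> by simp
    then show ?thesis unfolding weight_def using \<rho> by (simp add: field_simps)
  qed
  ultimately show ?thesis by blast
qed

lemma eq_0_of_le_linear:
  fixes K x :: real
  assumes "x \<ge> 0" "K > 0" "\<And>\<rho>. 0 < \<rho> \<Longrightarrow> \<rho> \<le> 1 \<Longrightarrow> x \<le> K * \<rho>"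
  shows "x = 0"
proof (rule ccontr)
  assume "x \<noteq> 0"
  then have x: "x > 0" using assms(1) by simp
  define \<rho> where "\<rho> = min 1 (x / (2 * K))"
  have "\<rho> > 0" "\<rho> \<le> 1" using x assms(2) by (auto simp: \<rho>_def)
  then have "x \<le> K * \<rho>" by (rule assms(3))
  also have "\<dots> \<le> K * (x / (2 * K))" using assms(2) by (intro mult_left_mono) (auto simp: \<rho>_def)
  also have "\<dots> = x / 2" using assms(2) by simp
  finally show False using x by simp
qed

abbreviation dists :: "(nat \<Rightarrow> complex) \<Rightarrow> nat \<Rightarrow> nat \<Rightarrow> real" where
  "dists \<alpha> i j \<equiv> cmod (\<alpha> i - \<alpha> j)"

text \<open>For \<open>m\<^sub>x, m\<^sub>y \<ge> \<rho>\<close> one has \<open>max m\<^sub>x m\<^sub>y \<le> m\<^sub>x m\<^sub>y / \<rho>\<close>, so a product over disjoint pairs is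
  controlled by the distances to a single point.\<close>

lemma pairs_le_weight:
  assumes T: "T + p = q * N" "2 * T \<le> q * N" and \<rho>: "\<rho> > 0"
    and xs: "xs \<in> dlists (T + T) ({..<N} \<times> {..<q})"
  shows "(\<Prod>l<T. cmod (\<alpha> (fst (xs ! l)) - \<alpha> (fst (xs ! (T + l))))) \<le> 2 ^ T * weight N p q (dists \<alpha> i) \<rho>"
proof -
  define m where "m = (\<lambda>v :: nat \<times> nat. max \<rho> (dists \<alpha> i (fst v)))"
  have m: "m v \<ge> \<rho>" "m v > 0" for v using \<rho> by (auto simp: m_def)
  have one: "cmod (\<alpha> (fst x) - \<alpha> (fst y)) \<le> 2 * (m x * m y) / \<rho>" for x y
  proof -
    have "cmod (\<alpha> (fst x) - \<alpha> (fst y)) \<le> dists \<alpha> i (fst x) + dists \<alpha> i (fst y)"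
      using norm_triangle_ineq4[of "\<alpha> i - \<alpha> (fst y)" "\<alpha> i - \<alpha> (fst x)"] by simp
    also have "\<dots> \<le> m x + m y" by (simp add: m_def)
    also have "\<dots> \<le> 2 * (m x * m y) / \<rho>"
    proof -
      have "\<rho> * m x \<le> m y * m x" "\<rho> * m y \<le> m x * m y"
        using m less_imp_le by (auto intro!: mult_right_mono)
      then have "\<rho> * (m x + m y) \<le> 2 * (m x * m y)" by (simp add: algebra_simps)
      then show ?thesis using \<rho> by (simp add: field_simps)
    qed
    finally show ?thesis .
  qed
  have "(\<Prod>l<T. cmod (\<alpha> (fst (xs ! l)) - \<alpha> (fst (xs ! (T + l))))) \<le>
      (\<Prod>l<T. 2 * (m (xs ! l) * m (xs ! (T + l))) / \<rho>)"
    by (intro prod_mono) (use one in auto)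
  also have "\<dots> = 2 ^ T / \<rho> ^ T * ((\<Prod>l<T. m (xs ! l)) * (\<Prod>l<T. m (xs ! (T + l))))"
    by (simp add: prod_dividef prod.distrib)
  also have "(\<Prod>l<T. m (xs ! l)) * (\<Prod>l<T. m (xs ! (T + l))) = (\<Prod>l<T + T. m (xs ! l))"
  proof -
    have "(\<Prod>l<T + k. m (xs ! l)) = (\<Prod>l<T. m (xs ! l)) * (\<Prod>l<k. m (xs ! (T + l)))" for k
      by (induction k) (simp_all add: mult.assoc)
    then show ?thesis by simp
  qed
  also have "\<dots> = (\<Prod>v\<in>set xs. m v)"
    using dlistsD[OF xs] prod_nth_distinct by metis
  also have "2 ^ T / \<rho> ^ T * (\<Prod>v\<in>set xs. m v) \<le>
      2 ^ T / \<rho> ^ T * ((\<Prod>j<N. max \<rho> (dists \<alpha> i j)) ^ q / \<rho> ^ (q * N - card (set xs)))"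
    unfolding m_def using \<rho> by (intro mult_left_mono prod_max_le dlistsD(3)[OF xs]) auto
  also have "card (set xs) = T + T" using dlistsD[OF xs] distinct_card[of xs] by simp
  also have "2 ^ T / \<rho> ^ T * ((\<Prod>j<N. max \<rho> (dists \<alpha> i j)) ^ q / \<rho> ^ (q * N - (T + T))) =
      2 ^ T * ((\<Prod>j<N. max \<rho> (dists \<alpha> i j)) ^ q / \<rho> ^ (T + (q * N - (T + T))))"
    by (simp add: power_add)
  \<comment> \<open>Each of the T pairs costs one factor 1/\<rho>, and q N - 2T copies belong to no
    pair; together these are q N - T = p powers.\<close>
  also have "T + (q * N - (T + T)) = p" using T by linarith
  finally show ?thesis by (simp add: weight_def)
qed

text \<open>Pigeonhole: N + 1 disjoint shells cannot all contain one of N distances. The ratio 3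
  makes a distance across the gap comparable to the larger of the two distances from the
  centre.\<close>

lemma exists_gap:
  fixes d :: "nat \<Rightarrow> real"
  assumes D: "D > 0"
  shows "\<exists>l\<in>{1..N + 1}. \<forall>j<N. d j < 3 ^ l * D \<or> d j \<ge> 3 ^ Suc l * D"
proof (rule ccontr)
  assume "\<not> ?thesis"
  then have "\<forall>l\<in>{1..N + 1}. \<exists>j<N. 3 ^ l * D \<le> d j \<and> d j < 3 ^ Suc l * D"
    by (auto simp: not_less not_le)
  then obtain g where g: "\<And>l. l \<in> {1..N + 1} \<Longrightarrow> g l < N \<and> 3 ^ l * D \<le> d (g l) \<and> d (g l) < 3 ^ Suc l * D"
    by metis
  have lt: "d (g l) < d (g l')" if "l \<in> {1..N + 1}" "l' \<in> {1..N + 1}" "l < l'" for l l'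
  proof -
    have "d (g l) < 3 ^ Suc l * D" using g[OF that(1)] by blast
    also have "\<dots> \<le> 3 ^ l' * D" using that(3) D by (intro mult_right_mono power_increasing) auto
    also have "\<dots> \<le> d (g l')" using g[OF that(2)] by blast
    finally show ?thesis .
  qed
  have "inj_on g {1..N + 1}"
    by (rule linorder_inj_onI) (use lt in force)+
  then have "card {1..N + 1} \<le> card {..<N}"
    by (rule card_inj_on_le) (use g in auto)
  then show False by simp
qed

lemma prod_list_mono:
  fixes f g :: "'a \<Rightarrow> real"
  assumes "\<And>x. x \<in> set xs \<Longrightarrow> 0 \<le> f x \<and> f x \<le> g x"
  shows "0 \<le> (\<Prod>x\<leftarrow>xs. f x) \<and> (\<Prod>x\<leftarrow>xs. f x) \<le> (\<Prod>x\<leftarrow>xs. g x)"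
  using assms
proof (induction xs)
  case (Cons a xs)
  then have "0 \<le> f a" "f a \<le> g a" "0 \<le> (\<Prod>x\<leftarrow>xs. f x)" "(\<Prod>x\<leftarrow>xs. f x) \<le> (\<Prod>x\<leftarrow>xs. g x)" by auto
  then show ?case by (auto intro!: mult_mono mult_nonneg_nonneg)
qed auto

text \<open>Points far from \<open>\<alpha> i\<close> are paired with points in the cluster \<open>K\<close> around it, across the gap;
  the remaining pairs are found inside \<open>K\<close>, where by minimality of \<open>D\<close> every point has many
  others at distance at least \<open>D\<close>.\<close>

lemma pairs_ge_weight:
  assumes T: "T + p = q * N" "2 * T \<le> q * N" and D: "D > 0"
    and lo: "\<And>j. j < N \<Longrightarrow> q * card {j'\<in>{..<N}. dists \<alpha> j j' < D} < p"
    and hi: "p < q * card {j\<in>{..<N}. dists \<alpha> i j \<le> D}"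
  shows "\<exists>xs\<in>dlists (T + T) ({..<N} \<times> {..<q}). weight N p q (dists \<alpha> i) D \<le>
    3 ^ ((N + 2) * (q * N)) * (\<Prod>l<T. cmod (\<alpha> (fst (xs ! l)) - \<alpha> (fst (xs ! (T + l)))))"
proof -
  let ?V = "{..<N} \<times> {..<q}" and ?d = "\<lambda>v. dists \<alpha> i (fst v)"
  let ?e = "\<lambda>x y. cmod (\<alpha> (fst x) - \<alpha> (fst y))"
  obtain l where l: "l \<in> {1..N + 1}" and gap: "\<And>j. j < N \<Longrightarrow> dists \<alpha> i j < 3 ^ l * D \<or> dists \<alpha> i j \<ge> 3 ^ Suc l * D"
    using exists_gap[OF D, of N "dists \<alpha> i"] by blast
  have l3: "3 ^ l \<ge> (3::real)" using l power_increasing[of 1 l "3::real"] by simp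
  have Dl: "D < 3 ^ l * D" using l3 D by simp
  define K where "K = {v \<in> ?V. ?d v < 3 ^ l * D}"
  define F where "F = {v \<in> ?V. ?d v \<ge> 3 ^ Suc l * D}"
  have fin: "finite K" "finite F" unfolding K_def F_def by auto
  have "?d v < 3 ^ l * D \<or> ?d v \<ge> 3 ^ Suc l * D" if "v \<in> ?V" for v
    using gap[of "fst v"] that by auto
  then have V: "?V = K \<union> F" unfolding K_def F_def by blast
  have "3 ^ l * D < 3 ^ Suc l * D" using D by simp
  then have disj: "K \<inter> F = {}" unfolding K_def F_def by (auto simp del: power_Suc)
  have cV: "card ?V = q * N" by (simp add: mult.commute)
  have cKF: "card K + card F = q * N" using card_Un_disjoint[OF fin disj] V cV by simp
  have "{v \<in> ?V. ?d v \<le> D} \<subseteq> K" unfolding K_def using Dl by auto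
  then have "card {v \<in> ?V. ?d v \<le> D} \<le> card K" using fin by (intro card_mono)
  then have pK: "p < card K" using hi by (simp only: card_copies[where P = "\<lambda>j. dists \<alpha> i j \<le> D"])
  \<comment> \<open>The subtraction is exact: \<open>K\<close> has more than p copies, hence
    \<open>F\<close> fewer than T, and t = card K - p. The hypothesis 2T \<le> q N means T \<le> p.
    It gives t \<le> p, room for t pairs inside \<open>K\<close>, and leaves p - t \<ge> card F
    further points of \<open>K\<close> as partners for \<open>F\<close>.\<close>
  define t where "t = T - card F"
  have t: "T = t + card F" "card K = p + t" "2 * t \<le> card K" "card F \<le> card K - 2 * t"
    using pK cKF T unfolding t_def by linarith+
  have deg: "t \<le> card {w \<in> K. D \<le> ?e v w}" if "v \<in> K" for v
  proof -
    have v: "fst v < N" using that unfolding K_def by auto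
    have "card {w \<in> ?V. ?e v w < D} < p"
      using lo[OF v] by (simp only: card_copies[where P = "\<lambda>j. dists \<alpha> (fst v) j < D"])
    moreover have "card K \<le> card ({w \<in> K. D \<le> ?e v w} \<union> {w \<in> ?V. ?e v w < D})"
    proof (rule card_mono)
      show "K \<subseteq> {w \<in> K. D \<le> ?e v w} \<union> {w \<in> ?V. ?e v w < D}"
        unfolding K_def by (auto simp: not_less)
    qed (use fin in auto)
    moreover have "\<dots> \<le> card {w \<in> K. D \<le> ?e v w} + card {w \<in> ?V. ?e v w < D}"
      by (rule card_Un_le)
    ultimately show ?thesis using t by linarith
  qed
  have "\<exists>ps. length ps = t \<and> pairing ps \<and> covered ps \<subseteq> K \<and> (\<forall>(x, y)\<in>set ps. D \<le> ?e x y)"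
    by (rule min_degree_pairing[OF fin(1) _ _ deg t(3)]) (use D in \<open>auto simp: norm_minus_commute\<close>)
  then obtain ps where ps: "length ps = t" "pairing ps" "covered ps \<subseteq> K" "\<forall>(x, y)\<in>set ps. D \<le> ?e x y"
    by blast
  have "card F \<le> card (K - covered ps)"
    using t(4) card_covered[OF ps(2)] ps(1,3) by (simp add: card_Diff_subset finite_covered)
  then obtain B where B: "B \<subseteq> K - covered ps" "card B = card F" "finite B"
    using obtain_subset_with_card_n by metis
  obtain Fl Bl where FB: "set Fl = F" "distinct Fl" "set Bl = B" "distinct Bl"
    using finite_distinct_list fin(2) B(3) by metis
  have len: "length Fl = card F" "length Bl = card F"
    using FB B(2) distinct_card by metis+
  define qs where "qs = zip Fl Bl"
  have qs_maps: "map fst qs = Fl" "map snd qs = Bl" using len by (simp_all add: qs_def)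
  have qs: "pairing qs" "covered qs = F \<union> B"
    using FB B(1) disj by (auto simp: pairing_def covered_def qs_maps)
  have all: "pairing (ps @ qs)" "covered (ps @ qs) \<subseteq> ?V" "length (ps @ qs) = T"
    using ps(1-3) qs B(1) disj V t(1) len by (auto simp: pairing_append covered_append qs_def)
  have ps_ge: "D ^ t \<le> (\<Prod>p\<leftarrow>ps. ?e (fst p) (snd p))"
    using prod_list_mono[of ps "\<lambda>_. D" "\<lambda>p. ?e (fst p) (snd p)"] ps(1,4) D
    by (fastforce simp: map_replicate_const)
  \<comment> \<open>The far point is at least three times as distant from the centre as its partner,
    so the triangle inequality loses at most one third.\<close>
  have "2/3 * ?d (fst p) \<le> ?e (fst p) (snd p)" if "p \<in> set qs" for p
  proof -
    have "fst p \<in> F" "snd p \<in> K"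
      using that qs_maps FB B(1) by (metis image_eqI set_map, metis DiffD1 image_eqI set_map subsetD)
    then have "3 ^ Suc l * D \<le> ?d (fst p)" "?d (snd p) < 3 ^ l * D"
      unfolding F_def K_def by auto
    moreover have "?d (fst p) \<le> ?d (snd p) + ?e (snd p) (fst p)"
      using norm_triangle_ineq[of "\<alpha> i - \<alpha> (fst (snd p))" "\<alpha> (fst (snd p)) - \<alpha> (fst (fst p))"] by simp
    ultimately show ?thesis by (simp add: norm_minus_commute)
  qed
  then have "(\<Prod>p\<leftarrow>qs. 2/3 * ?d (fst p)) \<le> (\<Prod>p\<leftarrow>qs. ?e (fst p) (snd p))"
    by (intro conjunct2[OF prod_list_mono]) auto
  moreover have "(\<Prod>p\<leftarrow>qs. 2/3 * ?d (fst p)) = (\<Prod>v\<in>F. 2/3 * ?d v)"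
  proof -
    have "(\<Prod>p\<leftarrow>qs. 2/3 * ?d (fst p)) = prod_list (map (\<lambda>v. 2/3 * ?d v) (map fst qs))"
      by (simp add: comp_def)
    then show ?thesis
      unfolding qs_maps using prod.distinct_set_conv_list[OF FB(2), of "\<lambda>v. 2/3 * ?d v"] FB(1) by simp
  qed
  ultimately have qs_ge: "(\<Prod>v\<in>F. 2/3 * ?d v) \<le> (\<Prod>p\<leftarrow>qs. ?e (fst p) (snd p))" by simp
  have "D ^ t * (\<Prod>v\<in>F. 2/3 * ?d v) \<le> (\<Prod>p\<leftarrow>ps. ?e (fst p) (snd p)) * (\<Prod>p\<leftarrow>qs. ?e (fst p) (snd p))"
    using ps_ge qs_ge D by (intro mult_mono prod_nonneg prod_list_nonneg) auto
  then have lower: "D ^ t * (\<Prod>v\<in>F. 2/3 * ?d v) \<le> (\<Prod>p\<leftarrow>ps @ qs. ?e (fst p) (snd p))" by simp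
  have "(\<Prod>v\<in>?V. max D (?d v)) = (\<Prod>v\<in>K. max D (?d v)) * (\<Prod>v\<in>F. max D (?d v))"
    unfolding V by (rule prod.union_disjoint[OF fin disj])
  also have "(\<Prod>v\<in>F. max D (?d v)) = (\<Prod>v\<in>F. ?d v)"
  proof (intro prod.cong refl)
    fix v assume "v \<in> F"
    then have "3 * (3 ^ l * D) \<le> ?d v" unfolding F_def by simp
    then show "max D (?d v) = ?d v" using Dl D by linarith
  qed
  also have "(\<Prod>v\<in>K. max D (?d v)) * (\<Prod>v\<in>F. ?d v) \<le> (\<Prod>v\<in>K. 3 ^ l * D) * (\<Prod>v\<in>F. ?d v)"
    using Dl D unfolding K_def by (intro mult_right_mono prod_mono prod_nonneg) auto
  \<comment> \<open>The exponent card K = p + t is split: D^p cancels the denominator of the weight,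
    and D^t is paid for by the t pairs inside \<open>K\<close>.\<close>
  also have "(\<Prod>v\<in>K. 3 ^ l * D) = 3 ^ (l * card K) * D ^ p * D ^ t"
    using t(2) by (simp add: power_mult_distrib power_mult power_add)
  finally have "weight N p q (dists \<alpha> i) D \<le> 3 ^ (l * card K) * (D ^ t * (\<Prod>v\<in>F. ?d v))"
    unfolding weight_def prod_copies[of "\<lambda>j. max D (dists \<alpha> i j)"] using D by (simp add: field_simps)
  also have "(\<Prod>v\<in>F. ?d v) = (3/2) ^ card F * (\<Prod>v\<in>F. 2/3 * ?d v)"
  proof -
    have "(\<Prod>v\<in>F. 2/3 * ?d v) = (2/3) ^ card F * (\<Prod>v\<in>F. ?d v)"
      by (simp only: prod.distrib prod_constant)
    moreover have "(3/2 :: real) ^ card F * (2/3) ^ card F = 1"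
      unfolding power_mult_distrib[symmetric] by simp
    ultimately show ?thesis by (metis mult.assoc mult_1)
  qed
  also have "3 ^ (l * card K) * (D ^ t * ((3/2) ^ card F * (\<Prod>v\<in>F. 2/3 * ?d v))) =
      (3 ^ (l * card K) * (3/2) ^ card F) * (D ^ t * (\<Prod>v\<in>F. 2/3 * ?d v))" by simp
  also have "\<dots> \<le> 3 ^ ((N + 2) * (q * N)) * (\<Prod>p\<leftarrow>ps @ qs. ?e (fst p) (snd p))"
  proof (rule mult_mono[OF _ lower])
    have "(3::real) ^ (l * card K) * (3/2) ^ card F \<le> 3 ^ ((N + 1) * (q * N)) * 3 ^ (q * N)"
    proof (intro mult_mono)
      have "l * card K \<le> (N + 1) * (q * N)" using l cKF by (intro mult_le_mono) auto
      then show "(3::real) ^ (l * card K) \<le> 3 ^ ((N + 1) * (q * N))" by (intro power_increasing) auto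
      have "(3/2 :: real) ^ card F \<le> 3 ^ card F" by (intro power_mono) auto
      also have "\<dots> \<le> 3 ^ (q * N)" using cKF by (intro power_increasing) auto
      finally show "(3/2 :: real) ^ card F \<le> 3 ^ (q * N)" .
    qed auto
    also have "\<dots> = 3 ^ ((N + 2) * (q * N))" by (simp add: power_add[symmetric] algebra_simps)
    finally show "(3::real) ^ (l * card K) * (3/2) ^ card F \<le> 3 ^ ((N + 2) * (q * N))" .
  qed (use D in \<open>auto intro!: mult_nonneg_nonneg prod_nonneg\<close>)
  finally show ?thesis
    using pairing_dlists(1)[OF all] pairing_dlists(2)[OF all, of ?e] by (intro bexI[of _ "map fst (ps @ qs) @ map snd (ps @ qs)"]) auto
qed

section \<open>Radial integrals\<close>

text \<open>The fundamental theorem of algebra gives the factorisation; equality of two polynomial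
  functions then identifies the coefficients.\<close>

lemma exists_roots:
  assumes a0: "a 0 = 1"
  shows "\<exists>\<alpha>. (\<forall>n\<le>N. a n = vieta {..<N} \<alpha> n) \<and> (\<forall>z. Qpoly N a z = (\<Prod>i<N. z - \<alpha> i))"
proof -
  define P where "P = (\<Sum>i\<le>N. monom (a i) (N - i))"
  have poly_P: "poly P z = Qpoly N a z" for z
    by (simp add: P_def Qpoly_def poly_sum poly_monom)
  have "coeff P N = (\<Sum>i\<le>N. if i = 0 then a 0 else 0)"
    unfolding P_def coeff_sum coeff_monom by (intro sum.cong) auto
  then have cN: "coeff P N = 1" using a0 by simp
  have "degree P \<le> N"
    unfolding P_def by (intro degree_sum_le) (auto intro: order_trans[OF degree_monom_le])
  then have deg: "degree P = N" using cN le_degree[of P N] by simp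
  obtain \<alpha> where "smult (lead_coeff P) (\<Prod>i<degree P. [:- \<alpha> i, 1:]) = P"
    using complex_poly_decompose'[of P] .
  then have P: "P = (\<Prod>i<N. [:- \<alpha> i, 1:])" using deg cN by simp
  have Q: "Qpoly N a z = (\<Prod>i<N. z - \<alpha> i)" for z
    unfolding poly_P[symmetric] by (subst P) (simp add: poly_prod)
  have "(\<Sum>i\<le>N. a (N - i) * z ^ i) = (\<Sum>i\<le>N. vieta {..<N} \<alpha> (N - i) * z ^ i)" for z
  proof -
    have rev: "(\<Sum>i\<le>N. f i * z ^ (N - i)) = (\<Sum>i\<le>N. f (N - i) * z ^ i)" for f :: "nat \<Rightarrow> complex"
      by (rule sum.reindex_bij_witness[of _ "\<lambda>i. N - i" "\<lambda>i. N - i"]) auto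
    show ?thesis
      using Q[of z] prod_eq_vieta[of "{..<N}" z \<alpha>] unfolding Qpoly_def by (simp add: rev)
  qed
  then have "\<forall>i\<le>N. a (N - i) = vieta {..<N} \<alpha> (N - i)"
    unfolding polyfun_eq_coeffs[symmetric] by blast
  then have "a n = vieta {..<N} \<alpha> n" if "n \<le> N" for n
    using that by (metis diff_diff_cancel diff_le_self)
  then show ?thesis using Q by blast
qed

text \<open>The model for |Q|^(-\<delta>) around a cluster whose radius is scaled to 1. It is
  integrable over the plane when a < 2 < b. At \<open>t = 0\<close> its value is 0, because 0 raised
  by \<open>powr\<close> is 0.\<close>

definition radial :: "real \<Rightarrow> real \<Rightarrow> real \<Rightarrow> real" where
  "radial a b t = (if t < 1 then t powr - a else t powr - b)"

lemma radial_nonneg: "radial a b t \<ge> 0"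
  by (simp add: radial_def)

lemma radial_measurable [measurable]: "(\<lambda>z::complex. radial a b (cmod (z - c) / D)) \<in> borel_measurable borel"
  unfolding radial_def by measurable

lemma dyadic_below:
  fixes t :: real
  assumes "0 < t" "t < 1"
  shows "\<exists>n. (1/2) ^ Suc n \<le> t \<and> t < (1/2) ^ n"
proof -
  define n where "n = (LEAST n. (1/2) ^ Suc n \<le> t)"
  obtain m where "(1/2::real) ^ m < t" using real_arch_pow_inv[of t "1/2"] assms by auto
  then have "(1/2::real) ^ Suc m \<le> t" using zero_le_power[of "1/2::real" m] unfolding power_Suc by linarith
  then have n: "(1/2) ^ Suc n \<le> t" unfolding n_def by (rule LeastI)
  moreover have "t < (1/2) ^ n"
  proof (cases n)
    case (Suc k)
    then show ?thesis using not_less_Least[of k "\<lambda>n. (1/2) ^ Suc n \<le> t"] unfolding n_def by (simp add: not_le)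
  qed (use assms in simp)
  ultimately show ?thesis by blast
qed

lemma dyadic_above:
  fixes t :: real
  assumes "1 \<le> t"
  shows "\<exists>n. 2 ^ n \<le> t \<and> t < 2 ^ Suc n"
proof -
  define n where "n = (LEAST n. t < 2 ^ Suc n)"
  obtain m where "t < (2::real) ^ m" using real_arch_pow[of 2 t] by auto
  then have "t < (2::real) ^ Suc m" using zero_le_power[of "2::real" m] unfolding power_Suc by linarith
  then have n: "t < 2 ^ Suc n" unfolding n_def by (rule LeastI)
  moreover have "2 ^ n \<le> t"
  proof (cases n)
    case (Suc k)
    then show ?thesis using not_less_Least[of k "\<lambda>n. t < 2 ^ Suc n"] unfolding n_def by (simp add: not_less)
  qed (use assms in simp)
  ultimately show ?thesis by blast
qed

lemma emeasure_ball_complex: "r \<ge> 0 \<Longrightarrow> emeasure lborel (ball (c::complex) r) = ennreal (pi * r\<^sup>2)"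
  by (simp add: emeasure_ball unit_ball_vol_2)

text \<open>Each positive t lies in one dyadic shell, and the ball around that shell carries the
  value of the profile at the inner edge. Afterwards the integral needs nothing but areas of
  balls.\<close>

lemma radial_le_dyadic:
  fixes z c :: complex
  assumes D: "D > 0" and a: "a \<ge> 0" and b: "b \<ge> 0"
  shows "ennreal (radial a b (cmod (z - c) / D)) \<le>
     (\<Sum>n. ennreal (2 powr (a * real (Suc n))) * indicator (ball c (D * (1/2) ^ n)) z) +
     (\<Sum>n. ennreal (2 powr (- b * real n)) * indicator (ball c (D * 2 ^ Suc n)) z)"
proof -
  define t where "t = cmod (z - c) / D"
  have t0: "t \<ge> 0" using D by (simp add: t_def)
  have ball: "z \<in> ball c (D * r) \<longleftrightarrow> t < r" for r
    using D by (simp add: t_def dist_norm norm_minus_commute field_simps)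
  have le_suminf: "f n \<le> suminf f" for f :: "nat \<Rightarrow> ennreal" and n
    using sum_le_suminf[of f "{n}"] by simp
  consider "t = 0" | "0 < t" "t < 1" | "t \<ge> 1" using t0 by linarith
  then show ?thesis
  proof cases
    case 1
    then show ?thesis unfolding t_def[symmetric] by (simp add: radial_def)
  next
    case 2
    then obtain n where n: "(1/2) ^ Suc n \<le> t" "t < (1/2) ^ n" using dyadic_below by blast
    have "t powr - a \<le> ((1/2) ^ Suc n) powr - a"
      using n(1) a by (intro powr_mono2') auto
    also have "\<dots> = 2 powr (a * real (Suc n))"
    proof -
      have "(1/2::real) ^ Suc n = 2 powr - real (Suc n)"
        by (simp add: powr_minus powr_realpow power_one_over inverse_eq_divide del: of_nat_Suc power_Suc)
      then show ?thesis by (simp add: powr_powr mult.commute del: of_nat_Suc power_Suc)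
    qed
    finally have "ennreal (radial a b t) \<le> ennreal (2 powr (a * real (Suc n))) * indicator (ball c (D * (1/2) ^ n)) z"
      using 2 n(2) by (simp add: radial_def indicator_def ball ennreal_leI del: mem_ball)
    also have "\<dots> \<le> (\<Sum>n. ennreal (2 powr (a * real (Suc n))) * indicator (ball c (D * (1/2) ^ n)) z)"
      by (rule le_suminf)
    finally show ?thesis unfolding t_def[symmetric] by (rule order_trans) simp
  next
    case 3
    then obtain n where n: "2 ^ n \<le> t" "t < 2 ^ Suc n" using dyadic_above by blast
    have "t powr - b \<le> (2 ^ n) powr - b"
      using n(1) b by (intro powr_mono2') auto
    also have "\<dots> = 2 powr (- b * real n)"
      by (simp add: powr_realpow[symmetric] powr_powr mult.commute)
    finally have "ennreal (radial a b t) \<le> ennreal (2 powr (- b * real n)) * indicator (ball c (D * 2 ^ Suc n)) z"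
      using 3 n(2) by (simp add: radial_def indicator_def ball ennreal_leI del: mem_ball power_Suc)
    also have "\<dots> \<le> (\<Sum>n. ennreal (2 powr (- b * real n)) * indicator (ball c (D * 2 ^ Suc n)) z)"
      by (rule le_suminf)
    finally show ?thesis unfolding t_def[symmetric] by (rule order_trans) simp
  qed
qed

text \<open>The areas turn the two dyadic sums into geometric series with ratios 2^(a-2) and
  2^(2-b). The constant depends on the exponents only, not on the centre or the scale.\<close>

lemma radial_integral:
  assumes a: "0 \<le> a" "a < 2" and b: "2 < b"
  shows "\<exists>C>0. \<forall>D>0. \<forall>c::complex.
    (\<integral>\<^sup>+ z. ennreal (radial a b (cmod (z - c) / D)) \<partial>lborel) \<le> ennreal (C * D\<^sup>2)"
proof -
  define A where "A = (\<Sum>n. (2 powr (a - 2)) ^ n)"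
  define B where "B = (\<Sum>n. (2 powr (2 - b)) ^ n)"
  have sA: "summable (\<lambda>n. (2 powr (a - 2)) ^ n)" and sB: "summable (\<lambda>n. (2 powr (2 - b)) ^ n)"
    using a b by (auto intro!: summable_geometric simp: powr_less_one)
  have A0: "A \<ge> 0" and B0: "B \<ge> 0" unfolding A_def B_def by (auto intro!: suminf_nonneg sA sB)
  have meas: "(\<lambda>z. ennreal k * indicator (ball c r) z) \<in> borel_measurable lborel" for k r and c :: complex
    by (auto intro!: borel_measurable_times_ennreal borel_measurable_indicator)
  have int_eq: "(\<integral>\<^sup>+ z. (\<Sum>n. ennreal (k n) * indicator (ball c (r n)) z) \<partial>lborel) =
      (\<Sum>n. ennreal (k n) * emeasure lborel (ball c (r n)))" for k r and c :: complex
    by (subst nn_integral_suminf[OF meas]) (intro arg_cong[where f = suminf] ext nn_integral_cmult_indicator, simp)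
  have sum_eq: "(\<Sum>n. ennreal (k * r ^ n)) = ennreal (k * (\<Sum>n. r ^ n))"
    if "k \<ge> 0" "r \<ge> 0" "summable (\<lambda>n. r ^ n)" for k r :: real
    using that by (subst suminf_ennreal2) (auto intro!: summable_mult simp: suminf_mult)
  have "(\<integral>\<^sup>+ z. ennreal (radial a b (cmod (z - c) / D)) \<partial>lborel) \<le>
      ennreal ((pi * 2 powr a * A + 4 * pi * B + 1) * D\<^sup>2)" if D: "D > 0" for D and c :: complex
  proof -
    have "(\<integral>\<^sup>+ z. ennreal (radial a b (cmod (z - c) / D)) \<partial>lborel) \<le>
       (\<integral>\<^sup>+ z. (\<Sum>n. ennreal (2 powr (a * real (Suc n))) * indicator (ball c (D * (1/2) ^ n)) z) +
         (\<Sum>n. ennreal (2 powr (- b * real n)) * indicator (ball c (D * 2 ^ Suc n)) z) \<partial>lborel)"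
      using a b by (intro nn_integral_mono radial_le_dyadic D) auto
    also have "\<dots> = (\<Sum>n. ennreal (2 powr (a * real (Suc n))) * emeasure lborel (ball c (D * (1/2) ^ n))) +
        (\<Sum>n. ennreal (2 powr (- b * real n)) * emeasure lborel (ball c (D * 2 ^ Suc n)))"
      by (subst nn_integral_add) (intro borel_measurable_suminf_order meas, intro borel_measurable_suminf_order meas, simp only: int_eq)
    also have "(\<lambda>n. ennreal (2 powr (a * real (Suc n))) * emeasure lborel (ball c (D * (1/2) ^ n))) =
        (\<lambda>n. ennreal ((pi * 2 powr a * D\<^sup>2) * (2 powr (a - 2)) ^ n))"
    proof
      fix n
      have "2 powr (a * real (Suc n)) * (pi * (D * (1/2) ^ n)\<^sup>2) = (pi * 2 powr a * D\<^sup>2) * (2 powr (a - 2)) ^ n"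
      proof -
        have "2 powr (a * real (Suc n)) = 2 powr a * (2 powr a) ^ n"
          by (simp add: powr_realpow[symmetric] powr_powr powr_add[symmetric] algebra_simps)
        moreover have "(2 powr (a - 2)) ^ n = (2 powr a) ^ n * ((1/2) ^ n)\<^sup>2"
          by (simp add: powr_diff power_divide power_mult[symmetric] mult.commute power2_eq_square power_mult_distrib[symmetric])
        ultimately show ?thesis by (simp add: power_mult_distrib)
      qed
      then show "ennreal (2 powr (a * real (Suc n))) * emeasure lborel (ball c (D * (1/2) ^ n)) =
        ennreal ((pi * 2 powr a * D\<^sup>2) * (2 powr (a - 2)) ^ n)"
        using D by (simp add: emeasure_ball_complex ennreal_mult''[symmetric])
    qed
    also have "(\<lambda>n. ennreal (2 powr (- b * real n)) * emeasure lborel (ball c (D * 2 ^ Suc n))) =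
        (\<lambda>n. ennreal ((4 * pi * D\<^sup>2) * (2 powr (2 - b)) ^ n))"
    proof
      fix n
      have "2 powr (- b * real n) * (pi * (D * 2 ^ Suc n)\<^sup>2) = (4 * pi * D\<^sup>2) * (2 powr (2 - b)) ^ n"
      proof -
        have "2 powr (- b * real n) = (2 powr - b) ^ n"
          by (simp add: powr_realpow[symmetric] powr_powr)
        moreover have "(2 powr (2 - b)) ^ n = (2 powr - b) ^ n * (2 ^ n)\<^sup>2"
        proof -
          have "2 powr (2 - b) = 2 powr - b * (2 * 2)" using powr_add[of 2 "- b" 2] by simp
          then show ?thesis by (simp only: power_mult_distrib power2_eq_square)
        qed
        ultimately show ?thesis by (simp add: power_mult_distrib)
      qed
      then show "ennreal (2 powr (- b * real n)) * emeasure lborel (ball c (D * 2 ^ Suc n)) =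
        ennreal ((4 * pi * D\<^sup>2) * (2 powr (2 - b)) ^ n)"
        using D by (simp add: emeasure_ball_complex ennreal_mult''[symmetric] del: power_Suc)
    qed
    also have "(\<Sum>n. ennreal ((pi * 2 powr a * D\<^sup>2) * (2 powr (a - 2)) ^ n)) +
        (\<Sum>n. ennreal ((4 * pi * D\<^sup>2) * (2 powr (2 - b)) ^ n)) =
        ennreal (pi * 2 powr a * D\<^sup>2 * A + 4 * pi * D\<^sup>2 * B)"
      unfolding A_def B_def using A0 B0 sA sB
      by (subst (1 2) sum_eq) (auto simp: A_def B_def ennreal_plus[symmetric] simp del: ennreal_plus)
    also have "\<dots> \<le> ennreal ((pi * 2 powr a * A + 4 * pi * B + 1) * D\<^sup>2)"
      by (intro ennreal_leI) (simp add: algebra_simps)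
    finally show ?thesis .
  qed
  moreover have "pi * 2 powr a * A + 4 * pi * B + 1 > 0"
    using A0 B0 by (intro add_nonneg_pos add_nonneg_nonneg mult_nonneg_nonneg) auto
  ultimately show ?thesis by blast
qed

section \<open>Bounds for the integral\<close>

definition root_integral :: "nat \<Rightarrow> real \<Rightarrow> real \<Rightarrow> (nat \<Rightarrow> complex) \<Rightarrow> ennreal" where
  "root_integral N \<delta> \<Lambda> \<alpha> = (\<integral>\<^sup>+ z \<in> ball 0 \<Lambda>. ennreal (cmod (\<Prod>i<N. z - \<alpha> i) powr - \<delta>) \<partial>lborel)"

lemma root_integral_ge_disc:
  assumes sub: "ball c r \<subseteq> ball 0 \<Lambda>" and r: "r \<ge> 0" and M: "M > 0" and \<delta>: "\<delta> > 0"
    and le: "\<And>z. z \<in> ball c r \<Longrightarrow> cmod (\<Prod>i<N. z - \<alpha> i) \<le> M"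
  shows "ennreal (pi * r\<^sup>2 * M powr - \<delta>) \<le> root_integral N \<delta> \<Lambda> \<alpha>"
proof -
  \<comment> \<open>At a zero the integrand is 0 by the convention for \<open>powr\<close>, so the
    pointwise bound fails there; the zeros form a null set.\<close>
  have "AE z in lborel. z \<notin> \<alpha> ` {..<N}"
    by (intro AE_not_in finite_imp_null_set_lborel) auto
  then have AE: "AE z in lborel. (\<Prod>i<N. z - \<alpha> i) \<noteq> 0"
    by eventually_elim auto
  have "ennreal (pi * r\<^sup>2 * M powr - \<delta>) = ennreal (M powr - \<delta>) * emeasure lborel (ball c r)"
    using r by (simp add: emeasure_ball_complex ennreal_mult''[symmetric] mult.commute)
  also have "\<dots> = (\<integral>\<^sup>+ z. ennreal (M powr - \<delta>) * indicator (ball c r) z \<partial>lborel)"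
    by (subst nn_integral_cmult_indicator) auto
  also have "\<dots> \<le> (\<integral>\<^sup>+ z \<in> ball 0 \<Lambda>. ennreal (cmod (\<Prod>i<N. z - \<alpha> i) powr - \<delta>) \<partial>lborel)"
  proof (rule nn_integral_mono_AE, use AE in eventually_elim)
    case (elim z)
    show ?case
    proof (cases "z \<in> ball c r")
      case True
      then have "M powr - \<delta> \<le> cmod (\<Prod>i<N. z - \<alpha> i) powr - \<delta>"
        using le[OF True] elim \<delta> by (intro powr_mono2') auto
      then show ?thesis using True sub by (auto simp: indicator_def ennreal_leI simp del: mem_ball)
    qed simp
  qed
  finally show ?thesis by (simp add: root_integral_def)
qed

lemma weight_powr:
  assumes "\<rho> > 0" "q > 0" "real p * \<delta> = 2 * real q"
  shows "weight N p q d \<rho> powr - (\<delta> / real q) = \<rho>\<^sup>2 * (\<Prod>j<N. max \<rho> (d j)) powr - \<delta>"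
proof -
  define P where "P = (\<Prod>j<N. max \<rho> (d j))"
  have P: "P > 0" unfolding P_def using assms(1) by (intro prod_pos) auto
  have "weight N p q d \<rho> powr - (\<delta> / real q) = (P ^ q) powr - (\<delta> / real q) / (\<rho> ^ p) powr - (\<delta> / real q)"
    unfolding weight_def P_def[symmetric] by (rule powr_divide)
  also have "(P ^ q) powr - (\<delta> / real q) = P powr - \<delta>"
    using P assms(2) by (simp add: powr_realpow[symmetric] powr_powr)
  also have "(\<rho> ^ p) powr - (\<delta> / real q) = \<rho> powr - 2"
    using assms by (simp add: powr_realpow[symmetric] powr_powr)
  also have "P powr - \<delta> / \<rho> powr - 2 = \<rho>\<^sup>2 * P powr - \<delta>"
    using assms(1) by (simp add: powr_minus_divide)
  finally show ?thesis unfolding P_def .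
qed

text \<open>The test disc has radius \<rho>/2 about \<alpha>_i; |\<alpha>_i| < \<Lambda>/2 and
  \<rho> \<le> \<Lambda> keep it inside the domain. On it every factor is at most twice
  \<open>max \<rho> (dists \<alpha> i j)\<close>. That \<rho> need not be the threshold is what
  later forces divergence.\<close>

lemma root_integral_ge_weight:
  assumes \<delta>: "\<delta> > 0" and q: "q > 0" "real p * \<delta> = 2 * real q"
    and \<rho>: "0 < \<rho>" "\<rho> \<le> \<Lambda>" and i: "cmod (\<alpha> i) < \<Lambda> / 2"
  shows "ennreal (pi / 4 * (2 ^ N) powr - \<delta> * weight N p q (dists \<alpha> i) \<rho> powr - (\<delta> / real q))
    \<le> root_integral N \<delta> \<Lambda> \<alpha>"
proof -
  let ?P = "\<Prod>j<N. max \<rho> (dists \<alpha> i j)"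
  have P: "?P > 0" using \<rho> by (intro prod_pos) auto
  have "ennreal (pi * (\<rho> / 2)\<^sup>2 * (2 ^ N * ?P) powr - \<delta>) \<le> root_integral N \<delta> \<Lambda> \<alpha>"
  proof (rule root_integral_ge_disc[of "\<alpha> i"])
    show "ball (\<alpha> i) (\<rho> / 2) \<subseteq> ball 0 \<Lambda>"
    proof
      fix z assume "z \<in> ball (\<alpha> i) (\<rho> / 2)"
      then have "cmod (z - \<alpha> i) < \<rho> / 2" by (simp add: dist_norm norm_minus_commute)
      then show "z \<in> ball 0 \<Lambda>" using i \<rho> norm_triangle_sub[of z "\<alpha> i"] by simp
    qed
    fix z assume "z \<in> ball (\<alpha> i) (\<rho> / 2)"
    then have z: "cmod (z - \<alpha> i) < \<rho> / 2" by (simp add: dist_norm norm_minus_commute)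
    have "cmod (z - \<alpha> j) \<le> 2 * max \<rho> (dists \<alpha> i j)" for j
      using norm_triangle_ineq[of "z - \<alpha> i" "\<alpha> i - \<alpha> j"] z \<rho> by simp
    then have "(\<Prod>j<N. cmod (z - \<alpha> j)) \<le> (\<Prod>j<N. 2 * max \<rho> (dists \<alpha> i j))"
      by (intro prod_mono) auto
    then show "cmod (\<Prod>j<N. z - \<alpha> j) \<le> 2 ^ N * ?P"
      by (simp add: prod_norm prod.distrib)
  qed (use \<rho> \<delta> P in auto)
  also have "pi * (\<rho> / 2)\<^sup>2 * (2 ^ N * ?P) powr - \<delta> =
      pi / 4 * (2 ^ N) powr - \<delta> * weight N p q (dists \<alpha> i) \<rho> powr - (\<delta> / real q)"
    unfolding weight_powr[OF \<rho>(1) q] using P by (simp add: powr_mult power_divide)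
  finally show ?thesis .
qed

text \<open>For r < D only the factors with d_j < D can shrink, by a ratio no smaller than r/D, and
  there are at most k of them. For r \<ge> D all factors with d_j \<le> D grow by the full ratio
  r/D, and there are at least k + 1 of them.\<close>

lemma prod_max_ge:
  fixes d :: "nat \<Rightarrow> real"
  assumes D: "D > 0" and r: "r > 0"
    and lo: "card {j\<in>{..<N}. d j < D} \<le> k" and hi: "k < card {j\<in>{..<N}. d j \<le> D}"
  shows "(\<Prod>j<N. max D (d j)) * (if r / D < 1 then (r / D) ^ k else (r / D) ^ Suc k) \<le> (\<Prod>j<N. max r (d j))"
proof -
  have pow: "(\<Prod>j<N. if P j then x else 1) = x ^ card {j\<in>{..<N}. P j}" for P and x :: real
    by (simp add: prod.If_cases Int_def)
  have P0: "(\<Prod>j<N. max D (d j)) \<ge> 0" using D by (intro prod_nonneg) auto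
  show ?thesis
  proof (cases "r / D < 1")
    case True
    have "(r / D) ^ k \<le> (r / D) ^ card {j\<in>{..<N}. d j < D}"
      using True D r lo by (intro power_decreasing) auto
    also have "\<dots> = (\<Prod>j<N. if d j < D then r / D else 1)" by (simp add: pow)
    finally have "(\<Prod>j<N. max D (d j)) * (r / D) ^ k \<le> (\<Prod>j<N. max D (d j)) * (\<Prod>j<N. if d j < D then r / D else 1)"
      using P0 by (rule mult_left_mono)
    also have "\<dots> = (\<Prod>j<N. max D (d j) * (if d j < D then r / D else 1))" by (simp add: prod.distrib)
    also have "\<dots> \<le> (\<Prod>j<N. max r (d j))" using D r by (intro prod_mono) auto
    finally show ?thesis using True by simp
  next
    case False
    then have rD: "r \<ge> D" using D by simp
    have "(r / D) ^ Suc k \<le> (r / D) ^ card {j\<in>{..<N}. d j \<le> D}"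
      using False hi by (intro power_increasing) auto
    also have "\<dots> = (\<Prod>j<N. if d j \<le> D then r / D else 1)" by (simp add: pow)
    finally have "(\<Prod>j<N. max D (d j)) * (r / D) ^ Suc k \<le> (\<Prod>j<N. max D (d j)) * (\<Prod>j<N. if d j \<le> D then r / D else 1)"
      using P0 by (rule mult_left_mono)
    also have "\<dots> = (\<Prod>j<N. max D (d j) * (if d j \<le> D then r / D else 1))" by (simp add: prod.distrib)
    also have "\<dots> \<le> (\<Prod>j<N. max r (d j))" using D r rD by (intro prod_mono) auto
    finally show ?thesis using False by (simp del: power_Suc)
  qed
qed

text \<open>For the nearest zero, |\<alpha>_i - \<alpha>_j| \<le> |z - \<alpha>_i| + |z -
  \<alpha>_j| \<le> 2 |z - \<alpha>_j|, so each factor is at least half of the corresponding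
  maximum.\<close>

lemma nearest_root:
  assumes "N > 0" and Q: "(\<Prod>i<N. z - \<alpha> i) \<noteq> 0"
  obtains i where "i < N" "cmod (z - \<alpha> i) > 0"
    "\<And>j. j < N \<Longrightarrow> cmod (z - \<alpha> i) \<le> cmod (z - \<alpha> j)"
    "(\<Prod>j<N. max (cmod (z - \<alpha> i)) (dists \<alpha> i j)) / 2 ^ N \<le> cmod (\<Prod>i<N. z - \<alpha> i)"
proof -
  obtain i where i: "i < N" "\<And>j. j < N \<Longrightarrow> cmod (z - \<alpha> i) \<le> cmod (z - \<alpha> j)"
    using ex_min_if_finite[of "(\<lambda>j. cmod (z - \<alpha> j)) ` {..<N}"] assms(1) by (auto simp: not_less)
  have "(\<Prod>j<N. max (cmod (z - \<alpha> i)) (dists \<alpha> i j) / 2) \<le> (\<Prod>j<N. cmod (z - \<alpha> j))"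
  proof (intro prod_mono conjI)
    fix j assume "j \<in> {..<N}"
    then have "cmod (z - \<alpha> i) \<le> cmod (z - \<alpha> j)" using i(2) by simp
    moreover have "dists \<alpha> i j \<le> cmod (z - \<alpha> j) + cmod (z - \<alpha> i)"
      using norm_triangle_ineq4[of "z - \<alpha> j" "z - \<alpha> i"] by simp
    ultimately show "max (cmod (z - \<alpha> i)) (dists \<alpha> i j) / 2 \<le> cmod (z - \<alpha> j)"
      using norm_ge_zero[of "z - \<alpha> j"] by linarith
  qed (simp add: le_max_iff_disj)
  then have "(\<Prod>j<N. max (cmod (z - \<alpha> i)) (dists \<alpha> i j)) / 2 ^ N \<le> cmod (\<Prod>i<N. z - \<alpha> i)"
    by (simp add: prod_norm prod_dividef)
  moreover have "cmod (z - \<alpha> i) > 0" using Q i(1) by auto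
  ultimately show ?thesis using that i by blast
qed

text \<open>The dominating index may vary with z; adding all N radial profiles covers every choice,
  and each integrates to a multiple of its squared scale. The constant is fixed before zeros, scales
  and heights.\<close>

lemma root_integral_le_radial:
  assumes \<delta>: "\<delta> > 0" and ab: "0 \<le> a" "a < 2" "2 < b"
  shows "\<exists>C>0. \<forall>\<alpha> D K. (\<forall>i<N. D i > 0 \<and> K i \<ge> 0) \<longrightarrow>
     (\<forall>z\<in>ball 0 \<Lambda>. (\<Prod>i<N. z - \<alpha> i) \<noteq> 0 \<longrightarrow>
        (\<exists>i<N. cmod (\<Prod>i<N. z - \<alpha> i) powr - \<delta> \<le> K i * radial a b (cmod (z - \<alpha> i) / D i))) \<longrightarrow>
     root_integral N \<delta> \<Lambda> \<alpha> \<le> ennreal (C * (\<Sum>i<N. K i * (D i)\<^sup>2))"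
proof -
  obtain C where C: "C > 0" and int: "\<And>D c. D > 0 \<Longrightarrow>
      (\<integral>\<^sup>+ z. ennreal (radial a b (cmod (z - c) / D)) \<partial>lborel) \<le> ennreal (C * D\<^sup>2)"
    using radial_integral[OF ab] by blast
  have "root_integral N \<delta> \<Lambda> \<alpha> \<le> ennreal (C * (\<Sum>i<N. K i * (D i)\<^sup>2))"
    if DK: "\<And>i. i < N \<Longrightarrow> D i > 0 \<and> K i \<ge> 0"
      and bd: "\<And>z. z \<in> ball 0 \<Lambda> \<Longrightarrow> (\<Prod>i<N. z - \<alpha> i) \<noteq> 0 \<Longrightarrow>
         \<exists>i<N. cmod (\<Prod>i<N. z - \<alpha> i) powr - \<delta> \<le> K i * radial a b (cmod (z - \<alpha> i) / D i)"
    for \<alpha> D K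
  proof -
    let ?R = "\<lambda>i z. K i * radial a b (cmod (z - \<alpha> i) / D i)"
    have R0: "?R i z \<ge> 0" if "i < N" for i z
      using DK[OF that] radial_nonneg by (intro mult_nonneg_nonneg) auto
    have "root_integral N \<delta> \<Lambda> \<alpha> \<le> (\<integral>\<^sup>+ z. (\<Sum>i<N. ennreal (?R i z)) \<partial>lborel)"
      unfolding root_integral_def
    proof (rule nn_integral_mono)
      fix z
      show "ennreal (cmod (\<Prod>i<N. z - \<alpha> i) powr - \<delta>) * indicator (ball 0 \<Lambda>) z \<le> (\<Sum>i<N. ennreal (?R i z))"
      proof (cases "z \<in> ball 0 \<Lambda> \<and> (\<Prod>i<N. z - \<alpha> i) \<noteq> 0")
        case True
        then obtain i where i: "i < N" "cmod (\<Prod>i<N. z - \<alpha> i) powr - \<delta> \<le> ?R i z" using bd by blast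
        have "ennreal (cmod (\<Prod>i<N. z - \<alpha> i) powr - \<delta>) \<le> ennreal (?R i z)" using i(2) by (rule ennreal_leI)
        also have "\<dots> \<le> (\<Sum>i<N. ennreal (?R i z))" using i(1) by (intro member_le_sum) auto
        finally show ?thesis using True by (simp add: indicator_def del: mem_ball)
      next
        case False
        then consider "z \<notin> ball 0 \<Lambda>" | "(\<Prod>i<N. z - \<alpha> i) = 0" by blast
        then show ?thesis
        proof cases
          case 2
          show ?thesis unfolding 2 by simp
        qed simp
      qed
    qed
    also have "\<dots> = (\<Sum>i<N. \<integral>\<^sup>+ z. ennreal (?R i z) \<partial>lborel)"
      by (intro nn_integral_sum) measurable
    also have "\<dots> \<le> (\<Sum>i<N. ennreal (C * (K i * (D i)\<^sup>2)))"
    proof (rule sum_mono)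
      fix i assume "i \<in> {..<N}"
      then have i: "D i > 0" "K i \<ge> 0" using DK by auto
      have "(\<integral>\<^sup>+ z. ennreal (?R i z) \<partial>lborel) =
          ennreal (K i) * (\<integral>\<^sup>+ z. ennreal (radial a b (cmod (z - \<alpha> i) / D i)) \<partial>lborel)"
        using i(2) radial_nonneg by (subst nn_integral_cmult[symmetric]) (auto simp: ennreal_mult)
      also have "\<dots> \<le> ennreal (K i) * ennreal (C * (D i)\<^sup>2)" by (intro mult_left_mono int i) simp
      also have "\<dots> = ennreal (C * (K i * (D i)\<^sup>2))"
        using i C by (simp add: ennreal_mult'[symmetric] mult_ac)
      finally show "(\<integral>\<^sup>+ z. ennreal (?R i z) \<partial>lborel) \<le> ennreal (C * (K i * (D i)\<^sup>2))" .
    qed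
    also have "\<dots> = ennreal (\<Sum>i<N. C * (K i * (D i)\<^sup>2))"
      using DK C by (intro sum_ennreal) auto
    finally show ?thesis by (simp add: sum_distrib_left)
  qed
  then show ?thesis using C by blast
qed

text \<open>Let k be the integer part of p/q = 2/\<delta>. As p is not a multiple of q, the
  inequalities \<delta> k < 2 < \<delta> (k + 1) are strict, and these are the exponents of an
  integrable radial profile of scale D_i around the zero nearest to z.\<close>

lemma root_integral_le_weight:
  assumes \<delta>: "\<delta> > 0" and q: "q > 0" "real p * \<delta> = 2 * real q"
    and p: "p < q * N" "\<And>k. k \<in> {..N} \<Longrightarrow> p \<noteq> q * k"
  shows "\<exists>C>0. \<forall>\<alpha> D. (\<forall>i<N. D i > 0 \<and> q * card {j\<in>{..<N}. dists \<alpha> i j < D i} < p \<and>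
        p < q * card {j\<in>{..<N}. dists \<alpha> i j \<le> D i}) \<longrightarrow>
     root_integral N \<delta> \<Lambda> \<alpha> \<le> ennreal (C * (\<Sum>i<N. weight N p q (dists \<alpha> i) (D i) powr - (\<delta> / real q)))"
proof -
  define k where "k = p div q"
  have N: "N > 0" using p(1) by (cases N) auto
  have "k < N" unfolding k_def using p(1) q by (simp add: div_less_iff_less_mult mult.commute)
  then have "p \<noteq> q * k" using p(2)[of k] by simp
  moreover have "q * k \<le> p" unfolding k_def by simp
  ultimately have "q * k < p" by simp
  then have "real q * real k < real p" by (metis of_nat_less_iff of_nat_mult)
  then have "(real q * real k) * \<delta> < real p * \<delta>" using \<delta> by (rule mult_strict_right_mono)
  then have a2: "\<delta> * real k < 2" using q by (simp add: mult_ac)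
  have "p < q * Suc k" unfolding k_def using q by (metis dividend_less_times_div mult_Suc_right)
  then have "real p < real q * real (Suc k)" by (metis of_nat_less_iff of_nat_mult)
  then have "real p * \<delta> < (real q * real (Suc k)) * \<delta>" using \<delta> by (rule mult_strict_right_mono)
  then have b2: "2 < \<delta> * real (Suc k)" using q by (simp add: mult_ac del: of_nat_Suc)
  let ?a = "\<delta> * real k" and ?b = "\<delta> * real (Suc k)"
  obtain C where C: "C > 0" and bound: "\<And>\<alpha> D K. (\<forall>i<N. D i > 0 \<and> K i \<ge> 0) \<Longrightarrow>
     (\<forall>z\<in>ball 0 \<Lambda>. (\<Prod>i<N. z - \<alpha> i) \<noteq> 0 \<longrightarrow>
        (\<exists>i<N. cmod (\<Prod>i<N. z - \<alpha> i) powr - \<delta> \<le> K i * radial ?a ?b (cmod (z - \<alpha> i) / D i))) \<Longrightarrow>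
     root_integral N \<delta> \<Lambda> \<alpha> \<le> ennreal (C * (\<Sum>i<N. K i * (D i)\<^sup>2))"
    using root_integral_le_radial[OF \<delta> _ a2 b2, of N \<Lambda>] \<delta> by auto
  define c where "c = (1 / 2 ^ N) powr - \<delta>"
  have c: "c > 0" unfolding c_def by simp
  have "root_integral N \<delta> \<Lambda> \<alpha> \<le> ennreal ((C * c) * (\<Sum>i<N. weight N p q (dists \<alpha> i) (D i) powr - (\<delta> / real q)))"
    if D: "\<And>i. i < N \<Longrightarrow> D i > 0" and lo: "\<And>i. i < N \<Longrightarrow> q * card {j\<in>{..<N}. dists \<alpha> i j < D i} < p"
      and hi: "\<And>i. i < N \<Longrightarrow> p < q * card {j\<in>{..<N}. dists \<alpha> i j \<le> D i}" for \<alpha> D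
  proof -
    define K where "K = (\<lambda>i. c * (\<Prod>j<N. max (D i) (dists \<alpha> i j)) powr - \<delta>)"
    have "root_integral N \<delta> \<Lambda> \<alpha> \<le> ennreal (C * (\<Sum>i<N. K i * (D i)\<^sup>2))"
    proof (rule bound)
      show "\<forall>i<N. D i > 0 \<and> K i \<ge> 0" using D c by (simp add: K_def)
      show "\<forall>z\<in>ball 0 \<Lambda>. (\<Prod>i<N. z - \<alpha> i) \<noteq> 0 \<longrightarrow>
        (\<exists>i<N. cmod (\<Prod>i<N. z - \<alpha> i) powr - \<delta> \<le> K i * radial ?a ?b (cmod (z - \<alpha> i) / D i))"
      proof (intro ballI impI)
        fix z assume Q: "(\<Prod>i<N. z - \<alpha> i) \<noteq> 0"
        obtain i where i: "i < N" "cmod (z - \<alpha> i) > 0"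
          "(\<Prod>j<N. max (cmod (z - \<alpha> i)) (dists \<alpha> i j)) / 2 ^ N \<le> cmod (\<Prod>i<N. z - \<alpha> i)"
          using nearest_root[OF N Q] by metis
        define t where "t = cmod (z - \<alpha> i) / D i"
        have t: "t > 0" using i(2) D[OF i(1)] by (simp add: t_def)
        let ?P = "\<Prod>j<N. max (D i) (dists \<alpha> i j)" and ?s = "if t < 1 then t ^ k else t ^ Suc k"
        have P: "?P > 0" using D[OF i(1)] by (intro prod_pos) (auto simp: less_max_iff_disj)
        have s: "?s > 0" using t by simp
        have "card {j\<in>{..<N}. dists \<alpha> i j < D i} \<le> k"
          unfolding k_def using lo[OF i(1)] q(1) by (simp add: less_eq_div_iff_mult_less_eq mult.commute)
        moreover have "k < card {j\<in>{..<N}. dists \<alpha> i j \<le> D i}"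
          unfolding k_def using hi[OF i(1)] q(1) by (simp add: div_less_iff_less_mult mult.commute)
        ultimately have "?P * ?s \<le> (\<Prod>j<N. max (cmod (z - \<alpha> i)) (dists \<alpha> i j))"
          unfolding t_def by (intro prod_max_ge D i)
        then have "1 / 2 ^ N * (?P * ?s) \<le> cmod (\<Prod>i<N. z - \<alpha> i)"
          using i(3) by (simp add: divide_right_mono order_trans[OF divide_right_mono])
        then have "cmod (\<Prod>i<N. z - \<alpha> i) powr - \<delta> \<le> (1 / 2 ^ N * (?P * ?s)) powr - \<delta>"
          using P s \<delta> by (intro powr_mono2') auto
        also have "\<dots> = c * (?P powr - \<delta> * ?s powr - \<delta>)"
          unfolding c_def using P s by (simp only: powr_mult)
        also have "?s powr - \<delta> = radial ?a ?b t"
          using t by (simp add: radial_def powr_realpow[symmetric] powr_powr mult.commute del: power_Suc of_nat_Suc)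
        finally have "cmod (\<Prod>i<N. z - \<alpha> i) powr - \<delta> \<le> K i * radial ?a ?b t" by (simp add: K_def mult.assoc)
        then show "\<exists>i<N. cmod (\<Prod>i<N. z - \<alpha> i) powr - \<delta> \<le> K i * radial ?a ?b (cmod (z - \<alpha> i) / D i)"
          using i(1) t_def by blast
      qed
    qed
    also have "(\<Sum>i<N. K i * (D i)\<^sup>2) = (\<Sum>i<N. c * weight N p q (dists \<alpha> i) (D i) powr - (\<delta> / real q))"
      using weight_powr[OF _ q] D by (intro sum.cong refl) (simp add: K_def)
    finally show ?thesis by (simp add: sum_distrib_left mult.assoc)
  qed
  then show ?thesis using C c by (intro exI[of _ "C * c"]) auto
qed

text \<open>Bounding |Q(z)| below by the N-th power of the distance to the nearest zero is enough
  when N \<delta> < 2. That distance stays below 2\<Lambda>, so the profile of scale 2\<Lambda> is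
  met only in its inner part; outside any exponent above 2 serves, and 3 is taken.\<close>

lemma root_integral_le_const:
  assumes \<delta>: "\<delta> > 0" "real N * \<delta> < 2" and \<Lambda>: "\<Lambda> > 0"
  shows "\<exists>C>0. \<forall>\<alpha>. (\<forall>i<N. cmod (\<alpha> i) < \<Lambda> / 2) \<longrightarrow> root_integral N \<delta> \<Lambda> \<alpha> \<le> ennreal C"
proof (cases "N = 0")
  case True
  have "root_integral N \<delta> \<Lambda> \<alpha> = ennreal (pi * \<Lambda>\<^sup>2)" for \<alpha>
    using True \<Lambda> by (simp add: root_integral_def emeasure_ball_complex)
  then show ?thesis using \<Lambda> by (intro exI[of _ "pi * \<Lambda>\<^sup>2"]) auto
next
  case False
  let ?a = "real N * \<delta>"
  obtain C where C: "C > 0" and bound: "\<And>\<alpha> D K. (\<forall>i<N. D i > 0 \<and> K i \<ge> 0) \<Longrightarrow>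
     (\<forall>z\<in>ball 0 \<Lambda>. (\<Prod>i<N. z - \<alpha> i) \<noteq> 0 \<longrightarrow>
        (\<exists>i<N. cmod (\<Prod>i<N. z - \<alpha> i) powr - \<delta> \<le> K i * radial ?a 3 (cmod (z - \<alpha> i) / D i))) \<Longrightarrow>
     root_integral N \<delta> \<Lambda> \<alpha> \<le> ennreal (C * (\<Sum>i<N. K i * (D i)\<^sup>2))"
    using root_integral_le_radial[OF \<delta>(1) _ \<delta>(2), of 3 N \<Lambda>] \<delta> by auto
  define K where "K = (2 * \<Lambda>) powr - ?a"
  have K: "K > 0" using \<Lambda> by (simp add: K_def)
  have "root_integral N \<delta> \<Lambda> \<alpha> \<le> ennreal (C * (\<Sum>i<N. K * (2 * \<Lambda>)\<^sup>2))"
    if \<alpha>: "\<And>i. i < N \<Longrightarrow> cmod (\<alpha> i) < \<Lambda> / 2" for \<alpha>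
  proof (rule bound)
    show "\<forall>i<N. 0 < 2 * \<Lambda> \<and> 0 \<le> K" using \<Lambda> K by simp
    show "\<forall>z\<in>ball 0 \<Lambda>. (\<Prod>i<N. z - \<alpha> i) \<noteq> 0 \<longrightarrow>
        (\<exists>i<N. cmod (\<Prod>i<N. z - \<alpha> i) powr - \<delta> \<le> K * radial ?a 3 (cmod (z - \<alpha> i) / (2 * \<Lambda>)))"
    proof (intro ballI impI)
      fix z :: complex assume z: "z \<in> ball 0 \<Lambda>" and Q: "(\<Prod>i<N. z - \<alpha> i) \<noteq> 0"
      obtain i where i: "i < N" "cmod (z - \<alpha> i) > 0" "\<And>j. j < N \<Longrightarrow> cmod (z - \<alpha> i) \<le> cmod (z - \<alpha> j)"
        using nearest_root[OF _ Q] False by (metis neq0_conv)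
      let ?r = "cmod (z - \<alpha> i)"
      have "?r < 2 * \<Lambda>" using z \<alpha>[OF i(1)] norm_triangle_ineq4[of z "\<alpha> i"] \<Lambda> by simp
      then have rad: "radial ?a 3 (?r / (2 * \<Lambda>)) = (?r / (2 * \<Lambda>)) powr - ?a" using \<Lambda> by (simp add: radial_def)
      have "(\<Prod>j<N. ?r) \<le> (\<Prod>j<N. cmod (z - \<alpha> j))" using i(3) by (intro prod_mono) auto
      then have "?r ^ N \<le> cmod (\<Prod>i<N. z - \<alpha> i)" by (simp add: prod_norm)
      then have "cmod (\<Prod>i<N. z - \<alpha> i) powr - \<delta> \<le> (?r ^ N) powr - \<delta>"
        using i(2) \<delta> by (intro powr_mono2') auto
      also have "\<dots> = ?r powr - ?a" using i(2) by (simp add: powr_realpow[symmetric] powr_powr)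
      also have "\<dots> = K * (?r / (2 * \<Lambda>)) powr - ?a"
        unfolding K_def using i(2) \<Lambda> by (subst powr_mult[symmetric]) auto
      finally show "\<exists>i<N. cmod (\<Prod>i<N. z - \<alpha> i) powr - \<delta> \<le> K * radial ?a 3 (cmod (z - \<alpha> i) / (2 * \<Lambda>))"
        using i(1) rad by auto
    qed
  qed
  moreover have "C * (\<Sum>i<N. K * (2 * \<Lambda>)\<^sup>2) > 0"
    using C K \<Lambda> False by (intro mult_pos_pos) auto
  ultimately show ?thesis by blast
qed

lemma root_integral_ge_const:
  assumes \<delta>: "\<delta> > 0" and \<Lambda>: "\<Lambda> > 0"
  shows "\<exists>c>0. \<forall>\<alpha>. (\<forall>i<N. cmod (\<alpha> i) < \<Lambda> / 2) \<longrightarrow> ennreal c \<le> root_integral N \<delta> \<Lambda> \<alpha>"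
proof (intro exI[of _ "pi * \<Lambda>\<^sup>2 * ((2 * \<Lambda>) ^ N) powr - \<delta>"] conjI allI impI)
  fix \<alpha> assume \<alpha>: "\<forall>i<N. cmod (\<alpha> i) < \<Lambda> / 2"
  show "ennreal (pi * \<Lambda>\<^sup>2 * ((2 * \<Lambda>) ^ N) powr - \<delta>) \<le> root_integral N \<delta> \<Lambda> \<alpha>"
  proof (rule root_integral_ge_disc[of 0])
    fix z :: complex assume z: "z \<in> ball 0 \<Lambda>"
    have "(\<Prod>i<N. cmod (z - \<alpha> i)) \<le> (\<Prod>i<N. 2 * \<Lambda>)"
    proof (intro prod_mono conjI)
      fix i assume "i \<in> {..<N}"
      then show "cmod (z - \<alpha> i) \<le> 2 * \<Lambda>"
        using z \<alpha>[rule_format, of i] norm_triangle_ineq4[of z "\<alpha> i"] \<Lambda> by simp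
    qed simp
    then show "cmod (\<Prod>i<N. z - \<alpha> i) \<le> (2 * \<Lambda>) ^ N" by (simp add: prod_norm)
  qed (use \<Lambda> \<delta> in auto)
qed (use \<Lambda> in simp)

section \<open>The comparison\<close>

text \<open>Since \<open>e\<close> is \<gamma>/(2L), raising to the power \<open>e\<close> turns
  x^(2L) into x^\<gamma> and yields the exponent that the formula puts on the sum of
  squares.\<close>

lemma powr_comparison:
  fixes x s :: real
  assumes x: "x \<ge> 0" and s: "s \<ge> 0" and C: "C > 0" and L: "L > 0" and \<gamma>: "\<gamma> > 0"
    and le: "x ^ (2 * L) \<le> C * s" "s \<le> C * x ^ (2 * L)"
  defines "e \<equiv> \<gamma> / real L / 2"
  shows "x powr \<gamma> \<le> C powr e * s powr e" "s powr e \<le> C powr e * x powr \<gamma>"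
proof -
  have e: "e \<ge> 0" using \<gamma> by (simp add: e_def)
  have eq: "(x ^ (2 * L)) powr e = x powr \<gamma>"
  proof (cases "x = 0")
    case False
    then have "(x ^ (2 * L)) powr e = x powr (real (2 * L) * e)"
      using x by (simp add: powr_realpow[symmetric] powr_powr del: of_nat_mult)
    also have "real (2 * L) * e = \<gamma>" using L by (simp add: e_def)
    finally show ?thesis .
  qed (use L in simp)
  have "(x ^ (2 * L)) powr e \<le> (C * s) powr e" using le(1) e x by (intro powr_mono2) auto
  then show "x powr \<gamma> \<le> C powr e * s powr e" using C s by (simp add: eq powr_mult)
  have "s powr e \<le> (C * x ^ (2 * L)) powr e" using le(2) e s by (intro powr_mono2) auto
  then show "s powr e \<le> C powr e * x powr \<gamma>" using C x by (simp add: eq powr_mult)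
qed

lemma negpow_integral_eq:
  assumes "\<And>z. Qpoly N a z = (\<Prod>i<N. z - \<alpha> i)"
  shows "negpow_integral N \<delta> \<Lambda> a = root_integral N \<delta> \<Lambda> \<alpha>"
  unfolding negpow_integral_def root_integral_def assms ..

text \<open>The passage from zeros to coefficients. A two-sided bound by X/Y, with X and Y
  represented by integer polynomials, becomes the asserted formula with exponents \<gamma>/L1 and
  \<gamma>/L2; the constants of the three comparisons multiply.\<close>

lemma asymp_formulaI:
  fixes X Y :: "(nat \<Rightarrow> complex) \<Rightarrow> real"
  assumes \<gamma>: "\<gamma> > 0" and L: "L1 > 0" "L2 > 0" and C: "C > 0"
    and XY: "\<And>\<alpha>. X \<alpha> \<ge> 0" "\<And>\<alpha>. Y \<alpha> \<ge> 0"
    and XF: "comparable N N' I F L1 X" and YG: "comparable N N' J G L2 Y"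
    and inf: "\<And>\<alpha>. (\<And>i. i < N \<Longrightarrow> cmod (\<alpha> i) < \<Lambda> / 2) \<Longrightarrow> root_integral N \<delta> \<Lambda> \<alpha> = \<infinity> \<longleftrightarrow> Y \<alpha> = 0"
    and fin: "\<And>\<alpha>. (\<And>i. i < N \<Longrightarrow> cmod (\<alpha> i) < \<Lambda> / 2) \<Longrightarrow> Y \<alpha> \<noteq> 0 \<Longrightarrow>
      root_integral N \<delta> \<Lambda> \<alpha> \<le> ennreal (C * (X \<alpha> / Y \<alpha>) powr \<gamma>) \<and>
      ennreal ((X \<alpha> / Y \<alpha>) powr \<gamma>) \<le> ennreal C * root_integral N \<delta> \<Lambda> \<alpha>"
  shows "asymp_formula N \<delta> \<Lambda> N' I J (\<gamma> / real L1) (\<gamma> / real L2) F G"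
proof -
  obtain C1 where C1: "C1 > 0" and F: "\<And>\<alpha>. X \<alpha> ^ (2 * L1) \<le> C1 * sq_sum N N' I F \<alpha> \<and>
      sq_sum N N' I F \<alpha> \<le> C1 * X \<alpha> ^ (2 * L1)"
    using XF unfolding comparable_def by blast
  obtain C2 where C2: "C2 > 0" and G: "\<And>\<alpha>. Y \<alpha> ^ (2 * L2) \<le> C2 * sq_sum N N' J G \<alpha> \<and>
      sq_sum N N' J G \<alpha> \<le> C2 * Y \<alpha> ^ (2 * L2)"
    using YG unfolding comparable_def by blast
  let ?e1 = "\<gamma> / real L1 / 2" and ?e2 = "\<gamma> / real L2 / 2"
  define A where "A = C1 powr ?e1 * C2 powr ?e2"
  have A: "A > 0" using C1 C2 by (simp add: A_def)
  have S0: "sq_sum N N' K H \<alpha> \<ge> 0" for K H \<alpha> unfolding sq_sum_def by (intro sum_nonneg) auto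
  have main: "(negpow_integral N \<delta> \<Lambda> a = \<infinity> \<longleftrightarrow> (\<forall>j<J. mpoly_eval N N' (G j) a = 0)) \<and>
      (negpow_integral N \<delta> \<Lambda> a \<noteq> \<infinity> \<longrightarrow>
        (let R = (\<Sum>i<I. (cmod (mpoly_eval N N' (F i) a))\<^sup>2) powr (\<gamma> / real L1 / 2) /
               (\<Sum>j<J. (cmod (mpoly_eval N N' (G j) a))\<^sup>2) powr (\<gamma> / real L2 / 2)
         in negpow_integral N \<delta> \<Lambda> a \<le> ennreal ((A * C) * R) \<and>
            ennreal R \<le> ennreal (A * C) * negpow_integral N \<delta> \<Lambda> a))"
    if a0: "a 0 = 1" and rts: "\<forall>z. Qpoly N a z = 0 \<longrightarrow> z \<in> ball 0 (\<Lambda> / 2)" for a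
  proof -
    obtain \<alpha> where va: "\<And>n. n \<le> N \<Longrightarrow> a n = vieta {..<N} \<alpha> n" and Q: "\<And>z. Qpoly N a z = (\<Prod>i<N. z - \<alpha> i)"
      using exists_roots[of a N, OF a0] by blast
    have ev: "mpoly_eval N N' c a = mpoly_eval N N' c (vieta {..<N} \<alpha>)" for c
      using va by (intro mpoly_eval_cong) auto
    have ok: "cmod (\<alpha> i) < \<Lambda> / 2" if "i < N" for i
      using rts[rule_format, of "\<alpha> i"] that by (auto simp: Q)
    let ?I = "root_integral N \<delta> \<Lambda> \<alpha>"
    have I: "negpow_integral N \<delta> \<Lambda> a = ?I" by (rule negpow_integral_eq[OF Q])
    have Y0: "Y \<alpha> = 0 \<longleftrightarrow> sq_sum N N' J G \<alpha> = 0"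
    proof
      assume "Y \<alpha> = 0"
      then have 0: "Y \<alpha> ^ (2 * L2) = 0" using L by simp
      show "sq_sum N N' J G \<alpha> = 0" using G[of \<alpha>] S0[of J G \<alpha>] unfolding 0 by simp
    next
      assume "sq_sum N N' J G \<alpha> = 0"
      then have "Y \<alpha> ^ (2 * L2) \<le> 0" using G[of \<alpha>] by simp
      then show "Y \<alpha> = 0" using XY(2)[of \<alpha>] zero_less_power[of "Y \<alpha>" "2 * L2"] by linarith
    qed
    also have "\<dots> \<longleftrightarrow> (\<forall>j<J. mpoly_eval N N' (G j) a = 0)"
      unfolding sq_sum_def ev by (subst sum_nonneg_eq_0_iff) auto
    finally have inf': "?I = \<infinity> \<longleftrightarrow> (\<forall>j<J. mpoly_eval N N' (G j) a = 0)"
      using inf[OF ok] by simp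
    moreover have "?I \<le> ennreal ((A * C) * R) \<and> ennreal R \<le> ennreal (A * C) * ?I"
      if nI: "?I \<noteq> \<infinity>" and R: "R = sq_sum N N' I F \<alpha> powr ?e1 / sq_sum N N' J G \<alpha> powr ?e2" for R
    proof -
      have Y: "Y \<alpha> \<noteq> 0" "sq_sum N N' J G \<alpha> \<noteq> 0" using nI inf[OF ok] Y0 by auto
      let ?x = "X \<alpha> powr \<gamma>" and ?y = "Y \<alpha> powr \<gamma>" and ?f = "sq_sum N N' I F \<alpha> powr ?e1" and ?g = "sq_sum N N' J G \<alpha> powr ?e2"
      let ?W = "(X \<alpha> / Y \<alpha>) powr \<gamma>"
      have W: "?W = ?x / ?y" by (rule powr_divide)
      have pos: "?y > 0" "?g > 0" "?x \<ge> 0" "?f \<ge> 0" using Y by auto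
      have cF: "?x \<le> C1 powr ?e1 * ?f" "?f \<le> C1 powr ?e1 * ?x"
        using powr_comparison[OF XY(1) S0 C1 L(1) \<gamma>] F by blast+
      have cG: "?y \<le> C2 powr ?e2 * ?g" "?g \<le> C2 powr ?e2 * ?y"
        using powr_comparison[OF XY(2) S0 C2 L(2) \<gamma>] G by blast+
      have "?x * ?g \<le> (C1 powr ?e1 * ?f) * (C2 powr ?e2 * ?y)"
        using cF cG pos by (intro mult_mono) auto
      then have WR: "?W \<le> A * R" unfolding W R A_def using pos by (simp add: field_simps)
      have "?f * ?y \<le> (C1 powr ?e1 * ?x) * (C2 powr ?e2 * ?g)"
        using cF cG pos by (intro mult_mono) auto
      then have RW: "R \<le> A * ?W" unfolding W R A_def using pos by (simp add: field_simps)
      have "?I \<le> ennreal (C * ?W)" using fin[OF ok Y(1)] by simp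
      also have "\<dots> \<le> ennreal ((A * C) * R)" using WR C by (intro ennreal_leI) (simp add: mult_ac)
      finally have "?I \<le> ennreal ((A * C) * R)" .
      moreover have "ennreal R \<le> ennreal (A * C) * ?I"
      proof -
        have "ennreal R \<le> ennreal A * ennreal ?W" using RW A by (simp add: ennreal_mult'[symmetric] ennreal_leI)
        also have "\<dots> \<le> ennreal A * (ennreal C * ?I)" using fin[OF ok Y(1)] by (intro mult_left_mono) auto
        also have "\<dots> = ennreal (A * C) * ?I" using A C by (simp add: ennreal_mult mult_ac)
        finally show ?thesis .
      qed
      ultimately show ?thesis by blast
    qed
    ultimately show ?thesis unfolding I Let_def ev sq_sum_def by blast
  qed
  show ?thesis
    unfolding asymp_formula_def
    by (intro exI[of _ "A * C"] conjI allI impI) (use A C main in auto)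
qed

lemma comparable_one: "comparable N D 1 (\<lambda>_. mpoly_one) 1 (\<lambda>_. 1)"
  unfolding comparable_def sq_sum_def by (intro exI[of _ 1]) (simp add: mpoly_eval_one)

text \<open>The case N \<delta> > 2, with 2/\<delta> written as p/q. Of the q N copies p are
  discarded and \<open>T\<close> are kept.\<close>

locale clusters =
  fixes N p q T :: nat and \<delta> \<Lambda> :: real
  assumes \<delta>: "\<delta> > 0" and \<Lambda>: "\<Lambda> > 0" and q: "q > 0" "real p * \<delta> = 2 * real q"
    and T: "T + p = q * N" "T > 0" and p: "\<And>k. k \<in> {..N} \<Longrightarrow> p \<noteq> q * k"
begin

definition bounded_roots :: "(nat \<Rightarrow> complex) \<Rightarrow> bool" where
  "bounded_roots \<alpha> \<longleftrightarrow> (\<forall>i<N. cmod (\<alpha> i) < \<Lambda> / 2)"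

text \<open>The threshold distances around the zeros. The value 0 is allowed and means that more
  than 2/\<delta> zeros coincide there.\<close>

definition radii :: "(nat \<Rightarrow> complex) \<Rightarrow> (nat \<Rightarrow> real) \<Rightarrow> bool" where
  "radii \<alpha> D \<longleftrightarrow> (\<forall>i<N. D i \<in> dists \<alpha> i ` {..<N} \<and> q * card {j\<in>{..<N}. dists \<alpha> i j < D i} < p \<and>
     p < q * card {j\<in>{..<N}. dists \<alpha> i j \<le> D i})"

abbreviation wt :: "(nat \<Rightarrow> complex) \<Rightarrow> nat \<Rightarrow> real \<Rightarrow> real" where
  "wt \<alpha> i \<equiv> weight N p q (dists \<alpha> i)"

lemma pN: "p < q * N" using T by linarith

lemma N: "N > 0" using pN by (cases N) auto

lemma exists_radii: "\<exists>D. radii \<alpha> D"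
proof -
  have "\<exists>D. D \<in> dists \<alpha> i ` {..<N} \<and> q * card {j\<in>{..<N}. dists \<alpha> i j < D} < p \<and>
     p < q * card {j\<in>{..<N}. dists \<alpha> i j \<le> D}" for i
    using exists_threshold[OF pN p, of "dists \<alpha> i"] by blast
  then have "\<forall>i. \<exists>D. D \<in> dists \<alpha> i ` {..<N} \<and> q * card {j\<in>{..<N}. dists \<alpha> i j < D} < p \<and>
     p < q * card {j\<in>{..<N}. dists \<alpha> i j \<le> D}" by (rule allI)
  from choice[OF this] show ?thesis unfolding radii_def by blast
qed

lemma radiiD:
  assumes "radii \<alpha> D" "i < N"
  shows "D i \<ge> 0" "q * card {j\<in>{..<N}. dists \<alpha> i j < D i} < p" "p < q * card {j\<in>{..<N}. dists \<alpha> i j \<le> D i}"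
  using assms unfolding radii_def by auto

lemma radii_le:
  assumes "bounded_roots \<alpha>" "radii \<alpha> D" "i < N"
  shows "D i \<le> \<Lambda>"
proof -
  obtain j where j: "j < N" "D i = dists \<alpha> i j" using assms(2,3) unfolding radii_def by auto
  have "cmod (\<alpha> i) < \<Lambda> / 2" "cmod (\<alpha> j) < \<Lambda> / 2" using assms(1,3) j(1) unfolding bounded_roots_def by auto
  then show ?thesis using norm_triangle_ineq4[of "\<alpha> i" "\<alpha> j"] j(2) by linarith
qed

lemma wt_le_linear:
  assumes "radii \<alpha> D" "i < N" "D i = 0"
  shows "\<exists>K>0. \<forall>\<rho>. 0 < \<rho> \<and> \<rho> \<le> 1 \<longrightarrow> wt \<alpha> i \<rho> \<le> K * \<rho>"
  using radiiD(3)[OF assms(1,2)] assms(3) by (intro weight_le_linear) auto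

lemma root_integral_infinite:
  assumes ok: "bounded_roots \<alpha>" and D: "radii \<alpha> D" "i < N" "D i = 0"
  shows "root_integral N \<delta> \<Lambda> \<alpha> = \<infinity>"
proof (rule ccontr)
  assume "root_integral N \<delta> \<Lambda> \<alpha> \<noteq> \<infinity>"
  then obtain x where x: "x \<ge> 0" "root_integral N \<delta> \<Lambda> \<alpha> = ennreal x"
    by (cases "root_integral N \<delta> \<Lambda> \<alpha>") auto
  define c where "c = pi / 4 * (2 ^ N) powr - \<delta>"
  define \<gamma> where "\<gamma> = \<delta> / real q"
  have c: "c > 0" by (simp add: c_def)
  have \<gamma>: "\<gamma> > 0" using \<delta> q by (simp add: \<gamma>_def)
  have i: "cmod (\<alpha> i) < \<Lambda> / 2" using ok D(2) unfolding bounded_roots_def by blast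
  obtain K where K: "K > 0" "\<And>\<rho>. 0 < \<rho> \<Longrightarrow> \<rho> \<le> 1 \<Longrightarrow> wt \<alpha> i \<rho> \<le> K * \<rho>"
    using wt_le_linear[OF D] by blast
  \<comment> \<open>Small enough for the disc bound to beat the supposed value \<open>x\<close>: a
    weight of at most (c/(x+1))^(1/\<gamma>) gives c wt^(-\<gamma>) \<ge> x + 1.\<close>
  define \<rho> where "\<rho> = min (min 1 \<Lambda>) ((c / (x + 1)) powr (1 / \<gamma>) / K)"
  have \<rho>: "0 < \<rho>" "\<rho> \<le> 1" "\<rho> \<le> \<Lambda>" using \<Lambda> c x(1) K(1) by (auto simp: \<rho>_def)
  have "wt \<alpha> i \<rho> \<le> K * \<rho>" using K(2) \<rho> by blast
  also have "\<dots> \<le> K * ((c / (x + 1)) powr (1 / \<gamma>) / K)"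
    using K(1) by (intro mult_left_mono) (auto simp: \<rho>_def)
  also have "\<dots> = (c / (x + 1)) powr (1 / \<gamma>)" using K(1) by simp
  finally have "((c / (x + 1)) powr (1 / \<gamma>)) powr - \<gamma> \<le> wt \<alpha> i \<rho> powr - \<gamma>"
    using \<gamma> weight_pos[OF \<rho>(1)] by (intro powr_mono2') auto
  moreover have "((c / (x + 1)) powr (1 / \<gamma>)) powr - \<gamma> = (x + 1) / c"
    using c x(1) \<gamma> by (simp add: powr_powr powr_minus_divide)
  ultimately have "(x + 1) / c \<le> wt \<alpha> i \<rho> powr - \<gamma>" by simp
  then have "x + 1 \<le> c * wt \<alpha> i \<rho> powr - \<gamma>" using c by (simp add: pos_divide_le_eq mult.commute)
  then have "ennreal (x + 1) \<le> ennreal (c * wt \<alpha> i \<rho> powr - \<gamma>)" by (rule ennreal_leI)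
  also have "\<dots> \<le> root_integral N \<delta> \<Lambda> \<alpha>"
    unfolding c_def \<gamma>_def by (rule root_integral_ge_weight[where \<alpha> = \<alpha> and i = i, OF \<delta> q \<rho>(1,3) i])
  finally show False using x by simp
qed

text \<open>The upper bound is a sum over the zeros and the lower bound holds for each zero, so the
  integral has the order of the largest wt_i^(-\<gamma>). \<open>W\<close> stands for any quantity
  that agrees with the largest 1/wt_i up to the factor \<open>A\<close>.\<close>

lemma root_integral_two_sided:
  assumes A: "A > 0"
  shows "\<exists>C>0. \<forall>\<alpha> D W. bounded_roots \<alpha> \<longrightarrow> radii \<alpha> D \<longrightarrow> (\<forall>i<N. D i > 0) \<longrightarrow> W \<ge> 0 \<longrightarrow>
    (\<forall>i<N. 1 / wt \<alpha> i (D i) \<le> A * W) \<longrightarrow> (\<exists>i<N. W \<le> A * (1 / wt \<alpha> i (D i))) \<longrightarrow>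
    root_integral N \<delta> \<Lambda> \<alpha> \<le> ennreal (C * W powr (\<delta> / real q)) \<and>
    ennreal (W powr (\<delta> / real q)) \<le> ennreal C * root_integral N \<delta> \<Lambda> \<alpha>"
proof -
  define c where "c = pi / 4 * (2 ^ N) powr - \<delta>"
  define \<gamma> where "\<gamma> = \<delta> / real q"
  have c: "c > 0" by (simp add: c_def)
  have \<gamma>: "\<gamma> > 0" using \<delta> q by (simp add: \<gamma>_def)
  obtain B where B: "B > 0" and up: "\<And>\<alpha> D. (\<forall>i<N. D i > 0 \<and> q * card {j\<in>{..<N}. dists \<alpha> i j < D i} < p \<and>
        p < q * card {j\<in>{..<N}. dists \<alpha> i j \<le> D i}) \<Longrightarrow>
     root_integral N \<delta> \<Lambda> \<alpha> \<le> ennreal (B * (\<Sum>i<N. wt \<alpha> i (D i) powr - \<gamma>))"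
    using root_integral_le_weight[OF \<delta> q pN p, of \<Lambda>] unfolding \<gamma>_def by blast
  define C where "C = B * real N * A powr \<gamma> + A powr \<gamma> / c"
  have C: "C > 0" using A B c by (simp add: C_def add_nonneg_pos)
  have "root_integral N \<delta> \<Lambda> \<alpha> \<le> ennreal (C * W powr \<gamma>) \<and>
      ennreal (W powr \<gamma>) \<le> ennreal C * root_integral N \<delta> \<Lambda> \<alpha>"
    if ok: "bounded_roots \<alpha>" and r: "radii \<alpha> D" and D: "\<And>i. i < N \<Longrightarrow> D i > 0" and W: "W \<ge> 0"
      and le: "\<And>i. i < N \<Longrightarrow> 1 / wt \<alpha> i (D i) \<le> A * W" and ge: "\<exists>i<N. W \<le> A * (1 / wt \<alpha> i (D i))" for \<alpha> D W
  proof
    have wt: "wt \<alpha> i (D i) > 0" if "i < N" for i using D[OF that] by (rule weight_pos)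
    have inv: "wt \<alpha> i (D i) powr - \<gamma> = (1 / wt \<alpha> i (D i)) powr \<gamma>" if "i < N" for i
      using wt[OF that] by (simp add: powr_minus_divide powr_divide)
    have "root_integral N \<delta> \<Lambda> \<alpha> \<le> ennreal (B * (\<Sum>i<N. wt \<alpha> i (D i) powr - \<gamma>))"
      using up[of D \<alpha>] D radiiD[OF r] by blast
    also have "\<dots> \<le> ennreal (C * W powr \<gamma>)"
    proof (rule ennreal_leI)
      have "(\<Sum>i<N. wt \<alpha> i (D i) powr - \<gamma>) \<le> (\<Sum>i<N. (A * W) powr \<gamma>)"
      proof (rule sum_mono)
        fix i assume "i \<in> {..<N}"
        then show "wt \<alpha> i (D i) powr - \<gamma> \<le> (A * W) powr \<gamma>"
          using le[of i] wt[of i] \<gamma> by (simp add: inv powr_mono2)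
      qed
      also have "\<dots> = real N * (A powr \<gamma> * W powr \<gamma>)" using A W by (simp add: powr_mult)
      finally have "B * (\<Sum>i<N. wt \<alpha> i (D i) powr - \<gamma>) \<le> B * (real N * (A powr \<gamma> * W powr \<gamma>))"
        using B by (intro mult_left_mono) auto
      also have "\<dots> \<le> C * W powr \<gamma>" using c by (simp add: C_def algebra_simps)
      finally show "B * (\<Sum>i<N. wt \<alpha> i (D i) powr - \<gamma>) \<le> C * W powr \<gamma>" .
    qed
    finally show "root_integral N \<delta> \<Lambda> \<alpha> \<le> ennreal (C * W powr \<gamma>)" .
    obtain i where i: "i < N" "W \<le> A * (1 / wt \<alpha> i (D i))" using ge by blast
    have "W powr \<gamma> \<le> (A * (1 / wt \<alpha> i (D i))) powr \<gamma>" using W i(2) \<gamma> by (intro powr_mono2) auto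
    also have "\<dots> = A powr \<gamma> * wt \<alpha> i (D i) powr - \<gamma>" using A wt[OF i(1)] inv[OF i(1)] by (simp only: powr_mult)
    also have "\<dots> = (A powr \<gamma> / c) * (c * wt \<alpha> i (D i) powr - \<gamma>)" using c by simp
    also have "\<dots> \<le> C * (c * wt \<alpha> i (D i) powr - \<gamma>)" using c B by (intro mult_right_mono) (auto simp: C_def)
    finally have "ennreal (W powr \<gamma>) \<le> ennreal C * ennreal (c * wt \<alpha> i (D i) powr - \<gamma>)"
      using C c by (simp add: ennreal_mult'[symmetric] ennreal_leI)
    also have "\<dots> \<le> ennreal C * root_integral N \<delta> \<Lambda> \<alpha>"
    proof (rule mult_left_mono)
      have "cmod (\<alpha> i) < \<Lambda> / 2" using ok i(1) unfolding bounded_roots_def by blast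
      then show "ennreal (c * wt \<alpha> i (D i) powr - \<gamma>) \<le> root_integral N \<delta> \<Lambda> \<alpha>"
        unfolding c_def \<gamma>_def
        using root_integral_ge_weight[OF \<delta> q D[OF i(1)] radii_le[OF ok r i(1)]] by blast
    qed simp
    finally show "ennreal (W powr \<gamma>) \<le> ennreal C * root_integral N \<delta> \<Lambda> \<alpha>" .
  qed
  then show ?thesis using C unfolding \<gamma>_def by (intro exI[of _ C]) auto
qed

lemma root_integral_finite:
  assumes r: "radii \<alpha> D" and D: "\<And>i. i < N \<Longrightarrow> D i > 0"
  shows "root_integral N \<delta> \<Lambda> \<alpha> \<noteq> \<infinity>"
proof -
  obtain B where "root_integral N \<delta> \<Lambda> \<alpha> \<le> ennreal (B * (\<Sum>i<N. wt \<alpha> i (D i) powr - (\<delta> / real q)))"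
    using root_integral_le_weight[OF \<delta> q pN p, of \<Lambda>] D radiiD[OF r] by blast
  then have "root_integral N \<delta> \<Lambda> \<alpha> < \<infinity>" by (rule le_less_trans) simp
  then show ?thesis by simp
qed

text \<open>The part shared by the star and the pair formula: it suffices that X/Y follows the
  largest 1/wt_i when all thresholds are positive, and that Y vanishes when one of them is 0. The
  zero set of Y is then exactly the divergence set.\<close>

lemma comparison:
  fixes X Y :: "(nat \<Rightarrow> complex) \<Rightarrow> real"
  assumes A: "A > 0" and X: "\<And>\<alpha>. X \<alpha> \<ge> 0"
    and zero: "\<And>\<alpha> D i. radii \<alpha> D \<Longrightarrow> i < N \<Longrightarrow> D i = 0 \<Longrightarrow> Y \<alpha> = 0"
    and pos: "\<And>\<alpha> D. radii \<alpha> D \<Longrightarrow> (\<And>i. i < N \<Longrightarrow> D i > 0) \<Longrightarrow>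
      Y \<alpha> > 0 \<and> (\<forall>i<N. 1 / wt \<alpha> i (D i) \<le> A * (X \<alpha> / Y \<alpha>)) \<and>
      (\<exists>i<N. X \<alpha> / Y \<alpha> \<le> A * (1 / wt \<alpha> i (D i)))"
  shows "\<exists>C>0. \<forall>\<alpha>. bounded_roots \<alpha> \<longrightarrow> (root_integral N \<delta> \<Lambda> \<alpha> = \<infinity> \<longleftrightarrow> Y \<alpha> = 0) \<and>
    (Y \<alpha> \<noteq> 0 \<longrightarrow> root_integral N \<delta> \<Lambda> \<alpha> \<le> ennreal (C * (X \<alpha> / Y \<alpha>) powr (\<delta> / real q)) \<and>
      ennreal ((X \<alpha> / Y \<alpha>) powr (\<delta> / real q)) \<le> ennreal C * root_integral N \<delta> \<Lambda> \<alpha>)"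
proof -
  obtain C where C: "C > 0" and two: "\<And>\<alpha> D W. bounded_roots \<alpha> \<Longrightarrow> radii \<alpha> D \<Longrightarrow> (\<forall>i<N. D i > 0) \<Longrightarrow> W \<ge> 0 \<Longrightarrow>
    (\<forall>i<N. 1 / wt \<alpha> i (D i) \<le> A * W) \<Longrightarrow> (\<exists>i<N. W \<le> A * (1 / wt \<alpha> i (D i))) \<Longrightarrow>
    root_integral N \<delta> \<Lambda> \<alpha> \<le> ennreal (C * W powr (\<delta> / real q)) \<and>
    ennreal (W powr (\<delta> / real q)) \<le> ennreal C * root_integral N \<delta> \<Lambda> \<alpha>"
    using root_integral_two_sided[OF A] by blast
  show ?thesis
  proof (intro exI[of _ C] conjI[OF C] allI impI)
    fix \<alpha> assume ok: "bounded_roots \<alpha>"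
    obtain D where r: "radii \<alpha> D" using exists_radii by blast
    show "(root_integral N \<delta> \<Lambda> \<alpha> = \<infinity> \<longleftrightarrow> Y \<alpha> = 0) \<and>
      (Y \<alpha> \<noteq> 0 \<longrightarrow> root_integral N \<delta> \<Lambda> \<alpha> \<le> ennreal (C * (X \<alpha> / Y \<alpha>) powr (\<delta> / real q)) \<and>
      ennreal ((X \<alpha> / Y \<alpha>) powr (\<delta> / real q)) \<le> ennreal C * root_integral N \<delta> \<Lambda> \<alpha>)"
    proof (cases "\<exists>i<N. D i = 0")
      case True
      then show ?thesis using zero[OF r] root_integral_infinite[OF ok r] by blast
    next
      case False
      then have D: "D i > 0" if "i < N" for i using radiiD(1)[OF r that] that by force
      note Y = pos[OF r D]
      have "X \<alpha> / Y \<alpha> \<ge> 0" using X[of \<alpha>] Y by simp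
      then show ?thesis using two[OF ok r, of "X \<alpha> / Y \<alpha>"] D Y root_integral_finite[OF r D] by auto
    qed
  qed
qed

section \<open>Comparison through star sums\<close>

lemma star_sum_ge_wt:
  assumes r: "radii \<alpha> D" and i: "i < N" "D i > 0"
  shows "wt \<alpha> i (D i) \<le> star_sum N q T \<alpha> i"
proof -
  obtain ys where ys: "ys \<in> dlists T ({..<N} \<times> {..<q})" "(\<Prod>l<T. dists \<alpha> i (fst (ys ! l))) = wt \<alpha> i (D i)"
    using weight_eq_star[OF T(1) i(2) radiiD(2,3)[OF r i(1)]] by blast
  then show ?thesis
    unfolding star_sum_def ys(2)[symmetric]
    by (intro member_le_sum) (auto intro!: prod_nonneg finite_dlists)
qed

lemma star_sum_le_weight:
  assumes "\<rho> > 0"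
  shows "star_sum N q T \<alpha> i \<le> real (card (dlists T ({..<N} \<times> {..<q}))) * wt \<alpha> i \<rho>"
  unfolding star_sum_def
  by (intro sum_bounded_above star_le_weight[where d = "dists \<alpha> i"] T(1) assms) auto

lemma star_sum_nonneg: "star_sum N q T \<alpha> i \<ge> 0"
  unfolding star_sum_def by (intro sum_nonneg prod_nonneg) auto

lemma eq_0_of_le_weight:
  assumes r: "radii \<alpha> D" "i < N" "D i = 0" and x: "x \<ge> 0" and B: "B \<ge> 0"
    and le: "\<And>\<rho>. \<rho> > 0 \<Longrightarrow> x \<le> B * wt \<alpha> i \<rho>"
  shows "x = 0"
proof -
  obtain K where K: "K > 0" "\<And>\<rho>. 0 < \<rho> \<Longrightarrow> \<rho> \<le> 1 \<Longrightarrow> wt \<alpha> i \<rho> \<le> K * \<rho>"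
    using wt_le_linear[OF r] by blast
  show ?thesis
  \<comment> \<open>\<open>B\<close> may be 0 while the linear bound requires a positive slope,
    hence \<open>B + 1\<close>.\<close>
  proof (rule eq_0_of_le_linear[OF x, of "(B + 1) * K"])
    show "(B + 1) * K > 0" using B K(1) by simp
    fix \<rho> :: real assume \<rho>: "0 < \<rho>" "\<rho> \<le> 1"
    have "x \<le> B * wt \<alpha> i \<rho>" by (rule le[OF \<rho>(1)])
    also have "\<dots> \<le> (B + 1) * (K * \<rho>)"
      using K(2)[OF \<rho>] B weight_pos[OF \<rho>(1), of N p q "dists \<alpha> i"] by (intro mult_mono) auto
    finally show "x \<le> (B + 1) * K * \<rho>" by (simp add: mult.assoc)
  qed
qed

lemma star_sum_eq_0:
  assumes "radii \<alpha> D" "i < N" "D i = 0"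
  shows "star_sum N q T \<alpha> i = 0"
  by (rule eq_0_of_le_weight[OF assms star_sum_nonneg _ star_sum_le_weight]) auto

text \<open>This is m! times the elementary symmetric function of degree m of the N star sums.
  Degree N gives their product and degree N - 1 the sum of all products omitting one factor, so the
  quotient has the order of the reciprocal of the smallest star sum.\<close>

definition star_prod :: "nat \<Rightarrow> (nat \<Rightarrow> complex) \<Rightarrow> real" where
  "star_prod m \<alpha> = (\<Sum>xs\<in>dlists m {..<N}. \<Prod>i<m. star_sum N q T \<alpha> (xs ! i))"

lemma star_prod_nonneg: "star_prod m \<alpha> \<ge> 0"
  unfolding star_prod_def by (intro sum_nonneg prod_nonneg) (auto simp: star_sum_nonneg)

lemma star_prod_N:
  "star_prod N \<alpha> = real (card (dlists N {..<N})) * (\<Prod>i<N. star_sum N q T \<alpha> i)"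
proof -
  have "(\<Prod>i<N. star_sum N q T \<alpha> (xs ! i)) = (\<Prod>i<N. star_sum N q T \<alpha> i)" if "xs \<in> dlists N {..<N}" for xs
  proof -
    have "set xs = {..<N}"
      using dlistsD[OF that] distinct_card[of xs] by (intro card_subset_eq) auto
    then show ?thesis
      using prod_nth_distinct[OF dlistsD(2,1)[OF that]] by metis
  qed
  then show ?thesis by (simp add: star_prod_def)
qed

lemma card_dlists_N: "card (dlists N {..<N}) > 0"
proof -
  have "[0..<N] \<in> dlists N {..<N}" by (auto simp: dlists_def)
  then show ?thesis using finite_dlists[of "{..<N}" N] by (auto simp: card_gt_0_iff)
qed

lemma star_prod_pred_ge:
  assumes pos: "\<And>i. i < N \<Longrightarrow> star_sum N q T \<alpha> i > 0" and i: "i < N"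
  shows "(\<Prod>i<N. star_sum N q T \<alpha> i) / star_sum N q T \<alpha> i \<le> star_prod (N - 1) \<alpha>"
proof -
  obtain xs where xs: "set xs = {..<N} - {i}" "distinct xs"
    using finite_distinct_list[of "{..<N} - {i}"] by auto
  have len: "length xs = N - 1" using xs i distinct_card[OF xs(2)] by simp
  have "(\<Prod>j<N. star_sum N q T \<alpha> j) = star_sum N q T \<alpha> i * (\<Prod>j\<in>{..<N} - {i}. star_sum N q T \<alpha> j)"
    using i by (intro prod.remove) auto
  then have "(\<Prod>j<N. star_sum N q T \<alpha> j) / star_sum N q T \<alpha> i = (\<Prod>j<N - 1. star_sum N q T \<alpha> (xs ! j))"
    using pos[OF i] prod_nth_distinct[OF xs(2) len, of "star_sum N q T \<alpha>"] xs(1) by simp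
  also have "\<dots> \<le> star_prod (N - 1) \<alpha>"
    unfolding star_prod_def
  proof (rule member_le_sum)
    show "xs \<in> dlists (N - 1) {..<N}" using xs len by (auto simp: dlists_def)
  qed (auto simp: star_sum_nonneg finite_dlists intro!: prod_nonneg)
  finally show ?thesis .
qed

text \<open>A list of length N - 1 without repetition omits a single index j, so its product is
  P/u_j. This is largest for the smallest u_j, whose index is the witness.\<close>

lemma star_prod_pred_le:
  assumes pos: "\<And>i. i < N \<Longrightarrow> star_sum N q T \<alpha> i > 0"
  shows "\<exists>i<N. star_prod (N - 1) \<alpha> \<le>
    real (card (dlists (N - 1) {..<N})) * ((\<Prod>i<N. star_sum N q T \<alpha> i) / star_sum N q T \<alpha> i)"
proof -
  let ?u = "star_sum N q T \<alpha>" and ?P = "\<Prod>i<N. star_sum N q T \<alpha> i"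
  obtain i where i: "i < N" "\<And>j. j < N \<Longrightarrow> ?u i \<le> ?u j"
    using ex_min_if_finite[of "?u ` {..<N}"] N by (auto simp: not_less)
  have P: "?P > 0" using pos by (intro prod_pos) auto
  have "star_prod (N - 1) \<alpha> \<le> real (card (dlists (N - 1) {..<N})) * (?P / ?u i)"
    unfolding star_prod_def
  proof (rule sum_bounded_above)
    fix xs assume xs: "xs \<in> dlists (N - 1) {..<N}"
    have "card ({..<N} - set xs) = 1"
      using dlistsD[OF xs] distinct_card[of xs] N by (subst card_Diff_subset) auto
    then obtain j where j: "{..<N} - set xs = {j}" by (auto simp: card_1_singleton_iff)
    then have jN: "j < N" and set: "set xs = {..<N} - {j}" using dlistsD(3)[OF xs] by auto
    have "?P = ?u j * (\<Prod>j\<in>{..<N} - {j}. ?u j)" using jN by (intro prod.remove) auto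
    then have "(\<Prod>l<N - 1. ?u (xs ! l)) = ?P / ?u j"
      using prod_nth_distinct[OF dlistsD(2,1)[OF xs], of ?u] pos[OF jN] set by simp
    also have "\<dots> \<le> ?P / ?u i" using P pos i jN by (intro divide_left_mono) auto
    finally show "(\<Prod>l<N - 1. ?u (xs ! l)) \<le> ?P / ?u i" .
  qed
  then show ?thesis using i(1) by blast
qed

lemma comparison_star:
  "\<exists>C>0. \<forall>\<alpha>. bounded_roots \<alpha> \<longrightarrow> (root_integral N \<delta> \<Lambda> \<alpha> = \<infinity> \<longleftrightarrow> star_prod N \<alpha> = 0) \<and>
    (star_prod N \<alpha> \<noteq> 0 \<longrightarrow>
      root_integral N \<delta> \<Lambda> \<alpha> \<le> ennreal (C * (star_prod (N - 1) \<alpha> / star_prod N \<alpha>) powr (\<delta> / real q)) \<and>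
      ennreal ((star_prod (N - 1) \<alpha> / star_prod N \<alpha>) powr (\<delta> / real q)) \<le> ennreal C * root_integral N \<delta> \<Lambda> \<alpha>)"
proof -
  define c0 where "c0 = real (card (dlists T ({..<N} \<times> {..<q})))"
  define cN where "cN = real (card (dlists N {..<N}))"
  define cM where "cM = real (card (dlists (N - 1) {..<N}))"
  \<comment> \<open>\<open>c0\<close> counts the terms of a star sum, \<open>cN\<close> is N!, and
    \<open>cM\<close> counts the lists that omit one index; the first product serves the upper
    bounds on 1/wt_i, \<open>cM\<close> the converse, and 1 makes \<open>A\<close> positive.\<close>
  define A where "A = c0 * cN + cM + 1"
  have c: "c0 \<ge> 0" "cN \<ge> 1" "cM \<ge> 0"
    using card_dlists_N by (auto simp: c0_def cN_def cM_def)
  have A: "A > 0" "c0 * cN \<le> A" "cM \<le> A" using c by (auto simp: A_def add_nonneg_pos)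
  show ?thesis
  proof (rule comparison[OF A(1) star_prod_nonneg])
    fix \<alpha> D i assume "radii \<alpha> D" "i < N" "D i = 0"
    then have "star_sum N q T \<alpha> i = 0" by (rule star_sum_eq_0)
    then have "(\<Prod>i<N. star_sum N q T \<alpha> i) = 0" using \<open>i < N\<close> by (intro prod_zero) auto
    then show "star_prod N \<alpha> = 0" unfolding star_prod_N by simp
  next
    fix \<alpha> D assume r: "radii \<alpha> D" and D: "\<And>i. i < N \<Longrightarrow> D i > 0"
    let ?u = "star_sum N q T \<alpha>" and ?X = "star_prod (N - 1) \<alpha>"
    let ?W = "?X / star_prod N \<alpha>"
    define P where "P = (\<Prod>i<N. ?u i)"
    have wt: "wt \<alpha> i (D i) > 0" if "i < N" for i using D[OF that] by (rule weight_pos)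
    have ge: "wt \<alpha> i (D i) \<le> ?u i" if "i < N" for i using star_sum_ge_wt[OF r that D[OF that]] .
    have le: "?u i \<le> c0 * wt \<alpha> i (D i)" if "i < N" for i
      unfolding c0_def by (rule star_sum_le_weight[OF D[OF that]])
    have u: "?u i > 0" if "i < N" for i using wt[OF that] ge[OF that] by linarith
    have P: "P > 0" unfolding P_def using u by (intro prod_pos) auto
    have Y: "star_prod N \<alpha> = cN * P" by (simp add: star_prod_N cN_def P_def)
    have W0: "?W \<ge> 0" by (intro divide_nonneg_nonneg star_prod_nonneg)
    have "1 / wt \<alpha> i (D i) \<le> A * ?W" if i: "i < N" for i
    proof -
      have "1 / wt \<alpha> i (D i) \<le> c0 * (1 / ?u i)" using le[OF i] u[OF i] wt[OF i] by (simp add: field_simps)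
      also have "1 / ?u i = (P / ?u i) / P" using P by simp
      also have "\<dots> \<le> ?X / P" using star_prod_pred_ge[OF u i] P by (intro divide_right_mono) (auto simp: P_def)
      also have "\<dots> = cN * ?W" using c P by (simp add: Y)
      finally have "1 / wt \<alpha> i (D i) \<le> c0 * (cN * ?W)" using c by (simp add: mult_left_mono)
      also have "\<dots> \<le> A * ?W" using mult_right_mono[OF A(2) W0] by (simp add: mult.assoc)
      finally show ?thesis .
    qed
    moreover have "\<exists>i<N. ?W \<le> A * (1 / wt \<alpha> i (D i))"
    proof -
      obtain i where i: "i < N" "?X \<le> cM * (P / ?u i)"
        using star_prod_pred_le[OF u] unfolding cM_def P_def by blast
      have "?W \<le> ?X / P" unfolding Y using c P star_prod_nonneg[of "N - 1" \<alpha>]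
        by (intro divide_left_mono) auto
      also have "\<dots> \<le> cM * (P / ?u i) / P" using i(2) P by (intro divide_right_mono) auto
      also have "\<dots> = cM * (1 / ?u i)" using P by simp
      also have "\<dots> \<le> A * (1 / wt \<alpha> i (D i))"
        using ge[OF i(1)] wt[OF i(1)] A c by (intro mult_mono divide_left_mono) auto
      finally show ?thesis using i(1) by blast
    qed
    ultimately show "star_prod N \<alpha> > 0 \<and> (\<forall>i<N. 1 / wt \<alpha> i (D i) \<le> A * ?W) \<and> (\<exists>i<N. ?W \<le> A * (1 / wt \<alpha> i (D i)))"
      using P c by (simp add: Y)
  qed
qed

section \<open>Comparison through disjoint pairs\<close>

lemma comparison_pair:
  assumes T2: "2 * T \<le> q * N"
  shows "\<exists>C>0. \<forall>\<alpha>. bounded_roots \<alpha> \<longrightarrow> (root_integral N \<delta> \<Lambda> \<alpha> = \<infinity> \<longleftrightarrow> pair_sum N q T \<alpha> = 0) \<and>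
    (pair_sum N q T \<alpha> \<noteq> 0 \<longrightarrow> root_integral N \<delta> \<Lambda> \<alpha> \<le> ennreal (C * (1 / pair_sum N q T \<alpha>) powr (\<delta> / real q)) \<and>
      ennreal ((1 / pair_sum N q T \<alpha>) powr (\<delta> / real q)) \<le> ennreal C * root_integral N \<delta> \<Lambda> \<alpha>)"
proof -
  let ?E = "pair_sum N q T"
  define c0 where "c0 = real (card (dlists (T + T) ({..<N} \<times> {..<q}))) * 2 ^ T"
  define c1 where "c1 = (3::real) ^ ((N + 2) * (q * N))"
  define A where "A = c0 + c1"
  have c: "c0 \<ge> 0" "c1 > 0" by (auto simp: c0_def c1_def)
  have A: "A > 0" "c0 \<le> A" "c1 \<le> A" using c by (auto simp: A_def)
  have E0: "?E \<alpha> \<ge> 0" for \<alpha> unfolding pair_sum_def by (intro sum_nonneg prod_nonneg) auto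
  \<comment> \<open>This holds for every centre, so the pair sum is controlled by the smallest
    weight at once and the numerator can be 1.\<close>
  have le: "?E \<alpha> \<le> c0 * wt \<alpha> i \<rho>" if "\<rho> > 0" for \<alpha> i \<rho>
    unfolding pair_sum_def c0_def mult.assoc
    by (intro sum_bounded_above pairs_le_weight T(1) T2 that)
  show ?thesis
  proof (rule comparison[OF A(1), where X = "\<lambda>_. 1"])
    fix \<alpha> D i assume "radii \<alpha> D" "i < N" "D i = 0"
    then show "?E \<alpha> = 0" using eq_0_of_le_weight[of \<alpha> D i "?E \<alpha>" c0] E0 c(1) le by blast
  next
    fix \<alpha> D assume r: "radii \<alpha> D" and D: "\<And>i. i < N \<Longrightarrow> D i > 0"
    have wt: "wt \<alpha> i (D i) > 0" if "i < N" for i using D[OF that] by (rule weight_pos)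
    \<comment> \<open>The zero with the smallest threshold is taken: around every zero fewer than p
      copies then lie within this one distance, as the pairing inside the cluster requires.\<close>
    obtain i where i: "i < N" "\<And>j. j < N \<Longrightarrow> D i \<le> D j"
      using ex_min_if_finite[of "D ` {..<N}"] N by (auto simp: not_less)
    have lo: "q * card {j'\<in>{..<N}. dists \<alpha> j j' < D i} < p" if j: "j < N" for j
    proof -
      have "card {j'\<in>{..<N}. dists \<alpha> j j' < D i} \<le> card {j'\<in>{..<N}. dists \<alpha> j j' < D j}"
        using i(2)[OF j] by (intro card_mono) auto
      then show ?thesis using radiiD(2)[OF r j] by (meson le_less_trans mult_le_mono2)
    qed
    obtain xs where xs: "xs \<in> dlists (T + T) ({..<N} \<times> {..<q})"
      "wt \<alpha> i (D i) \<le> c1 * (\<Prod>l<T. cmod (\<alpha> (fst (xs ! l)) - \<alpha> (fst (xs ! (T + l)))))"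
      unfolding c1_def using pairs_ge_weight[OF T(1) T2 D[OF i(1)] lo radiiD(3)[OF r i(1)]] by blast
    have "(\<Prod>l<T. cmod (\<alpha> (fst (xs ! l)) - \<alpha> (fst (xs ! (T + l))))) \<le> ?E \<alpha>"
      unfolding pair_sum_def using xs(1) by (intro member_le_sum) (auto intro!: prod_nonneg finite_dlists)
    then have ge: "wt \<alpha> i (D i) \<le> c1 * ?E \<alpha>" using xs(2) c(2) by (meson less_imp_le mult_left_mono order_trans)
    have E: "?E \<alpha> > 0" using ge wt[OF i(1)] c(2) by (smt (verit) zero_less_mult_pos)
    have "1 / wt \<alpha> j (D j) \<le> A * (1 / ?E \<alpha>)" if j: "j < N" for j
    proof -
      have "?E \<alpha> \<le> A * wt \<alpha> j (D j)"
        using le[OF D[OF j], of \<alpha> j] mult_right_mono[OF A(2), of "wt \<alpha> j (D j)"] wt[OF j] by linarith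
      then show ?thesis using E wt[OF j] by (simp add: field_simps)
    qed
    moreover have "1 / ?E \<alpha> \<le> A * (1 / wt \<alpha> i (D i))"
    proof -
      have "wt \<alpha> i (D i) \<le> A * ?E \<alpha>" using ge mult_right_mono[OF A(3), of "?E \<alpha>"] E by linarith
      then show ?thesis using E wt[OF i(1)] by (simp add: field_simps)
    qed
    ultimately show "?E \<alpha> > 0 \<and> (\<forall>i<N. 1 / wt \<alpha> i (D i) \<le> A * (1 / ?E \<alpha>)) \<and>
        (\<exists>i<N. 1 / ?E \<alpha> \<le> A * (1 / wt \<alpha> i (D i)))"
      using E i(1) by blast
  qed simp
qed

lemma asymp_formula_star:
  assumes "\<delta> \<in> \<rat>"
  shows "\<exists>N' I J. \<exists>\<epsilon>' \<delta>' :: real. \<exists>F G. \<epsilon>' \<in> \<rat> \<and> \<delta>' \<in> \<rat> \<and> asymp_formula N \<delta> \<Lambda> N' I J \<epsilon>' \<delta>' F G"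
proof -
  have \<gamma>: "\<delta> / real q > 0" "\<delta> / real q \<in> \<rat>" using \<delta> q assms by auto
  have "repres N (star_prod (N - 1))" "repres N (star_prod N)"
    using repres_star_sum_prod[of N] unfolding star_prod_def by auto
  then obtain L1 I D1 L2 J D2 where L: "L1 > 0" "L2 > 0"
    and "\<forall>D\<ge>D1. \<exists>F. comparable N D I F L1 (star_prod (N - 1))"
    and "\<forall>D\<ge>D2. \<exists>G. comparable N D J G L2 (star_prod N)"
    unfolding repres_def by blast
  \<comment> \<open>Both representations are available at every large degree, so the maximum of the
    two bounds serves numerator and denominator alike.\<close>
  then obtain F G where F: "comparable N (max D1 D2) I F L1 (star_prod (N - 1))"
    and G: "comparable N (max D1 D2) J G L2 (star_prod N)"
    by (meson max.cobounded1 max.cobounded2)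
  obtain C where C: "C > 0" and cmp: "\<forall>\<alpha>. bounded_roots \<alpha> \<longrightarrow> (root_integral N \<delta> \<Lambda> \<alpha> = \<infinity> \<longleftrightarrow> star_prod N \<alpha> = 0) \<and>
    (star_prod N \<alpha> \<noteq> 0 \<longrightarrow>
      root_integral N \<delta> \<Lambda> \<alpha> \<le> ennreal (C * (star_prod (N - 1) \<alpha> / star_prod N \<alpha>) powr (\<delta> / real q)) \<and>
      ennreal ((star_prod (N - 1) \<alpha> / star_prod N \<alpha>) powr (\<delta> / real q)) \<le> ennreal C * root_integral N \<delta> \<Lambda> \<alpha>)"
    using comparison_star by blast
  have "asymp_formula N \<delta> \<Lambda> (max D1 D2) I J (\<delta> / real q / real L1) (\<delta> / real q / real L2) F G"
    by (rule asymp_formulaI[OF \<gamma>(1) L C star_prod_nonneg star_prod_nonneg F G])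
       (use cmp in \<open>auto simp: bounded_roots_def\<close>)
  moreover have "\<delta> / real q / real L1 \<in> \<rat>" "\<delta> / real q / real L2 \<in> \<rat>" by (intro Rats_divide \<gamma>(2) Rats_of_nat)+
  ultimately show ?thesis by blast
qed

lemma asymp_formula_pair:
  assumes "\<delta> \<in> \<rat>" and T2: "2 * T \<le> q * N"
  shows "\<exists>N' J. \<exists>\<epsilon>' \<delta>' :: real. \<exists>G. \<epsilon>' \<in> \<rat> \<and> \<delta>' \<in> \<rat> \<and> asymp_formula N \<delta> \<Lambda> N' 1 J \<epsilon>' \<delta>' (\<lambda>_. mpoly_one) G"
proof -
  have \<gamma>: "\<delta> / real q > 0" "\<delta> / real q \<in> \<rat>" using \<delta> q assms by auto
  obtain L2 J D2 G where L: "L2 > 0" and G: "comparable N D2 J G L2 (pair_sum N q T)"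
    using repres_pair_sum[of N q T] unfolding repres_def by blast
  obtain C where C: "C > 0" and cmp: "\<forall>\<alpha>. bounded_roots \<alpha> \<longrightarrow> (root_integral N \<delta> \<Lambda> \<alpha> = \<infinity> \<longleftrightarrow> pair_sum N q T \<alpha> = 0) \<and>
    (pair_sum N q T \<alpha> \<noteq> 0 \<longrightarrow> root_integral N \<delta> \<Lambda> \<alpha> \<le> ennreal (C * (1 / pair_sum N q T \<alpha>) powr (\<delta> / real q)) \<and>
      ennreal ((1 / pair_sum N q T \<alpha>) powr (\<delta> / real q)) \<le> ennreal C * root_integral N \<delta> \<Lambda> \<alpha>)"
    using comparison_pair[OF T2] by blast
  have E0: "pair_sum N q T \<alpha> \<ge> 0" for \<alpha> unfolding pair_sum_def by (intro sum_nonneg prod_nonneg) auto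
  have "asymp_formula N \<delta> \<Lambda> D2 1 J (\<delta> / real q / real 1) (\<delta> / real q / real L2) (\<lambda>_. mpoly_one) G"
    by (rule asymp_formulaI[OF \<gamma>(1) _ L C _ E0 comparable_one G])
       (use cmp in \<open>auto simp: bounded_roots_def\<close>)
  moreover have "\<delta> / real q / real 1 \<in> \<rat>" "\<delta> / real q / real L2 \<in> \<rat>" by (intro Rats_divide \<gamma>(2) Rats_of_nat)+
  ultimately show ?thesis by blast
qed

end

text \<open>Here the integral stays between two positive constants. The constant polynomial 1 in
  numerator and denominator therefore works with degree bound 0: it never vanishes and the integral
  is never infinite.\<close>

lemma asymp_formula_bounded:
  assumes \<delta>: "\<delta> > 0" "real N * \<delta> < 2" and \<Lambda>: "\<Lambda> > 0"
  shows "asymp_formula N \<delta> \<Lambda> 0 1 1 1 1 (\<lambda>_. mpoly_one) (\<lambda>_. mpoly_one)"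
proof -
  obtain C where C: "C > 0" "\<And>\<alpha>. (\<forall>i<N. cmod (\<alpha> i) < \<Lambda> / 2) \<Longrightarrow> root_integral N \<delta> \<Lambda> \<alpha> \<le> ennreal C"
    using root_integral_le_const[OF \<delta> \<Lambda>] by blast
  obtain c where c: "c > 0" "\<And>\<alpha>. (\<forall>i<N. cmod (\<alpha> i) < \<Lambda> / 2) \<Longrightarrow> ennreal c \<le> root_integral N \<delta> \<Lambda> \<alpha>"
    using root_integral_ge_const[OF \<delta>(1) \<Lambda>] by blast
  have up: "root_integral N \<delta> \<Lambda> \<alpha> \<le> ennreal (C + 1 / c)" if "\<forall>i<N. cmod (\<alpha> i) < \<Lambda> / 2" for \<alpha>
    using c(1) by (intro order_trans[OF C(2)[OF that]] ennreal_leI) simp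
  have lo: "1 \<le> ennreal (C + 1 / c) * root_integral N \<delta> \<Lambda> \<alpha>" if "\<forall>i<N. cmod (\<alpha> i) < \<Lambda> / 2" for \<alpha>
  proof -
    have "1 \<le> (C + 1 / c) * c" using C(1) c(1) by (simp add: field_simps)
    then have "ennreal 1 \<le> ennreal ((C + 1 / c) * c)" by (rule ennreal_leI)
    also have "\<dots> = ennreal (C + 1 / c) * ennreal c" using C(1) c(1) by (intro ennreal_mult) auto
    also have "\<dots> \<le> ennreal (C + 1 / c) * root_integral N \<delta> \<Lambda> \<alpha>" using c(2)[OF that] by (intro mult_left_mono) auto
    finally show ?thesis by simp
  qed
  have fin: "root_integral N \<delta> \<Lambda> \<alpha> \<noteq> \<infinity>" if "\<forall>i<N. cmod (\<alpha> i) < \<Lambda> / 2" for \<alpha>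
    using C(2)[OF that] by (metis ennreal_less_top infinity_ennreal_def not_less)
  have "asymp_formula N \<delta> \<Lambda> 0 1 1 (1 / real 1) (1 / real 1) (\<lambda>_. mpoly_one) (\<lambda>_. mpoly_one)"
    by (rule asymp_formulaI[where C = "C + 1 / c", OF _ _ _ _ _ _ comparable_one comparable_one])
       (use C(1) c(1) up lo fin in \<open>auto simp: add_pos_pos\<close>)
  then show ?thesis by simp
qed

theorem theorem3:
  fixes N :: nat and \<Lambda> \<delta> :: real
  assumes "\<Lambda> > 0" and "\<delta> \<in> \<rat>" and "\<delta> > 0"
    and "\<forall>k\<in>{1..N}. 2 / \<delta> \<noteq> real k"
  shows "(\<exists>N' I J :: nat. \<exists>\<epsilon>' \<delta>' :: real. \<exists>F G.
            \<epsilon>' \<in> \<rat> \<and> \<delta>' \<in> \<rat> \<and> asymp_formula N \<delta> \<Lambda> N' I J \<epsilon>' \<delta>' F G)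
       \<and> (real N * \<delta> < 4 \<longrightarrow>
           (\<exists>N' J :: nat. \<exists>\<epsilon>' \<delta>' :: real. \<exists>G.
            \<epsilon>' \<in> \<rat> \<and> \<delta>' \<in> \<rat> \<and> asymp_formula N \<delta> \<Lambda> N' 1 J \<epsilon>' \<delta>' (\<lambda>_. mpoly_one) G))"
proof (cases "real N * \<delta> < 2")
  case True
  then show ?thesis
    using asymp_formula_bounded[OF assms(3) True assms(1)] Rats_1 by blast
next
  case False
  have "2 / \<delta> \<in> \<rat>" using assms(2) by auto
  then obtain p q :: nat where q0: "q \<noteq> 0" and pq: "\<bar>2 / \<delta>\<bar> = real p / real q"
    by (rule Rats_abs_nat_div_natE)
  have q: "q > 0" "real p * \<delta> = 2 * real q" using q0 pq assms(3) by (auto simp: field_simps)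
  \<comment> \<open>The index 0 is included; it is excluded as a value because 2/\<delta> is
    positive.\<close>
  have pk: "p \<noteq> q * k" if "k \<in> {..N}" for k
  proof
    assume "p = q * k"
    then have k: "2 / \<delta> = real k" using pq q0 assms(3) by simp
    then have "k \<noteq> 0" using assms(3) by (intro notI) simp
    then show False using assms(4) that k by auto
  qed
  have "2 * real q \<le> real N * \<delta> * real q" using False by (intro mult_right_mono) auto
  then have "real p * \<delta> \<le> (real q * real N) * \<delta>" using q(2) by (simp add: mult_ac)
  then have "real p \<le> real (q * N)" using assms(3) by simp
  then have "p \<le> q * N" by (simp only: of_nat_le_iff)
  \<comment> \<open>The instance k = N rules out N \<delta> = 2, the borderline between the two
    cases.\<close>
  then have pN: "p < q * N" using pk[of N] by simp
  then have T: "q * N - p + p = q * N" "q * N - p > 0" by auto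
  interpret clusters N p q "q * N - p" \<delta> \<Lambda>
    by unfold_locales (fact assms q T pk)+
  \<comment> \<open>In terms of p and q, N \<delta> < 4 gives q N \<le> 2p, which is the room needed
    for q N - p disjoint pairs among q N copies.\<close>
  have "2 * (q * N - p) \<le> q * N" if "real N * \<delta> < 4"
  proof -
    have "real N * \<delta> * real q \<le> 4 * real q" using that by (intro mult_right_mono) auto
    then have "(real q * real N) * \<delta> \<le> (2 * real p) * \<delta>" using q(2) by (simp add: mult_ac)
    then have "real (q * N) \<le> real (2 * p)" using assms(3) by simp
    then show ?thesis by linarith
  qed
  note T2 = this
  show ?thesis
  proof (intro conjI impI)
    show "\<exists>N' I J :: nat. \<exists>\<epsilon>' \<delta>' :: real. \<exists>F G.
        \<epsilon>' \<in> \<rat> \<and> \<delta>' \<in> \<rat> \<and> asymp_formula N \<delta> \<Lambda> N' I J \<epsilon>' \<delta>' F G"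
      by (rule asymp_formula_star[OF assms(2)])
    assume "real N * \<delta> < 4"
    then show "\<exists>N' J :: nat. \<exists>\<epsilon>' \<delta>' :: real. \<exists>G.
        \<epsilon>' \<in> \<rat> \<and> \<delta>' \<in> \<rat> \<and> asymp_formula N \<delta> \<Lambda> N' 1 J \<epsilon>' \<delta>' (\<lambda>_. mpoly_one) G"
      by (intro asymp_formula_pair[OF assms(2)] T2)
  qed
qed

end
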